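(* Every object in a complete exceptional sequence for the linearly oriented quiver of type $A_n$ is either relatively projective or relatively injective (or both), and at least one object of the sequence is both relatively projective and relatively injective.
   Context: Let $n\ge1$, $K$ a field, $Q: 1\to 2\to\cdots\to n$, $\Lambda=KQ$; modules are finite-dimensional representations of $Q$ over $K$, and $\mathrm{Ext}$ means $\mathrm{Ext}^1_\Lambda$. A complete exceptional sequence is a sequence $(E_1,\dots,E_n)$ of rigid indecomposable modules such that $\mathrm{Hom}(E_j,E_i)=0=\mathrm{Ext}(E_j,E_i)$ for all $i<j$. For a module $Z$, $Z^\perp$ is the full subcategory of modules $Y$ with $\mathrm{Hom}(Z,Y)=0=\mathrm{Ext}(Z,Y)$, and ${}^\perp Z$ is the full subcategory of modules $X$ with $\mathrm{Hom}(X,Z)=0=\mathrm{Ext}(X,Z)$. $E_i$ is relatively projective in the sequence if it is a projective object of $(E_{i+1}\oplus\cdots\oplus E_n)^\perp$, and relatively injective if it is an injective object of ${}^\perp(E_1\oplus\cdots\oplus E_{i-1})$. *)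

theory Defs
  imports "Jordan_Normal_Form.Matrix_Kernel" "HOL-Library.FuncSet"
begin

text \<open>
  A finite-dimensional representation of the quiver with vertices \<open>1, \<dots>, n\<close> and arrows
  \<open>i \<rightarrow> i + 1\<close> over a field \<open>'k\<close> is given in coordinates: the space at vertex \<open>i\<close> is
  \<open>'k\<close> to the power \<open>dimv M i\<close>, and the arrow \<open>i \<rightarrow> i + 1\<close> acts by left multiplication with
  \<open>arr M i\<close>. Values of \<open>dimv\<close> outside \<open>{1..n}\<close> and of \<open>arr\<close> outside \<open>{1..<n}\<close> are irrelevant.
\<close>

record 'k rep =
  dimv :: "nat \<Rightarrow> nat"
  arr :: "nat \<Rightarrow> 'k mat"

definition is_rep :: "nat \<Rightarrow> 'k rep \<Rightarrow> bool" where
  "is_rep n M \<longleftrightarrow> (\<forall>i\<in>{1..<n}. arr M i \<in> carrier_mat (dimv M (i + 1)) (dimv M i))"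

definition Hom :: "nat \<Rightarrow> 'k::field rep \<Rightarrow> 'k rep \<Rightarrow> (nat \<Rightarrow> 'k mat) set" where
  "Hom n X Y = {f \<in> (\<Pi>\<^sub>E i\<in>{1..n}. carrier_mat (dimv Y i) (dimv X i)).
     \<forall>i\<in>{1..<n}. f (i + 1) * arr X i = arr Y i * f i}"

definition comp_hom ::
  "nat \<Rightarrow> (nat \<Rightarrow> 'k::field mat) \<Rightarrow> (nat \<Rightarrow> 'k mat) \<Rightarrow> nat \<Rightarrow> 'k mat" where
  "comp_hom n g f = (\<lambda>i\<in>{1..n}. g i * f i)"

definition id_hom :: "nat \<Rightarrow> 'k::field rep \<Rightarrow> nat \<Rightarrow> 'k mat" where
  "id_hom n X = (\<lambda>i\<in>{1..n}. 1\<^sub>m (dimv X i))"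

definition zero_hom :: "nat \<Rightarrow> 'k::field rep \<Rightarrow> 'k rep \<Rightarrow> nat \<Rightarrow> 'k mat" where
  "zero_hom n X Y = (\<lambda>i\<in>{1..n}. 0\<^sub>m (dimv Y i) (dimv X i))"

definition is_isomorphism ::
  "nat \<Rightarrow> 'k::field rep \<Rightarrow> 'k rep \<Rightarrow> (nat \<Rightarrow> 'k mat) \<Rightarrow> bool" where
  "is_isomorphism n X Y f \<longleftrightarrow> f \<in> Hom n X Y \<and>
     (\<exists>g\<in>Hom n Y X. comp_hom n g f = id_hom n X \<and> comp_hom n f g = id_hom n Y)"

definition isomorphic :: "nat \<Rightarrow> 'k::field rep \<Rightarrow> 'k rep \<Rightarrow> bool" where
  "isomorphic n X Y \<longleftrightarrow> (\<exists>f. is_isomorphism n X Y f)"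

definition is_zero_rep :: "nat \<Rightarrow> 'k rep \<Rightarrow> bool" where
  "is_zero_rep n M \<longleftrightarrow> (\<forall>i\<in>{1..n}. dimv M i = 0)"

definition dsum :: "'k::field rep list \<Rightarrow> 'k rep" where
  "dsum Ms = \<lparr>dimv = (\<lambda>i. \<Sum>M\<leftarrow>Ms. dimv M i),
     arr = (\<lambda>i. diag_block_mat (map (\<lambda>M. arr M i) Ms))\<rparr>"

definition indecomposable :: "nat \<Rightarrow> 'k::field rep \<Rightarrow> bool" where
  "indecomposable n M \<longleftrightarrow> is_rep n M \<and> \<not> is_zero_rep n M \<and>
     (\<forall>A B. is_rep n A \<longrightarrow> is_rep n B \<longrightarrow> isomorphic n M (dsum [A, B]) \<longrightarrow>
        is_zero_rep n A \<or> is_zero_rep n B)"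

text \<open>
  \<open>Ext1 n X Y\<close> is the first Yoneda extension group, as a pointed set: the short exact sequences
  \<open>0 \<rightarrow> Y \<rightarrow> E \<rightarrow> X \<rightarrow> 0\<close>, encoded as triples \<open>(E, \<iota>, \<pi>)\<close>, up to isomorphisms that are the
  identity on \<open>X\<close> and \<open>Y\<close>. Its zero is the class of the split sequence.
\<close>

definition extensions ::
  "nat \<Rightarrow> 'k::field rep \<Rightarrow> 'k rep \<Rightarrow> ('k rep \<times> (nat \<Rightarrow> 'k mat) \<times> (nat \<Rightarrow> 'k mat)) set" where
  "extensions n X Y = {(E, \<iota>, \<pi>). is_rep n E \<and> \<iota> \<in> Hom n Y E \<and> \<pi> \<in> Hom n E X \<and>
     (\<forall>i\<in>{1..n}.
        inj_on (\<lambda>v. \<iota> i *\<^sub>v v) (carrier_vec (dimv Y i)) \<and>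
        (\<lambda>v. \<iota> i *\<^sub>v v) ` carrier_vec (dimv Y i) = mat_kernel (\<pi> i) \<and>
        (\<lambda>v. \<pi> i *\<^sub>v v) ` carrier_vec (dimv E i) = carrier_vec (dimv X i))}"

definition ext_equiv ::
  "nat \<Rightarrow> 'k::field rep \<Rightarrow> 'k rep \<Rightarrow>
    (('k rep \<times> (nat \<Rightarrow> 'k mat) \<times> (nat \<Rightarrow> 'k mat)) \<times>
     ('k rep \<times> (nat \<Rightarrow> 'k mat) \<times> (nat \<Rightarrow> 'k mat))) set" where
  "ext_equiv n X Y = {((E, \<iota>, \<pi>), (E', \<iota>', \<pi>')).
     (E, \<iota>, \<pi>) \<in> extensions n X Y \<and> (E', \<iota>', \<pi>') \<in> extensions n X Y \<and>
     (\<exists>\<phi>. is_isomorphism n E E' \<phi> \<and> comp_hom n \<phi> \<iota> = \<iota>' \<and> comp_hom n \<pi>' \<phi> = \<pi>)}"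

definition split_ext ::
  "nat \<Rightarrow> 'k::field rep \<Rightarrow> 'k rep \<Rightarrow> 'k rep \<times> (nat \<Rightarrow> 'k mat) \<times> (nat \<Rightarrow> 'k mat)" where
  "split_ext n X Y = (dsum [Y, X],
     \<lambda>i\<in>{1..n}. 1\<^sub>m (dimv Y i) @\<^sub>r 0\<^sub>m (dimv X i) (dimv Y i),
     \<lambda>i\<in>{1..n}. transpose_mat (0\<^sub>m (dimv Y i) (dimv X i) @\<^sub>r 1\<^sub>m (dimv X i)))"

definition Ext1 ::
  "nat \<Rightarrow> 'k::field rep \<Rightarrow> 'k rep \<Rightarrow> ('k rep \<times> (nat \<Rightarrow> 'k mat) \<times> (nat \<Rightarrow> 'k mat)) set set" where
  "Ext1 n X Y = extensions n X Y // ext_equiv n X Y"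

definition Hom_vanishes :: "nat \<Rightarrow> 'k::field rep \<Rightarrow> 'k rep \<Rightarrow> bool" where
  "Hom_vanishes n X Y \<longleftrightarrow> Hom n X Y = {zero_hom n X Y}"

definition Ext_vanishes :: "nat \<Rightarrow> 'k::field rep \<Rightarrow> 'k rep \<Rightarrow> bool" where
  "Ext_vanishes n X Y \<longleftrightarrow> Ext1 n X Y = {ext_equiv n X Y `` {split_ext n X Y}}"

definition rigid :: "nat \<Rightarrow> 'k::field rep \<Rightarrow> bool" where
  "rigid n M \<longleftrightarrow> Ext_vanishes n M M"

text \<open>Lists are indexed from 0, so the \<open>i\<close>-th object of the sequence is \<open>Es ! (i - 1)\<close>.\<close>

definition complete_exceptional_sequence :: "nat \<Rightarrow> 'k::field rep list \<Rightarrow> bool" where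
  "complete_exceptional_sequence n Es \<longleftrightarrow> length Es = n \<and>
     (\<forall>E\<in>set Es. is_rep n E \<and> indecomposable n E \<and> rigid n E) \<and>
     (\<forall>i j. i < j \<longrightarrow> j < n \<longrightarrow>
        Hom_vanishes n (Es ! j) (Es ! i) \<and> Ext_vanishes n (Es ! j) (Es ! i))"

definition right_perp :: "nat \<Rightarrow> 'k::field rep \<Rightarrow> 'k rep set" where
  "right_perp n Z = {Y. is_rep n Y \<and> Hom_vanishes n Z Y \<and> Ext_vanishes n Z Y}"

definition left_perp :: "nat \<Rightarrow> 'k::field rep \<Rightarrow> 'k rep set" where
  "left_perp n Z = {X. is_rep n X \<and> Hom_vanishes n X Z \<and> Ext_vanishes n X Z}"

text \<open>
  A full subcategory is given by its set \<open>C\<close> of objects. Epimorphisms and monomorphisms are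
  those of the category \<open>C\<close> itself: they are tested against objects of \<open>C\<close> only.
\<close>

definition epi_in ::
  "nat \<Rightarrow> 'k::field rep set \<Rightarrow> 'k rep \<Rightarrow> 'k rep \<Rightarrow> (nat \<Rightarrow> 'k mat) \<Rightarrow> bool" where
  "epi_in n C X Y f \<longleftrightarrow> f \<in> Hom n X Y \<and>
     (\<forall>W\<in>C. \<forall>g\<in>Hom n Y W. \<forall>h\<in>Hom n Y W. comp_hom n g f = comp_hom n h f \<longrightarrow> g = h)"

definition mono_in ::
  "nat \<Rightarrow> 'k::field rep set \<Rightarrow> 'k rep \<Rightarrow> 'k rep \<Rightarrow> (nat \<Rightarrow> 'k mat) \<Rightarrow> bool" where
  "mono_in n C X Y f \<longleftrightarrow> f \<in> Hom n X Y \<and>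
     (\<forall>W\<in>C. \<forall>g\<in>Hom n W X. \<forall>h\<in>Hom n W X. comp_hom n f g = comp_hom n f h \<longrightarrow> g = h)"

definition projective_object :: "nat \<Rightarrow> 'k::field rep set \<Rightarrow> 'k rep \<Rightarrow> bool" where
  "projective_object n C P \<longleftrightarrow> P \<in> C \<and>
     (\<forall>X\<in>C. \<forall>Y\<in>C. \<forall>f g. epi_in n C X Y f \<longrightarrow> g \<in> Hom n P Y \<longrightarrow>
        (\<exists>h\<in>Hom n P X. comp_hom n f h = g))"

definition injective_object :: "nat \<Rightarrow> 'k::field rep set \<Rightarrow> 'k rep \<Rightarrow> bool" where
  "injective_object n C I \<longleftrightarrow> I \<in> C \<and>
     (\<forall>X\<in>C. \<forall>Y\<in>C. \<forall>f g. mono_in n C X Y f \<longrightarrow> g \<in> Hom n X I \<longrightarrow>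
        (\<exists>h\<in>Hom n Y I. comp_hom n h f = g))"

text \<open>
  In both definitions the index \<open>i\<close> is 0-based and refers to \<open>Es ! i\<close>. The empty direct sum is the
  zero representation, whose perpendicular categories contain all representations.
\<close>

definition relatively_projective :: "nat \<Rightarrow> 'k::field rep list \<Rightarrow> nat \<Rightarrow> bool" where
  "relatively_projective n Es i \<longleftrightarrow>
     projective_object n (right_perp n (dsum (drop (Suc i) Es))) (Es ! i)"

definition relatively_injective :: "nat \<Rightarrow> 'k::field rep list \<Rightarrow> nat \<Rightarrow> bool" where
  "relatively_injective n Es i \<longleftrightarrow>
     injective_object n (left_perp n (dsum (take i Es))) (Es ! i)"

end

(*
  Up to isomorphism the objects of the sequence are interval modules M(a, b) with support {a..<b},
  where 1 <= a < b <= n + 1: in an indecomposable module, a vector at the first vertex a of the support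
  generates a direct summand. The projective resolution of M(a, b) shows that a module Y lies in the
  right perpendicular category of M(a, b) iff the path map Y a -> Y b is bijective (with Y (n + 1) = 0).
  Applied to two members of the sequence, this turns exceptionality into a condition on endpoints:
  the edges from a to b form a noncrossing graph on {1..n+1}, in which the order of the sequence
  restricts to a fixed order on edges with a common endpoint. The graph is connected, because the
  Euler form is unitriangular on the dimension vectors of the sequence.

  Consider an object M(a, b) and the smallest edge from p to q above it. By connectedness the maximal
  edges below (p, q) form, around M(a, b), a path that ends in p on the left or in q on the right. If it
  ends in q, then (p, q) and the edges between b and q come later in the sequence. Hence in the
  subcategory where M(a, b) must be projective the path maps from p to b are bijective. A vector at a
  that is annihilated at b then lifts along every map that is onto at a, by correcting an arbitrary
  preimage by its part from p; and epimorphisms of the subcategory are onto, since it is closed under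
  cokernels. So M(a, b) is relatively projective. The path ending in p gives relative injectivity by
  duality, and for a maximal edge (one with no edge above it) both arguments apply.
*)

theory Submission
  imports Defs "Jordan_Normal_Form.Determinant"
begin

section \<open>Matrices without carriers\<close>

text \<open>Two features of the definitions shape the proof: Ext is a set of Yoneda classes, and
  epimorphisms of a perpendicular category are tested only inside it. Both are reduced to matrix
  equations. Ext vanishes iff every family of maps from \<open>X i\<close> to
  \<open>Y (i + 1)\<close> is a coboundary, and cokernels come with vertexwise splittings. The
  condition on endpoints arises because the path map of M(a, b) from c to d can be bijective only if
  c and d both lie in \<open>{a..<b}\<close> or both lie outside. Nothing but this comparison of
  dimensions enters the combinatorics. Projectivity has a functorial reason. Hom(M(a, b), X) is the
  kernel of the path map from X a to X b. If the path map from X p to X b is bijective for some p <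
  a, this kernel is a direct summand of X a, naturally in X, so it inherits surjectivity from X a.
  Duality reflects the vertices of the quiver by i -> n + 1 - i but the ends of edges by x -> n + 2
  - x, because an edge ends one past its support. It also reverses the sequence.\<close>

lemma mat_assoc:
  fixes A B C :: "'a::semiring_0 mat"
  shows "dim_col A = dim_row B \<Longrightarrow> dim_col B = dim_row C \<Longrightarrow> A * B * C = A * (B * C)"
  by (rule assoc_mult_mat[of A "dim_row A" "dim_row B" B "dim_row C" C "dim_col C"]) auto

lemma mat_mult_add_left:
  fixes A B C :: "'a::semiring_0 mat"
  shows "dim_row A = dim_row B \<Longrightarrow> dim_col A = dim_col B \<Longrightarrow> dim_col B = dim_row C \<Longrightarrow>
    (A + B) * C = A * C + B * C"
  by (rule add_mult_distrib_mat[of A "dim_row A" "dim_row C" B C "dim_col C"]) auto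

lemma mat_mult_add_right:
  fixes A B C :: "'a::semiring_0 mat"
  shows "dim_row B = dim_row C \<Longrightarrow> dim_col B = dim_col C \<Longrightarrow> dim_col A = dim_row C \<Longrightarrow>
    A * (B + C) = A * B + A * C"
  by (rule mult_add_distrib_mat[of A "dim_row A" "dim_row C" B "dim_col C" C]) auto

lemma mat_mult_one_left: "dim_row A = k \<Longrightarrow> 1\<^sub>m k * A = (A :: 'a::semiring_1 mat)"
  by auto

lemma mat_mult_one_right: "dim_col A = k \<Longrightarrow> A * 1\<^sub>m k = (A :: 'a::semiring_1 mat)"
  by auto

lemma mat_mult_zero_left: "dim_row A = k \<Longrightarrow> 0\<^sub>m j k * A = (0\<^sub>m j (dim_col A) :: 'a::semiring_0 mat)"
  by auto

lemma mat_mult_zero_right: "dim_col A = k \<Longrightarrow> A * 0\<^sub>m k j = (0\<^sub>m (dim_row A) j :: 'a::semiring_0 mat)"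
  by auto

lemma mat_add_zero_left: "dim_row A = j \<Longrightarrow> dim_col A = k \<Longrightarrow> 0\<^sub>m j k + A = (A :: 'a::monoid_add mat)"
  by auto

lemma mat_add_zero_right: "dim_row A = j \<Longrightarrow> dim_col A = k \<Longrightarrow> A + 0\<^sub>m j k = (A :: 'a::monoid_add mat)"
  by auto

lemma mat_add_assoc:
  fixes A B C :: "'a::comm_monoid_add mat"
  shows "dim_row A = dim_row B \<Longrightarrow> dim_col A = dim_col B \<Longrightarrow> dim_row B = dim_row C \<Longrightarrow>
    dim_col B = dim_col C \<Longrightarrow> A + B + C = A + (B + C)"
  by (rule assoc_add_mat[of A "dim_row A" "dim_col A"]) auto

lemma mat_add_comm:
  fixes A B :: "'a::comm_monoid_add mat"
  shows "dim_row A = dim_row B \<Longrightarrow> dim_col A = dim_col B \<Longrightarrow> A + B = B + A"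
  by (rule comm_add_mat[of A "dim_row A" "dim_col A"]) auto

lemma mat_add_left_comm:
  fixes A B C :: "'a::comm_monoid_add mat"
  shows "dim_row A = dim_row B \<Longrightarrow> dim_col A = dim_col B \<Longrightarrow> dim_row B = dim_row C \<Longrightarrow>
    dim_col B = dim_col C \<Longrightarrow> A + (B + C) = B + (A + C)"
  by (metis mat_add_assoc mat_add_comm)

lemma mat_mult_minus_left:
  fixes A B :: "'a::ring mat"
  shows "dim_col A = dim_row B \<Longrightarrow> (- A) * B = - (A * B)"
  by (rule uminus_mult_left_mat)

lemma mat_mult_minus_right:
  fixes A B :: "'a::ring mat"
  shows "dim_col A = dim_row B \<Longrightarrow> A * (- B) = - (A * B)"
  by (rule uminus_mult_right_mat)

lemma mat_minus_self_add:
  fixes A :: "'a::ab_group_add mat"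
  shows "- A + A = 0\<^sub>m (dim_row A) (dim_col A)" "A + - A = 0\<^sub>m (dim_row A) (dim_col A)"
  by auto

lemma mat_minus_zero [simp]: "- 0\<^sub>m j k = (0\<^sub>m j k :: 'a::group_add mat)"
  by auto

text \<open>Side conditions are equations between dimensions, which simp discharges from the
  dimension facts made available in each proof. Commutativity of addition is kept apart in
  \<open>mat_add_ac\<close>.\<close>

lemmas mat_algebra = mat_assoc mat_mult_add_left mat_mult_add_right
  mat_mult_one_left mat_mult_one_right mat_mult_zero_left mat_mult_zero_right
  mat_add_zero_left mat_add_zero_right mat_mult_minus_left mat_mult_minus_right

lemmas mat_add_ac = mat_add_assoc mat_add_comm mat_add_left_comm

lemma mat_empty_eq:
  "dim_row A = dim_row B \<Longrightarrow> dim_col A = dim_col B \<Longrightarrow> dim_row A = 0 \<or> dim_col A = 0 \<Longrightarrow> A = B"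
  by (rule eq_matI) auto

lemma one_mat_eq_zero: "1\<^sub>m k = (0\<^sub>m k k :: 'a::zero_neq_one mat) \<Longrightarrow> k = 0"
proof (rule ccontr)
  assume h: "1\<^sub>m k = (0\<^sub>m k k :: 'a mat)" and k: "k \<noteq> 0"
  show False using k arg_cong[OF h, of "\<lambda>M. M $$ (0, 0)"] by simp
qed

section \<open>Block matrices through coordinate inclusions and projections\<close>

definition incl1 :: "nat \<Rightarrow> nat \<Rightarrow> 'a::{zero,one} mat" where
  "incl1 m k = mat (m + k) m (\<lambda>(i, j). if i = j then 1 else 0)"

definition incl2 :: "nat \<Rightarrow> nat \<Rightarrow> 'a::{zero,one} mat" where
  "incl2 m k = mat (m + k) k (\<lambda>(i, j). if i = m + j then 1 else 0)"

lemma incl_dim [simp]: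
  "dim_row (incl1 m k) = m + k" "dim_col (incl1 m k) = m"
  "dim_row (incl2 m k) = m + k" "dim_col (incl2 m k) = k"
  by (simp_all add: incl1_def incl2_def)

lemma incl_append:
  "incl1 m k = 1\<^sub>m m @\<^sub>r 0\<^sub>m k m" "incl2 m k = 0\<^sub>m m k @\<^sub>r 1\<^sub>m k"
  by (rule eq_matI; auto simp: incl1_def incl2_def append_rows_def)+

lemma incl_mult:
  fixes A :: "'a::comm_ring_1 mat"
  shows "dim_row A = m \<Longrightarrow> incl1 m k * A = mat (m + k) (dim_col A) (\<lambda>(i, j). if i < m then A $$ (i, j) else 0)"
    and "dim_row A = k \<Longrightarrow> incl2 m k * A = mat (m + k) (dim_col A) (\<lambda>(i, j). if m \<le> i then A $$ (i - m, j) else 0)"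
    and "dim_col A = m \<Longrightarrow> A * (incl1 m k)\<^sup>T =
      mat (dim_row A) (m + k) (\<lambda>(i, j). if j < m then A $$ (i, j) else 0)"
    and "dim_col A = k \<Longrightarrow> A * (incl2 m k)\<^sup>T =
      mat (dim_row A) (m + k) (\<lambda>(i, j). if m \<le> j then A $$ (i, j - m) else 0)"
proof -
  have *: "(if i = m + l then (1::'a) else 0) = (if m \<le> i then if l = i - m then 1 else 0 else 0)" for i l
    by auto
  show "dim_row A = m \<Longrightarrow> incl1 m k * A = mat (m + k) (dim_col A) (\<lambda>(i, j). if i < m then A $$ (i, j) else 0)"
    "dim_row A = k \<Longrightarrow> incl2 m k * A = mat (m + k) (dim_col A) (\<lambda>(i, j). if m \<le> i then A $$ (i - m, j) else 0)"
    "dim_col A = m \<Longrightarrow> A * (incl1 m k)\<^sup>T =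
      mat (dim_row A) (m + k) (\<lambda>(i, j). if j < m then A $$ (i, j) else 0)"
    "dim_col A = k \<Longrightarrow> A * (incl2 m k)\<^sup>T =
      mat (dim_row A) (m + k) (\<lambda>(i, j). if m \<le> j then A $$ (i, j - m) else 0)"
    by (rule eq_matI; auto simp: incl1_def incl2_def scalar_prod_def * if_distrib[of "\<lambda>x. x * _"]
        if_distrib[of "\<lambda>x. _ * x"] cong: if_cong)+
qed

text \<open>These are the equations of a biproduct, with the transposes as projections. They turn
  computations with blocks into rewriting.\<close>

lemma incl_orth [simp]:
  "(incl1 m k)\<^sup>T * incl1 m k = (1\<^sub>m m :: 'a::comm_ring_1 mat)"
  "(incl2 m k)\<^sup>T * incl2 m k = (1\<^sub>m k :: 'a mat)"
  "(incl1 m k)\<^sup>T * incl2 m k = (0\<^sub>m m k :: 'a mat)"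
  "(incl2 m k)\<^sup>T * incl1 m k = (0\<^sub>m k m :: 'a mat)"
  "incl1 m k * (incl1 m k)\<^sup>T + incl2 m k * (incl2 m k)\<^sup>T = (1\<^sub>m (m + k) :: 'a mat)"
proof -
  note defs = incl1_def incl2_def scalar_prod_def if_distrib[of "\<lambda>x. x * _"] if_distrib[of "\<lambda>x. _ * x"]
  show "(incl1 m k)\<^sup>T * incl1 m k = (1\<^sub>m m :: 'a mat)"
    "(incl2 m k)\<^sup>T * incl2 m k = (1\<^sub>m k :: 'a mat)"
    "(incl1 m k)\<^sup>T * incl2 m k = (0\<^sub>m m k :: 'a mat)"
    "(incl2 m k)\<^sup>T * incl1 m k = (0\<^sub>m k m :: 'a mat)"
    by (rule eq_matI; auto simp: defs cong: if_cong)+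
  show "incl1 m k * (incl1 m k)\<^sup>T + incl2 m k * (incl2 m k)\<^sup>T = (1\<^sub>m (m + k) :: 'a mat)"
    by (subst incl_mult(1), simp, subst incl_mult(2), simp) (rule eq_matI; auto simp: incl1_def incl2_def)
qed

lemma incl_orth_assoc:
  fixes A :: "'a::comm_ring_1 mat"
  shows "dim_row A = m \<Longrightarrow> (incl1 m k)\<^sup>T * (incl1 m k * A) = A"
    and "dim_row A = k \<Longrightarrow> (incl1 m k)\<^sup>T * (incl2 m k * A) = 0\<^sub>m m (dim_col A)"
    and "dim_row A = m \<Longrightarrow> (incl2 m k)\<^sup>T * (incl1 m k * A) = 0\<^sub>m k (dim_col A)"
    and "dim_row A = k \<Longrightarrow> (incl2 m k)\<^sup>T * (incl2 m k * A) = A"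
  by (simp_all add: mat_assoc[symmetric] mat_algebra(4-9))

lemma four_block_incl:
  fixes A D :: "'a::comm_ring_1 mat"
  assumes "A \<in> carrier_mat r c" "B \<in> carrier_mat r c'" "D \<in> carrier_mat r' c'"
  shows "four_block_mat A B (0\<^sub>m r' c) D =
    incl1 r r' * A * (incl1 c c')\<^sup>T + incl2 r r' * D * (incl2 c c')\<^sup>T +
    incl1 r r' * B * (incl2 c c')\<^sup>T"
proof -
  have d: "dim_row A = r" "dim_col A = c" "dim_row D = r'" "dim_col D = c'" "dim_row B = r" "dim_col B = c'"
    using assms by auto
  show ?thesis
    by (subst incl_mult(3), simp add: d, subst (1 2) incl_mult(4), simp_all add: d,
        subst (1 2) incl_mult(1), simp_all add: d, subst incl_mult(2), simp add: d)
      (rule eq_matI; auto simp: d)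
qed

section \<open>Rank factorizations and cokernels\<close>

definition nonzero_rows :: "'a::zero mat \<Rightarrow> nat set" where
  "nonzero_rows A = {i. i < dim_row A \<and> (\<exists>j<dim_col A. A $$ (i, j) \<noteq> 0)}"

text \<open>Pivoting: subtracting from \<open>A\<close> the rank one matrix \<open>c * r\<close>, where \<open>r\<close> is the row of a pivot
  and \<open>c\<close> its column divided by the pivot, clears the row of the pivot.\<close>

lemma full_rank_factorization:
  fixes A :: "'a::field mat"
  assumes "A \<in> carrier_mat m k"
  shows "\<exists>r S R L T. S \<in> carrier_mat m r \<and> R \<in> carrier_mat r k \<and> L \<in> carrier_mat r m \<and>
    T \<in> carrier_mat k r \<and> A = S * R \<and> L * S = 1\<^sub>m r \<and> R * T = 1\<^sub>m r"
  using assms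
proof (induction "card (nonzero_rows A)" arbitrary: A rule: less_induct)
  case (less A)
  note dA [simp] = carrier_matD[OF less.prems]
  show ?case
  proof (cases "nonzero_rows A = {}")
    case True
    then have A: "A = 0\<^sub>m m k"
      by (intro eq_matI) (auto simp: nonzero_rows_def)
    show ?thesis
      by (rule exI[of _ 0], rule exI[of _ "0\<^sub>m m 0"], rule exI[of _ "0\<^sub>m 0 k"],
          rule exI[of _ "0\<^sub>m 0 m"], rule exI[of _ "0\<^sub>m k 0"]) (auto simp: A intro!: eq_matI)
  next
    case False
    then obtain i j where ij: "i < m" "j < k" "A $$ (i, j) \<noteq> 0"
      by (auto simp: nonzero_rows_def)
    define p where "p = A $$ (i, j)"
    define c where "c = mat m 1 (\<lambda>(x, _). A $$ (x, j) / p)"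
    define w where "w = mat 1 k (\<lambda>(_, y). A $$ (i, y))"
    define ei where "ei = mat 1 m (\<lambda>(_, x). if x = i then 1 else (0::'a))"
    define ej where "ej = mat k 1 (\<lambda>(x, _). if x = j then 1 / p else (0::'a))"
    have [simp]: "dim_row c = m" "dim_col c = 1" "dim_row w = 1" "dim_col w = k"
      "dim_row ei = 1" "dim_col ei = m" "dim_row ej = k" "dim_col ej = 1"
      by (simp_all add: c_def w_def ei_def ej_def)
    have p: "p \<noteq> 0" using ij p_def by simp
    have eic: "ei * c = 1\<^sub>m 1"
      by (rule eq_matI)
        (auto simp: ei_def c_def scalar_prod_def p p_def[symmetric] ij if_distrib[of "\<lambda>x. x * _"]
          if_distrib[of "\<lambda>x. x / _"] cong: if_cong)
    have wej: "w * ej = 1\<^sub>m 1"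
      by (rule eq_matI)
        (auto simp: ej_def w_def scalar_prod_def p p_def[symmetric] ij if_distrib[of "\<lambda>x. _ * x"] cong: if_cong)
    define B where "B = mat m k (\<lambda>(x, y). A $$ (x, y) - A $$ (x, j) / p * A $$ (i, y))"
    have B [simp]: "dim_row B = m" "dim_col B = k" by (simp_all add: B_def)
    have AB: "A = B + c * w"
      by (rule eq_matI) (auto simp: B_def c_def w_def scalar_prod_def)
    have eiB: "ei * B = 0\<^sub>m 1 k"
      by (rule eq_matI)
        (auto simp: ei_def B_def scalar_prod_def p p_def[symmetric] ij if_distrib[of "\<lambda>x. x * _"] cong: if_cong)
    have Bej: "B * ej = 0\<^sub>m m 1"
      by (rule eq_matI)
        (auto simp: ej_def B_def scalar_prod_def p p_def[symmetric] ij if_distrib[of "\<lambda>x. _ * x"] cong: if_cong)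
    have "nonzero_rows B \<subset> nonzero_rows A"
    proof
      show "nonzero_rows B \<subseteq> nonzero_rows A"
      proof
        fix x assume "x \<in> nonzero_rows B"
        then obtain y where x: "x < m" "y < k" "A $$ (x, y) - A $$ (x, j) / p * A $$ (i, y) \<noteq> 0"
          by (auto simp: nonzero_rows_def B_def)
        then have "A $$ (x, y) \<noteq> 0 \<or> A $$ (x, j) \<noteq> 0" by auto
        then show "x \<in> nonzero_rows A" using x(1,2) ij(2) by (auto simp: nonzero_rows_def)
      qed
      have "i \<in> nonzero_rows A" "i \<notin> nonzero_rows B"
        using ij p p_def by (auto simp: nonzero_rows_def B_def)
      then show "nonzero_rows B \<noteq> nonzero_rows A" by blast
    qed
    moreover have "finite (nonzero_rows A)" by (simp add: nonzero_rows_def)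
    ultimately have "card (nonzero_rows B) < card (nonzero_rows A)" by (simp add: psubset_card_mono)
    from less.hyps[OF this] obtain r S R L T where
      c: "S \<in> carrier_mat m r" "R \<in> carrier_mat r k" "L \<in> carrier_mat r m" "T \<in> carrier_mat k r"
      and BSR: "B = S * R" and LS: "L * S = 1\<^sub>m r" and RT: "R * T = 1\<^sub>m r"
      by (metis B carrier_matI)
    note [simp] = carrier_matD[OF c(1)] carrier_matD[OF c(2)] carrier_matD[OF c(3)] carrier_matD[OF c(4)]
    \<comment> \<open>The factors of \<open>B\<close> inherit \<open>eiB\<close> and
      \<open>Bej\<close>, because \<open>S = B * T\<close> and \<open>R = L * B\<close>.\<close>
    have eiS: "ei * S = 0\<^sub>m 1 r"
    proof -
      have "ei * S = ei * (S * (R * T))" by (simp add: RT mat_algebra)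
      also have "\<dots> = ei * B * T" by (simp add: BSR mat_algebra)
      finally show ?thesis by (simp add: eiB mat_algebra)
    qed
    have Rej: "R * ej = 0\<^sub>m r 1"
    proof -
      have "R * ej = L * S * R * ej" by (simp add: LS mat_algebra)
      also have "\<dots> = L * (B * ej)" by (simp add: BSR mat_algebra)
      finally show ?thesis by (simp add: Bej mat_algebra)
    qed
    define S' where "S' = S * (incl1 r 1)\<^sup>T + c * (incl2 r 1)\<^sup>T"
    define R' where "R' = incl1 r 1 * R + incl2 r 1 * w"
    \<comment> \<open>\<open>S'\<close> and \<open>R'\<close> append \<open>c\<close> and
      \<open>w\<close> as a new column and a new row. \<open>L\<close> need not vanish on
      \<open>c\<close>, nor \<open>w\<close> on \<open>T\<close>; the subtracted terms remove
      exactly these products.\<close>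
    define L' where "L' = incl1 r 1 * (L + - (L * c * ei)) + incl2 r 1 * ei"
    define T' where "T' = (T + - (ej * (w * T))) * (incl1 r 1)\<^sup>T + ej * (incl2 r 1)\<^sup>T"
    have [simp]: "dim_row S' = m" "dim_col S' = Suc r" "dim_row T' = k" "dim_col T' = Suc r"
      by (simp_all add: S'_def T'_def)
    have 1: "A = S' * R'"
      by (simp add: AB BSR S'_def R'_def mat_algebra incl_orth_assoc)
    have "ei * S' = ei * S * (incl1 r 1)\<^sup>T + ei * c * (incl2 r 1)\<^sup>T"
      by (simp add: S'_def mat_algebra)
    then have eS: "ei * S' = (incl2 r 1)\<^sup>T"
      by (simp add: eiS eic mat_algebra)
    have "L * S' = L * S * (incl1 r 1)\<^sup>T + L * c * (incl2 r 1)\<^sup>T"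
      by (simp add: S'_def mat_algebra)
    then have LS': "L * S' = (incl1 r 1)\<^sup>T + L * (c * (incl2 r 1)\<^sup>T)"
      by (simp add: LS mat_algebra)
    have "L' * S' = incl1 r 1 * (L * S' + - (L * (c * (ei * S')))) + incl2 r 1 * (ei * S')"
      by (simp add: L'_def mat_algebra)
    also have "L * S' + - (L * (c * (ei * S'))) = (incl1 r 1)\<^sup>T"
      by (simp add: LS' eS mat_add_assoc mat_minus_self_add mat_add_zero_right)
    finally have 2: "L' * S' = 1\<^sub>m (r + 1)"
      by (simp add: eS)
    have "w * T' = (w * T + - (w * ej * (w * T))) * (incl1 r 1)\<^sup>T + w * ej * (incl2 r 1)\<^sup>T"
      by (simp add: T'_def mat_algebra)
    then have wT: "w * T' = (incl2 r 1)\<^sup>T"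
      by (simp add: wej mat_algebra mat_minus_self_add)
    have "R * T' = (R * T + - (R * ej * (w * T))) * (incl1 r 1)\<^sup>T + R * ej * (incl2 r 1)\<^sup>T"
      by (simp add: T'_def mat_algebra)
    then have RT': "R * T' = (incl1 r 1)\<^sup>T"
      by (simp add: Rej RT mat_algebra)
    have 3: "R' * T' = 1\<^sub>m (r + 1)"
      using RT' wT by (simp add: R'_def mat_algebra)
    have "S' \<in> carrier_mat m (r + 1)" "R' \<in> carrier_mat (r + 1) k" "L' \<in> carrier_mat (r + 1) m"
      "T' \<in> carrier_mat k (r + 1)"
      by (auto simp: S'_def R'_def L'_def T'_def)
    then show ?thesis using 1 2 3 by blast
  qed
qed

text \<open>Write \<open>E = S * R\<close> with full rank factors. Cancelling \<open>S\<close> on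
  the left and \<open>R\<close> on the right of \<open>S * R * S * R = S * R\<close> leaves
  \<open>R * S = 1\<close>.\<close>

lemma mat_idempotent_split:
  fixes E :: "'a::field mat"
  assumes "E \<in> carrier_mat m m" "E * E = E"
  shows "\<exists>r s q. s \<in> carrier_mat m r \<and> q \<in> carrier_mat r m \<and> E = s * q \<and> q * s = 1\<^sub>m r"
proof -
  obtain r S R L T where c: "S \<in> carrier_mat m r" "R \<in> carrier_mat r m" "L \<in> carrier_mat r m"
    "T \<in> carrier_mat m r" and E: "E = S * R" and LS: "L * S = 1\<^sub>m r" and RT: "R * T = 1\<^sub>m r"
    using full_rank_factorization[OF assms(1)] by blast
  note [simp] = carrier_matD[OF c(1)] carrier_matD[OF c(2)] carrier_matD[OF c(3)] carrier_matD[OF c(4)]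
  have "R * S = (L * S) * (R * S) * (R * T)"
    by (simp add: LS RT mat_algebra)
  also have "\<dots> = L * (E * E) * T"
    by (simp add: E mat_algebra)
  also have "\<dots> = L * S * (R * T)"
    unfolding assms(2) by (simp add: E mat_algebra)
  finally have "R * S = 1\<^sub>m r"
    by (simp add: LS RT mat_algebra)
  then show ?thesis using c E by blast
qed

text \<open>With \<open>f = S * R\<close>, the matrix \<open>S * L\<close> projects onto the image
  of \<open>f\<close>, and splitting the complementary idempotent gives \<open>q\<close> and
  \<open>s\<close>. The matrix \<open>t\<close> expresses that the kernel of \<open>q\<close> is
  contained in the image of \<open>f\<close>.\<close>

lemma mat_cokernel:
  fixes f :: "'a::field mat"
  assumes "f \<in> carrier_mat m k"
  shows "\<exists>r q s t. q \<in> carrier_mat r m \<and> s \<in> carrier_mat m r \<and> t \<in> carrier_mat k m \<and>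
    q * f = 0\<^sub>m r k \<and> q * s = 1\<^sub>m r \<and> s * q + f * t = 1\<^sub>m m"
proof -
  obtain r S R L T where c: "S \<in> carrier_mat m r" "R \<in> carrier_mat r k" "L \<in> carrier_mat r m"
    "T \<in> carrier_mat k r" and f: "f = S * R" and LS: "L * S = 1\<^sub>m r" and RT: "R * T = 1\<^sub>m r"
    using full_rank_factorization[OF assms] by blast
  note [simp] = carrier_matD[OF c(1)] carrier_matD[OF c(2)] carrier_matD[OF c(3)] carrier_matD[OF c(4)]
  define t where "t = T * L"
  have [simp]: "dim_row t = k" "dim_col t = m" by (simp_all add: t_def)
  have "f * t = S * (R * T) * L" by (simp add: f t_def mat_algebra)
  then have ft: "f * t = S * L" by (simp add: RT mat_algebra)
  have "S * L * S = S * (L * S)" by (simp add: mat_algebra)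
  then have SLS: "S * L * S = S" by (simp add: LS mat_algebra)
  have SLSL: "S * (L * (S * L)) = S * L"
    using arg_cong[OF SLS, of "\<lambda>M. M * L"] by (simp add: mat_algebra)
  define E where "E = 1\<^sub>m m + - (S * L)"
  have E: "E \<in> carrier_mat m m" by (rule carrier_matI) (simp_all add: E_def)
  have "E * E = E + - (S * L * E)"
    using E by (simp add: E_def mat_algebra)
  also have "S * L * E = 0\<^sub>m m m"
    by (simp add: E_def mat_algebra SLSL mat_minus_self_add)
  also have "E + - 0\<^sub>m m m = E" using E by auto
  finally obtain r' s q where sq: "s \<in> carrier_mat m r'" "q \<in> carrier_mat r' m" "E = s * q" "q * s = 1\<^sub>m r'"
    using mat_idempotent_split[OF E] by blast
  note [simp] = carrier_matD[OF sq(1)] carrier_matD[OF sq(2)]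
  have "q * f = (q * s) * q * f" by (simp add: sq(4) mat_algebra)
  also have "\<dots> = q * (E * S) * R" by (simp add: f sq(3) mat_algebra)
  also have "E * S = 0\<^sub>m m r"
    using SLS by (simp add: E_def mat_algebra mat_minus_self_add)
  finally have "q * f = 0\<^sub>m r' k" by (simp add: mat_algebra)
  moreover have "s * q + f * t = 1\<^sub>m m"
    by (simp add: ft flip: sq(3)) (simp add: E_def mat_algebra mat_add_assoc mat_minus_self_add)
  moreover have "t \<in> carrier_mat k m" by auto
  ultimately show ?thesis using sq by blast
qed

section \<open>Representations on all vertices\<close>

text \<open>All natural numbers serve as vertices, so that equations between morphisms carry no
  bounds on the index.\<close>

definition total_rep :: "'k rep \<Rightarrow> bool" where
  "total_rep X \<longleftrightarrow> (\<forall>i. arr X i \<in> carrier_mat (dimv X (Suc i)) (dimv X i))"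

definition mor :: "'k::field rep \<Rightarrow> 'k rep \<Rightarrow> (nat \<Rightarrow> 'k mat) \<Rightarrow> bool" where
  "mor X Y s \<longleftrightarrow> (\<forall>i. s i \<in> carrier_mat (dimv Y i) (dimv X i)) \<and>
     (\<forall>i. s (Suc i) * arr X i = arr Y i * s i)"

text \<open>\<open>Hom(X, Y)\<close> and \<open>Ext(X, Y)\<close> are the kernel and the cokernel of the map that sends a family
  \<open>s i : X i \<rightarrow> Y i\<close> to the family \<open>s (i + 1) * arr X i - arr Y i * s i : X i \<rightarrow> Y (i + 1)\<close>.\<close>

definition hom_zero :: "'k::field rep \<Rightarrow> 'k rep \<Rightarrow> bool" where
  "hom_zero X Y \<longleftrightarrow> (\<forall>s. mor X Y s \<longrightarrow> (\<forall>i. s i = 0\<^sub>m (dimv Y i) (dimv X i)))"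

definition ext_zero :: "'k::field rep \<Rightarrow> 'k rep \<Rightarrow> bool" where
  "ext_zero X Y \<longleftrightarrow> (\<forall>h. (\<forall>i. h i \<in> carrier_mat (dimv Y (Suc i)) (dimv X i)) \<longrightarrow>
     (\<exists>s. (\<forall>i. s i \<in> carrier_mat (dimv Y i) (dimv X i)) \<and>
       (\<forall>i. s (Suc i) * arr X i = arr Y i * s i + h i)))"

definition perp :: "'k::field rep \<Rightarrow> 'k rep \<Rightarrow> bool" where
  "perp X Y \<longleftrightarrow> hom_zero X Y \<and> ext_zero X Y"

lemma total_rep_dim:
  assumes "total_rep X"
  shows "dim_row (arr X i) = dimv X (Suc i)" "dim_col (arr X i) = dimv X i"
  using assms by (auto simp: total_rep_def)

lemma mor_dim:
  assumes "mor X Y s"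
  shows "dim_row (s i) = dimv Y i" "dim_col (s i) = dimv X i"
  using assms by (auto simp: mor_def)

lemma mor_carrier: "mor X Y s \<Longrightarrow> s i \<in> carrier_mat (dimv Y i) (dimv X i)"
  by (simp add: mor_def)

lemma mor_comm: "mor X Y s \<Longrightarrow> s (Suc i) * arr X i = arr Y i * s i"
  by (simp add: mor_def)

lemma mor_comm_assoc:
  assumes "mor X Y s" "total_rep X" "total_rep Y" "dim_row Z = dimv X i"
  shows "s (Suc i) * (arr X i * Z) = arr Y i * (s i * Z)"
proof -
  note [simp] = mor_dim[OF assms(1)] total_rep_dim[OF assms(2)] total_rep_dim[OF assms(3)] assms(4)
  have "s (Suc i) * (arr X i * Z) = s (Suc i) * arr X i * Z" by (simp add: mat_assoc)
  then show ?thesis by (simp add: mor_comm[OF assms(1)] mat_assoc)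
qed

lemma morI:
  assumes "\<And>i. dim_row (s i) = dimv Y i" "\<And>i. dim_col (s i) = dimv X i"
    "\<And>i. s (Suc i) * arr X i = arr Y i * s i"
  shows "mor X Y s"
  using assms by (auto simp: mor_def)

lemma mor_comp:
  assumes X: "total_rep X" and Y: "total_rep Y" and Z: "total_rep Z"
    and f: "mor X Y f" and g: "mor Y Z g"
  shows "mor X Z (\<lambda>i. g i * f i)"
proof (rule morI)
  note [simp] = mor_dim[OF f] mor_dim[OF g] total_rep_dim[OF X] total_rep_dim[OF Y] total_rep_dim[OF Z]
  show "g (Suc i) * f (Suc i) * arr X i = arr Z i * (g i * f i)" for i
    by (simp add: mat_assoc mor_comm[OF f] mor_comm_assoc[OF g Y Z])
qed (simp_all add: mor_dim[OF f] mor_dim[OF g])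

lemma mor_one: "total_rep X \<Longrightarrow> mor X X (\<lambda>i. 1\<^sub>m (dimv X i))"
  by (auto simp: mor_def total_rep_dim mat_algebra)

lemma mor_add:
  assumes X: "total_rep X" and Y: "total_rep Y" and f: "mor X Y f" and g: "mor X Y g"
  shows "mor X Y (\<lambda>i. f i + g i)"
  by (rule morI) (simp_all add: mor_dim[OF f] mor_dim[OF g] total_rep_dim[OF X] total_rep_dim[OF Y]
      mat_algebra mor_comm[OF f] mor_comm[OF g])

lemma hom_zeroD: "hom_zero X Y \<Longrightarrow> mor X Y s \<Longrightarrow> s i = 0\<^sub>m (dimv Y i) (dimv X i)"
  by (simp add: hom_zero_def)

lemma ext_zeroD:
  assumes "ext_zero X Y" "\<And>i. dim_row (h i) = dimv Y (Suc i)" "\<And>i. dim_col (h i) = dimv X i"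
  obtains s where "\<And>i. dim_row (s i) = dimv Y i" "\<And>i. dim_col (s i) = dimv X i"
    "\<And>i. s (Suc i) * arr X i = arr Y i * s i + h i"
proof -
  have "\<forall>i. h i \<in> carrier_mat (dimv Y (Suc i)) (dimv X i)" using assms(2,3) by auto
  then obtain s where "\<forall>i. s i \<in> carrier_mat (dimv Y i) (dimv X i)"
    "\<forall>i. s (Suc i) * arr X i = arr Y i * s i + h i"
    using assms(1) unfolding ext_zero_def by metis
  then show ?thesis by (intro that) auto
qed

definition coboundary :: "'k::field rep \<Rightarrow> 'k rep \<Rightarrow> (nat \<Rightarrow> 'k mat) \<Rightarrow> (nat \<Rightarrow> 'k mat) \<Rightarrow> bool" where
  "coboundary X Y s h \<longleftrightarrow> (\<forall>i. dim_row (s i) = dimv Y i \<and> dim_col (s i) = dimv X i \<and>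
     s (Suc i) * arr X i = arr Y i * s i + h i)"

lemma ext_zeroI:
  assumes "\<And>h. (\<And>i. dim_row (h i) = dimv Y (Suc i)) \<Longrightarrow> (\<And>i. dim_col (h i) = dimv X i) \<Longrightarrow>
    \<exists>s. coboundary X Y s h"
  shows "ext_zero X Y"
  unfolding ext_zero_def
proof (intro allI impI)
  fix h :: "nat \<Rightarrow> 'a mat" assume "\<forall>i. h i \<in> carrier_mat (dimv Y (Suc i)) (dimv X i)"
  then have "dim_row (h i) = dimv Y (Suc i)" "dim_col (h i) = dimv X i" for i by auto
  from assms[OF this] obtain s where "coboundary X Y s h" by blast
  then show "\<exists>s. (\<forall>i. s i \<in> carrier_mat (dimv Y i) (dimv X i)) \<and>
       (\<forall>i. s (Suc i) * arr X i = arr Y i * s i + h i)"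
    by (intro exI[of _ s]) (auto simp: coboundary_def)
qed

text \<open>Hom and Ext are functorial in the first argument, so a retract of \<open>X\<close> gets
  retracts of the groups of \<open>X\<close>: compose with \<open>f\<close>, solve over
  \<open>X\<close>, and compose with \<open>g\<close>.\<close>

lemma perp_retract_left:
  assumes X: "total_rep X" and X': "total_rep X'" and Y: "total_rep Y"
    and f: "mor X X' f" and g: "mor X' X g" and fg: "\<And>i. f i * g i = 1\<^sub>m (dimv X' i)"
    and o: "perp X Y"
  shows "perp X' Y"
  unfolding perp_def
proof
  note [simp] = mor_dim[OF f] mor_dim[OF g] total_rep_dim[OF X] total_rep_dim[OF X'] total_rep_dim[OF Y]
  show "hom_zero X' Y"
    unfolding hom_zero_def
  proof (intro allI impI)
    fix s i assume s: "mor X' Y s"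
    note [simp] = mor_dim[OF s]
    have "s i = s i * f i * g i" by (simp add: mat_algebra fg)
    also have "s i * f i = 0\<^sub>m (dimv Y i) (dimv X i)"
      using hom_zeroD[OF _ mor_comp[OF X X' Y f s]] o by (simp add: perp_def)
    finally show "s i = 0\<^sub>m (dimv Y i) (dimv X' i)" by (simp add: mat_algebra)
  qed
  show "ext_zero X' Y"
  proof (rule ext_zeroI)
    fix h :: "nat \<Rightarrow> 'a mat"
    assume [simp]: "\<And>i. dim_row (h i) = dimv Y (Suc i)" "\<And>i. dim_col (h i) = dimv X' i"
    obtain s where [simp]: "\<And>i. dim_row (s i) = dimv Y i" "\<And>i. dim_col (s i) = dimv X i" and
      s: "\<And>i. s (Suc i) * arr X i = arr Y i * s i + h i * f i"
      by (rule ext_zeroD[of X Y "\<lambda>i. h i * f i"]) (use o in \<open>auto simp: perp_def\<close>)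
    have "s (Suc i) * g (Suc i) * arr X' i = arr Y i * (s i * g i) + h i" for i
    proof -
      have "s (Suc i) * g (Suc i) * arr X' i = s (Suc i) * arr X i * g i"
        by (simp add: mat_algebra mor_comm[OF g])
      also have "\<dots> = arr Y i * (s i * g i) + h i * (f i * g i)"
        unfolding s by (simp add: mat_algebra)
      finally show ?thesis by (simp add: fg mat_algebra)
    qed
    then show "\<exists>s. coboundary X' Y s h"
        by (intro exI[of _ "\<lambda>i. s i * g i"]) (simp add: coboundary_def)
  qed
qed

section \<open>Isomorphisms, biproducts and cokernels\<close>

definition iso_pair ::
  "'k::field rep \<Rightarrow> 'k rep \<Rightarrow> (nat \<Rightarrow> 'k mat) \<Rightarrow> (nat \<Rightarrow> 'k mat) \<Rightarrow> bool" where
  "iso_pair X Y u v \<longleftrightarrow> mor X Y u \<and> mor Y X v \<and>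
    (\<forall>i. v i * u i = 1\<^sub>m (dimv X i) \<and> u i * v i = 1\<^sub>m (dimv Y i))"

definition biproduct ::
  "'k::field rep \<Rightarrow> 'k rep \<Rightarrow> 'k rep \<Rightarrow> (nat \<Rightarrow> 'k mat) \<Rightarrow> (nat \<Rightarrow> 'k mat) \<Rightarrow>
    (nat \<Rightarrow> 'k mat) \<Rightarrow> (nat \<Rightarrow> 'k mat) \<Rightarrow> bool" where
  "biproduct E X Y i1 p1 i2 p2 \<longleftrightarrow> mor X E i1 \<and> mor E X p1 \<and> mor Y E i2 \<and> mor E Y p2 \<and>
    (\<forall>i. p1 i * i1 i = 1\<^sub>m (dimv X i) \<and> p2 i * i2 i = 1\<^sub>m (dimv Y i) \<and>
      p1 i * i2 i = 0\<^sub>m (dimv X i) (dimv Y i) \<and> p2 i * i1 i = 0\<^sub>m (dimv Y i) (dimv X i) \<and>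
      i1 i * p1 i + i2 i * p2 i = 1\<^sub>m (dimv E i))"

lemma perp_biproduct_left:
  assumes E: "total_rep E" and X: "total_rep X" and Y: "total_rep Y" and Z: "total_rep Z"
    and b: "biproduct E X Y i1 p1 i2 p2"
  shows "perp E Z \<longleftrightarrow> perp X Z \<and> perp Y Z"
proof
  from b have m: "mor X E i1" "mor E X p1" "mor Y E i2" "mor E Y p2"
    and i: "p1 i * i1 i = 1\<^sub>m (dimv X i)" "p2 i * i2 i = 1\<^sub>m (dimv Y i)"
      "i1 i * p1 i + i2 i * p2 i = 1\<^sub>m (dimv E i)" for i
    by (auto simp: biproduct_def)
  note [simp] = m[THEN mor_dim(1)] m[THEN mor_dim(2)] total_rep_dim[OF X] total_rep_dim[OF Y]
    total_rep_dim[OF Z] total_rep_dim[OF E]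
  show "perp X Z \<and> perp Y Z" if "perp E Z"
    using perp_retract_left[OF E X Z m(2,1) i(1) that] perp_retract_left[OF E Y Z m(4,3) i(2) that]
    by blast
  assume o: "perp X Z \<and> perp Y Z"
  have split: "s i = s i * i1 i * p1 i + s i * i2 i * p2 i" if "dim_col (s i) = dimv E i"
    for s :: "nat \<Rightarrow> 'a mat" and i
    using that arg_cong[OF i(3), of "\<lambda>M. s i * M" i] by (simp add: mat_algebra)
  show "perp E Z"
    unfolding perp_def
  proof
    show "hom_zero E Z"
      unfolding hom_zero_def
    proof (intro allI impI)
      fix s i assume s: "mor E Z s"
      note [simp] = mor_dim[OF s]
      have "s i * i1 i = 0\<^sub>m (dimv Z i) (dimv X i)" "s i * i2 i = 0\<^sub>m (dimv Z i) (dimv Y i)"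
        using hom_zeroD[OF _ mor_comp[OF X E Z m(1) s]] hom_zeroD[OF _ mor_comp[OF Y E Z m(3) s]] o
        by (simp_all add: perp_def)
      with split[of s i] show "s i = 0\<^sub>m (dimv Z i) (dimv E i)" by (simp add: mat_algebra)
    qed
    show "ext_zero E Z"
    proof (rule ext_zeroI)
      fix h :: "nat \<Rightarrow> 'a mat"
      assume [simp]: "\<And>i. dim_row (h i) = dimv Z (Suc i)" "\<And>i. dim_col (h i) = dimv E i"
      obtain s where [simp]: "\<And>i. dim_row (s i) = dimv Z i" "\<And>i. dim_col (s i) = dimv X i" and
        s: "\<And>i. s (Suc i) * arr X i = arr Z i * s i + h i * i1 i"
        by (rule ext_zeroD[of X Z "\<lambda>i. h i * i1 i"]) (use o in \<open>auto simp: perp_def\<close>)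
      obtain t where [simp]: "\<And>i. dim_row (t i) = dimv Z i" "\<And>i. dim_col (t i) = dimv Y i" and
        t: "\<And>i. t (Suc i) * arr Y i = arr Z i * t i + h i * i2 i"
        by (rule ext_zeroD[of Y Z "\<lambda>i. h i * i2 i"]) (use o in \<open>auto simp: perp_def\<close>)
      have "(s (Suc i) * p1 (Suc i) + t (Suc i) * p2 (Suc i)) * arr E i =
        arr Z i * (s i * p1 i + t i * p2 i) + h i" for i
      proof -
        have "(s (Suc i) * p1 (Suc i) + t (Suc i) * p2 (Suc i)) * arr E i =
          s (Suc i) * arr X i * p1 i + t (Suc i) * arr Y i * p2 i"
          by (simp add: mat_algebra mor_comm[OF m(2)] mor_comm[OF m(4)])
        also have "\<dots> = arr Z i * (s i * p1 i + t i * p2 i) + (h i * i1 i * p1 i + h i * i2 i * p2 i)"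
          unfolding s t by (simp add: mat_algebra mat_add_ac)
        finally show ?thesis using split[of h i] by simp
      qed
      then show "\<exists>s. coboundary E Z s h"
        by (intro exI[of _ "\<lambda>i. s i * p1 i + t i * p2 i"]) (simp add: coboundary_def)
    qed
  qed
qed

lemma biproduct_unique:
  assumes E: "total_rep E" and F: "total_rep F" and X: "total_rep X" and Y: "total_rep Y"
    and b: "biproduct E X Y i1 p1 i2 p2" and c: "biproduct F X Y j1 q1 j2 q2"
  shows "iso_pair E F (\<lambda>i. j1 i * p1 i + j2 i * p2 i) (\<lambda>i. i1 i * q1 i + i2 i * q2 i)"
proof -
  have *: "mor E F (\<lambda>i. j1 i * p1 i + j2 i * p2 i)"
    if "total_rep E" "total_rep F" "biproduct E X Y i1 p1 i2 p2" "biproduct F X Y j1 q1 j2 q2"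
    for E F i1 p1 i2 p2 j1 q1 j2 q2
    using that by (intro mor_add mor_comp[of E X F] mor_comp[of E Y F]) (auto simp: biproduct_def X Y)
  have **: "(i1 i * q1 i + i2 i * q2 i) * (j1 i * p1 i + j2 i * p2 i) = 1\<^sub>m (dimv E i)"
    if b: "biproduct E X Y i1 p1 i2 p2" and c: "biproduct F X Y j1 q1 j2 q2"
    for E F i1 p1 i2 p2 j1 q1 j2 q2 i
  proof -
    have m: "mor X E i1" "mor E X p1" "mor Y E i2" "mor E Y p2"
      "mor X F j1" "mor F X q1" "mor Y F j2" "mor F Y q2"
      and e: "q1 i * j1 i = 1\<^sub>m (dimv X i)" "q2 i * j2 i = 1\<^sub>m (dimv Y i)"
      "q1 i * j2 i = 0\<^sub>m (dimv X i) (dimv Y i)" "q2 i * j1 i = 0\<^sub>m (dimv Y i) (dimv X i)"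
      and id: "i1 i * p1 i + i2 i * p2 i = 1\<^sub>m (dimv E i)"
      using b c by (auto simp: biproduct_def)
    note [simp] = m[THEN mor_dim(1)] m[THEN mor_dim(2)]
    have "(i1 i * q1 i + i2 i * q2 i) * (j1 i * p1 i + j2 i * p2 i) =
      i1 i * (q1 i * j1 i) * p1 i + i2 i * (q2 i * j1 i) * p1 i +
      (i1 i * (q1 i * j2 i) * p2 i + i2 i * (q2 i * j2 i) * p2 i)"
      by (simp add: mat_algebra)
    also have "\<dots> = i1 i * p1 i + i2 i * p2 i"
      by (simp only: e) (simp add: mat_algebra)
    finally show ?thesis using id by simp
  qed
  show ?thesis
    unfolding iso_pair_def using *[OF E F b c] *[OF F E c b] **[OF b c] **[OF c b] by blast
qed

lemma total_rep_quotient: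
  assumes Y: "total_rep Y"
    and q: "\<And>i. q i \<in> carrier_mat (r i) (dimv Y i)" and s: "\<And>i. s i \<in> carrier_mat (dimv Y i) (r i)"
  shows "total_rep \<lparr>dimv = r, arr = \<lambda>i. q (Suc i) * arr Y i * s i\<rparr>"
proof -
  have "q (Suc i) * arr Y i * s i \<in> carrier_mat (r (Suc i)) (r i)" for i
    using carrier_matD[OF q[of "Suc i"]] carrier_matD[OF s[of i]] by (intro carrier_matI) simp_all
  then show ?thesis by (simp add: total_rep_def)
qed

text \<open>Cokernels are chosen at every vertex, and an arrow of \<open>W\<close> is computed on
  representatives selected by \<open>s\<close>. The splittings \<open>s\<close> and \<open>t\<close>
  need not commute with the arrows; that \<open>q\<close> does follows from
  \<open>q * f = 0\<close>.\<close>

lemma cokernel_exists: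
  assumes X: "total_rep X" and Y: "total_rep Y" and f: "mor X Y f"
  obtains W q s t where "total_rep W" "mor Y W q"
    "\<And>i. q i * f i = 0\<^sub>m (dimv W i) (dimv X i)"
    "\<And>i. s i \<in> carrier_mat (dimv Y i) (dimv W i)" "\<And>i. t i \<in> carrier_mat (dimv X i) (dimv Y i)"
    "\<And>i. q i * s i = 1\<^sub>m (dimv W i)" "\<And>i. s i * q i + f i * t i = 1\<^sub>m (dimv Y i)"
proof -
  have "\<forall>i. \<exists>r q s t. q \<in> carrier_mat r (dimv Y i) \<and> s \<in> carrier_mat (dimv Y i) r \<and>
    t \<in> carrier_mat (dimv X i) (dimv Y i) \<and>
    q * f i = 0\<^sub>m r (dimv X i) \<and> q * s = 1\<^sub>m r \<and> s * q + f i * t = 1\<^sub>m (dimv Y i)"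
    using mat_cokernel[OF mor_carrier[OF f]] by blast
  then obtain r q s t where c: "\<And>i. q i \<in> carrier_mat (r i) (dimv Y i)"
    "\<And>i. s i \<in> carrier_mat (dimv Y i) (r i)" "\<And>i. t i \<in> carrier_mat (dimv X i) (dimv Y i)"
    and e: "\<And>i. q i * f i = 0\<^sub>m (r i) (dimv X i)" "\<And>i. q i * s i = 1\<^sub>m (r i)"
      "\<And>i. s i * q i + f i * t i = 1\<^sub>m (dimv Y i)"
    by metis
  note [simp] = carrier_matD[OF c(1)] carrier_matD[OF c(2)] carrier_matD[OF c(3)] mor_dim[OF f]
    total_rep_dim[OF X] total_rep_dim[OF Y]
  define W where "W = \<lparr>dimv = r, arr = \<lambda>i. q (Suc i) * arr Y i * s i\<rparr>"
  have W: "total_rep W" unfolding W_def by (rule total_rep_quotient[OF Y c(1,2)])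
  have "mor Y W q"
  proof (rule morI)
    fix i
    have "q (Suc i) * arr Y i = q (Suc i) * arr Y i * (s i * q i + f i * t i)"
      by (simp add: e(3) mat_algebra)
    also have "\<dots> = arr W i * q i + q (Suc i) * (arr Y i * f i) * t i"
      by (simp add: W_def mat_algebra)
    also have "q (Suc i) * (arr Y i * f i) = q (Suc i) * f (Suc i) * arr X i"
      by (simp add: mor_comm[OF f, symmetric] mat_algebra)
    finally show "q (Suc i) * arr Y i = arr W i * q i"
      by (simp add: e(1) W_def mat_algebra)
  qed (simp_all add: W_def)
  with W show ?thesis
    by (rule that[of W q s t]) (auto simp: W_def c e simp del: carrier_matD)
qed

text \<open>The complement is realised as the cokernel of \<open>u\<close>. The retraction
  \<open>v\<close> is what makes its section compatible with the arrows.\<close>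

lemma retract_complement:
  assumes M: "total_rep M" and A: "total_rep A" and u: "mor A M u" and v: "mor M A v"
    and vu: "\<And>i. v i * u i = 1\<^sub>m (dimv A i)"
  obtains W j q where "total_rep W" "biproduct M A W u v j q"
proof -
  note [simp] = mor_dim[OF u] mor_dim[OF v] total_rep_dim[OF M] total_rep_dim[OF A]
  obtain W q s t where W: "total_rep W" and q: "mor M W q"
    and e: "\<And>i. q i * u i = 0\<^sub>m (dimv W i) (dimv A i)"
    and c: "\<And>i. s i \<in> carrier_mat (dimv M i) (dimv W i)" "\<And>i. t i \<in> carrier_mat (dimv A i) (dimv M i)"
    and d: "\<And>i. q i * s i = 1\<^sub>m (dimv W i)" "\<And>i. s i * q i + u i * t i = 1\<^sub>m (dimv M i)"
    by (rule cokernel_exists[OF A M u]) blast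
  note [simp] = mor_dim[OF q] total_rep_dim[OF W] carrier_matD[OF c(1)] carrier_matD[OF c(2)]
  \<comment> \<open>correct the section \<open>s\<close> by \<open>u * v\<close>, so that its image is the kernel of \<open>v\<close>\<close>
  define j where "j i = s i + - (u i * (v i * s i))" for i
  have [simp]: "dim_row (j i) = dimv M i" "dim_col (j i) = dimv W i" for i by (simp_all add: j_def)
  have vuZ: "v i * (u i * Z) = Z" if "dim_row Z = dimv A i" for Z i
    using that by (simp add: mat_assoc[symmetric] vu mat_mult_one_left)
  have quZ: "q i * (u i * Z) = 0\<^sub>m (dimv W i) (dim_col Z)" if "dim_row Z = dimv A i" for Z i
    using that by (simp add: mat_assoc[symmetric] e mat_mult_zero_left)
  have vj: "v i * j i = 0\<^sub>m (dimv A i) (dimv W i)" for i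
    by (simp add: j_def mat_algebra vuZ mat_minus_self_add)
  have qj: "q i * j i = 1\<^sub>m (dimv W i)" for i
    by (simp add: j_def mat_algebra quZ d)
  have id: "u i * v i + j i * q i = 1\<^sub>m (dimv M i)" for i
  proof -
    \<comment> \<open>Applying \<open>v\<close> to the identity \<open>s * q + u * t = 1\<close>
      determines \<open>t\<close>.\<close>
    have t: "t i = v i + - (v i * (s i * q i))"
    proof -
      have "v i * (s i * q i) + t i = v i"
        using arg_cong[OF d(2), of "\<lambda>N. v i * N" i] by (simp add: mat_algebra vuZ)
      then have "v i + - (v i * (s i * q i)) = v i * (s i * q i) + t i + - (v i * (s i * q i))" by simp
      also have "\<dots> = t i + (v i * (s i * q i) + - (v i * (s i * q i)))" by (simp add: mat_add_ac)
      also have "\<dots> = t i" by (simp add: mat_minus_self_add mat_algebra)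
      finally show ?thesis by simp
    qed
    have "u i * v i + j i * q i = s i * q i + u i * (v i + - (v i * (s i * q i)))"
      by (simp add: j_def mat_algebra mat_add_ac)
    then show ?thesis using d(2)[of i] by (simp flip: t)
  qed
  have "mor W M j"
  proof (rule morI)
    fix i
    \<comment> \<open>Decompose \<open>arr M i * j i\<close> along \<open>u * v + j * q = 1\<close>:
      its component under \<open>v\<close> vanishes and its component under \<open>q\<close> is
      \<open>arr W i\<close>.\<close>
    have "j (Suc i) * arr W i = (u (Suc i) * v (Suc i) + j (Suc i) * q (Suc i)) * (arr M i * j i)"
    proof -
      have "v (Suc i) * (arr M i * j i) = 0\<^sub>m (dimv A (Suc i)) (dimv W i)"
        by (simp add: mor_comm_assoc[OF v M A] vj mat_algebra)
      moreover have "q (Suc i) * (arr M i * j i) = arr W i"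
        by (simp add: mor_comm_assoc[OF q M W] qj mat_algebra)
      ultimately show ?thesis by (simp add: mat_algebra)
    qed
    then show "j (Suc i) * arr W i = arr M i * j i" by (simp add: id mat_algebra)
  qed simp_all
  then have "biproduct M A W u v j q"
    unfolding biproduct_def using u v q vu vj qj id e by blast
  with W that show ?thesis by blast
qed

section \<open>Padding and direct sums\<close>

text \<open>An inverse taken vertex by vertex commutes with the arrows automatically.\<close>

lemma iso_pairI:
  assumes X: "total_rep X" and Y: "total_rep Y" and u: "mor X Y u"
    and v: "\<And>i. v i \<in> carrier_mat (dimv X i) (dimv Y i)"
    and vu: "\<And>i. v i * u i = 1\<^sub>m (dimv X i)" and uv: "\<And>i. u i * v i = 1\<^sub>m (dimv Y i)"
  shows "iso_pair X Y u v"
proof -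
  note [simp] = mor_dim[OF u] carrier_matD[OF v] total_rep_dim[OF X] total_rep_dim[OF Y]
  have "mor Y X v"
  proof (rule morI)
    fix i
    have "v (Suc i) * arr Y i = v (Suc i) * (arr Y i * (u i * v i))"
      by (simp add: uv mat_mult_one_right)
    also have "\<dots> = v (Suc i) * u (Suc i) * (arr X i * v i)"
      by (simp add: mat_algebra mor_comm_assoc[OF u X Y])
    finally show "v (Suc i) * arr Y i = arr X i * v i"
      by (simp add: vu mat_mult_one_left)
  qed simp_all
  then show ?thesis using u vu uv by (simp add: iso_pair_def)
qed

lemma iso_pair_refl: "total_rep X \<Longrightarrow> iso_pair X X (\<lambda>i. 1\<^sub>m (dimv X i)) (\<lambda>i. 1\<^sub>m (dimv X i))"
  by (simp add: iso_pair_def mor_one)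

lemma iso_pair_sym: "iso_pair X Y u v \<Longrightarrow> iso_pair Y X v u"
  by (simp add: iso_pair_def)

lemma iso_pair_trans:
  assumes X: "total_rep X" and Y: "total_rep Y" and Z: "total_rep Z"
    and uv: "iso_pair X Y u v" and ws: "iso_pair Y Z w s"
  shows "iso_pair X Z (\<lambda>i. w i * u i) (\<lambda>i. v i * s i)"
proof -
  have *: "p i * q i * (r i * t i) = 1\<^sub>m (dimv X i)"
    if "mor Y X p" "mor Z Y q" "mor Y Z r" "mor X Y t" "q i * r i = 1\<^sub>m (dimv Y i)" "p i * t i = 1\<^sub>m (dimv X i)"
    for X Z :: "'a rep" and p q r t and i
  proof -
    note [simp] = that(1-4)[THEN mor_dim(1)] that(1-4)[THEN mor_dim(2)]
    have "p i * q i * (r i * t i) = p i * ((q i * r i) * t i)" by (simp add: mat_algebra)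
    also have "\<dots> = p i * t i" by (simp only: that(5)) (simp add: mat_algebra)
    finally show ?thesis using that(6) by simp
  qed
  from uv ws show ?thesis
    unfolding iso_pair_def
    by (auto intro: mor_comp[OF X Y Z] mor_comp[OF Z Y X] *)
qed

text \<open>Extension by zero to all vertices. With zero spaces at \<open>0\<close> and \<open>n + 1\<close>, the modules whose support
  ends at \<open>1\<close> or \<open>n\<close> need no separate treatment.\<close>

definition pad_rep :: "nat \<Rightarrow> 'k::field rep \<Rightarrow> 'k rep" where
  "pad_rep n X = (let d = (\<lambda>i. if i \<in> {1..n} then dimv X i else 0) in
     \<lparr>dimv = d, arr = (\<lambda>i. if i \<in> {1..<n} then arr X i else 0\<^sub>m (d (Suc i)) (d i))\<rparr>)"

text \<open>Between zero spaces the empty matrix is the only one, so padding is a bijection from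
  \<open>Hom n X Y\<close> onto the morphisms of the padded representations.\<close>

definition pad_fam :: "nat \<Rightarrow> (nat \<Rightarrow> 'k::field mat) \<Rightarrow> nat \<Rightarrow> 'k mat" where
  "pad_fam n s i = (if i \<in> {1..n} then s i else 0\<^sub>m 0 0)"

lemma dimv_pad_rep: "dimv (pad_rep n X) i = (if i \<in> {1..n} then dimv X i else 0)"
  by (simp add: pad_rep_def Let_def)

lemma arr_pad_rep:
  "i \<in> {1..<n} \<Longrightarrow> arr (pad_rep n X) i = arr X i"
  "i \<notin> {1..<n} \<Longrightarrow> arr (pad_rep n X) i = 0\<^sub>m (dimv (pad_rep n X) (Suc i)) (dimv (pad_rep n X) i)"
  by (auto simp: pad_rep_def Let_def)

lemma total_pad_rep: "is_rep n X \<Longrightarrow> total_rep (pad_rep n X)"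
  by (auto simp: total_rep_def is_rep_def pad_rep_def Let_def)

text \<open>An arrow at a zero space is an empty matrix, hence unique. So cokernels, glued
  representations and interval modules are equal, not merely isomorphic, to their paddings.\<close>

lemma pad_rep_eqI:
  assumes "total_rep W" "\<And>i. i \<notin> {1..n} \<Longrightarrow> dimv W i = 0"
  shows "pad_rep n W = W"
proof (rule rep.equality)
  show d: "dimv (pad_rep n W) = dimv W" using assms(2) by (auto simp: dimv_pad_rep)
  show "arr (pad_rep n W) = arr W"
  proof
    fix i
    show "arr (pad_rep n W) i = arr W i"
    proof (cases "i \<in> {1..<n}")
      case False
      then have "i \<notin> {1..n} \<or> Suc i \<notin> {1..n}" by auto
      then show ?thesis using assms False total_rep_dim[OF assms(1), of i]
        by (intro mat_empty_eq) (auto simp: arr_pad_rep(2) d)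
    qed (simp add: arr_pad_rep)
  qed
qed simp

lemma is_rep_total_rep: "total_rep W \<Longrightarrow> is_rep n W"
  by (auto simp: total_rep_def is_rep_def)

lemma mor_pad_fam:
  assumes X: "is_rep n X" and Y: "is_rep n Y" and f: "f \<in> Hom n X Y"
  shows "mor (pad_rep n X) (pad_rep n Y) (pad_fam n f)"
proof (rule morI)
  have c: "f i \<in> carrier_mat (dimv Y i) (dimv X i)" if "i \<in> {1..n}" for i
    using f that by (auto simp: Hom_def)
  then show r: "dim_row (pad_fam n f i) = dimv (pad_rep n Y) i" for i
    by (auto simp: pad_fam_def dimv_pad_rep)
  show d: "dim_col (pad_fam n f i) = dimv (pad_rep n X) i" for i
    using c by (auto simp: pad_fam_def dimv_pad_rep)
  fix i
  show "pad_fam n f (Suc i) * arr (pad_rep n X) i = arr (pad_rep n Y) i * pad_fam n f i"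
  proof (cases "i \<in> {1..<n}")
    case True
    then show ?thesis using f by (auto simp: Hom_def pad_fam_def arr_pad_rep)
  next
    case False
    then have "i \<notin> {1..n} \<or> Suc i \<notin> {1..n}" by auto
    then show ?thesis
      using total_rep_dim[OF total_pad_rep[OF X], of i] total_rep_dim[OF total_pad_rep[OF Y], of i] r d
      by (intro mat_empty_eq) (auto simp: dimv_pad_rep)
  qed
qed

lemma Hom_restrict:
  assumes "mor (pad_rep n X) (pad_rep n Y) s"
  shows "restrict s {1..n} \<in> Hom n X Y"
proof -
  have "s i \<in> carrier_mat (dimv Y i) (dimv X i)" if "i \<in> {1..n}" for i
    using mor_carrier[OF assms, of i] that by (simp add: dimv_pad_rep)
  moreover have "s (Suc i) * arr X i = arr Y i * s i" if "i \<in> {1..<n}" for i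
    using mor_comm[OF assms, of i] that by (simp add: arr_pad_rep)
  ultimately show ?thesis by (auto simp: Hom_def)
qed

lemma pad_restrict:
  assumes "mor (pad_rep n X) (pad_rep n Y) s"
  shows "pad_fam n (restrict s {1..n}) = s"
proof
  fix i
  show "pad_fam n (restrict s {1..n}) i = s i"
    using mor_carrier[OF assms, of i] by (auto simp: pad_fam_def dimv_pad_rep)
qed

lemma restrict_pad: "f \<in> Hom n X Y \<Longrightarrow> restrict (pad_fam n f) {1..n} = f"
  by (rule ext) (auto simp: Hom_def pad_fam_def restrict_def PiE_def extensional_def)

lemma comp_hom_restrict: "comp_hom n (restrict g {1..n}) (restrict f {1..n}) = restrict (\<lambda>i. g i * f i) {1..n}"
  by (auto simp: comp_hom_def)

lemma zero_hom_mem: "is_rep n X \<Longrightarrow> is_rep n Y \<Longrightarrow> zero_hom n X Y \<in> Hom n X Y"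
  unfolding Hom_def
proof (intro CollectI conjI ballI)
  fix i assume "is_rep n X" "is_rep n Y" and i: "i \<in> {1..<n}"
  then have "arr X i \<in> carrier_mat (dimv X (i + 1)) (dimv X i)" "arr Y i \<in> carrier_mat (dimv Y (i + 1)) (dimv Y i)"
    by (auto simp: is_rep_def)
  then show "zero_hom n X Y (i + 1) * arr X i = arr Y i * zero_hom n X Y i"
    using i by (simp add: zero_hom_def)
qed (simp add: zero_hom_def)

section \<open>Vanishing of Hom and isomorphisms after padding\<close>

lemma Hom_vanishes_iff:
  assumes X: "is_rep n X" and Y: "is_rep n Y"
  shows "Hom_vanishes n X Y \<longleftrightarrow> hom_zero (pad_rep n X) (pad_rep n Y)"
proof
  assume h: "Hom_vanishes n X Y"
  show "hom_zero (pad_rep n X) (pad_rep n Y)"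
    unfolding hom_zero_def
  proof (intro allI impI)
    fix s i assume s: "mor (pad_rep n X) (pad_rep n Y) s"
    from Hom_restrict[OF s] h have "restrict s {1..n} = zero_hom n X Y"
      by (simp add: Hom_vanishes_def)
    then have "s i = 0\<^sub>m (dimv Y i) (dimv X i)" if "i \<in> {1..n}"
      using that by (auto simp: zero_hom_def dest: fun_cong[of _ _ i])
    then show "s i = 0\<^sub>m (dimv (pad_rep n Y) i) (dimv (pad_rep n X) i)"
      using mor_carrier[OF s, of i] by (auto simp: dimv_pad_rep)
  qed
next
  assume h: "hom_zero (pad_rep n X) (pad_rep n Y)"
  have "f = zero_hom n X Y" if f: "f \<in> Hom n X Y" for f
  proof -
    have "restrict (pad_fam n f) {1..n} = zero_hom n X Y"
      using hom_zeroD[OF h mor_pad_fam[OF X Y f]] by (auto simp: zero_hom_def dimv_pad_rep)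
    then show ?thesis unfolding restrict_pad[OF f] .
  qed
  then show "Hom_vanishes n X Y"
    using zero_hom_mem[OF X Y] unfolding Hom_vanishes_def by blast
qed

lemma is_isomorphism_iff:
  assumes X: "is_rep n X" and Y: "is_rep n Y" and f: "f \<in> Hom n X Y"
  shows "is_isomorphism n X Y f \<longleftrightarrow> (\<exists>v. iso_pair (pad_rep n X) (pad_rep n Y) (pad_fam n f) v)"
proof
  assume "is_isomorphism n X Y f"
  then obtain g where g: "g \<in> Hom n Y X" "comp_hom n g f = id_hom n X" "comp_hom n f g = id_hom n Y"
    by (auto simp: is_isomorphism_def)
  have "pad_fam n g i * pad_fam n f i = 1\<^sub>m (dimv (pad_rep n X) i)"
    "pad_fam n f i * pad_fam n g i = 1\<^sub>m (dimv (pad_rep n Y) i)" for i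
    using fun_cong[OF g(2), of i] fun_cong[OF g(3), of i]
    by (auto simp: pad_fam_def comp_hom_def id_hom_def dimv_pad_rep split: if_splits)
  then show "\<exists>v. iso_pair (pad_rep n X) (pad_rep n Y) (pad_fam n f) v"
    using mor_pad_fam[OF X Y f] mor_pad_fam[OF Y X g(1)] by (auto simp: iso_pair_def)
next
  assume "\<exists>v. iso_pair (pad_rep n X) (pad_rep n Y) (pad_fam n f) v"
  then obtain v where v: "iso_pair (pad_rep n X) (pad_rep n Y) (pad_fam n f) v" by blast
  have "v i * f i = 1\<^sub>m (dimv X i)" "f i * v i = 1\<^sub>m (dimv Y i)" if "i \<in> {1..n}" for i
  proof -
    have "v i * pad_fam n f i = 1\<^sub>m (dimv (pad_rep n X) i)"
      "pad_fam n f i * v i = 1\<^sub>m (dimv (pad_rep n Y) i)"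
      using v unfolding iso_pair_def by blast+
    then show "v i * f i = 1\<^sub>m (dimv X i)" "f i * v i = 1\<^sub>m (dimv Y i)"
      using that by (simp_all add: pad_fam_def dimv_pad_rep)
  qed
  then have "comp_hom n (restrict v {1..n}) f = id_hom n X" "comp_hom n f (restrict v {1..n}) = id_hom n Y"
    unfolding comp_hom_def id_hom_def by (auto intro!: restrict_ext)
  moreover have "restrict v {1..n} \<in> Hom n Y X" using v Hom_restrict by (auto simp: iso_pair_def)
  ultimately show "is_isomorphism n X Y f" using f unfolding is_isomorphism_def by blast
qed

lemma isomorphic_iff:
  assumes X: "is_rep n X" and Y: "is_rep n Y"
  shows "isomorphic n X Y \<longleftrightarrow> (\<exists>u v. iso_pair (pad_rep n X) (pad_rep n Y) u v)"
proof
  assume "isomorphic n X Y"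
  then obtain f where "is_isomorphism n X Y f" "f \<in> Hom n X Y"
    by (auto simp: isomorphic_def is_isomorphism_def)
  then show "\<exists>u v. iso_pair (pad_rep n X) (pad_rep n Y) u v"
    using is_isomorphism_iff[OF X Y] by blast
next
  assume "\<exists>u v. iso_pair (pad_rep n X) (pad_rep n Y) u v"
  then obtain u v where u: "iso_pair (pad_rep n X) (pad_rep n Y) u v" by blast
  then have m: "mor (pad_rep n X) (pad_rep n Y) u" by (simp add: iso_pair_def)
  have "is_isomorphism n X Y (restrict u {1..n})"
    unfolding is_isomorphism_iff[OF X Y Hom_restrict[OF m]] pad_restrict[OF m] using u by (rule exI[of _ v])
  then show "isomorphic n X Y"
    unfolding isomorphic_def by (rule exI[of _ "restrict u {1..n}"])
qed

text \<open>The extension of \<open>X\<close> by \<open>Y\<close> attached to the cocycle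
  \<open>h\<close>: the family \<open>h\<close> is the off-diagonal part of the arrows.\<close>

definition glue :: "'k::field rep \<Rightarrow> 'k rep \<Rightarrow> (nat \<Rightarrow> 'k mat) \<Rightarrow> 'k rep" where
  "glue Y X h = \<lparr>dimv = (\<lambda>i. dimv Y i + dimv X i),
     arr = (\<lambda>i. four_block_mat (arr Y i) (h i) (0\<^sub>m (dimv X (Suc i)) (dimv Y i)) (arr X i))\<rparr>"

definition glue_incl1 :: "'k::field rep \<Rightarrow> 'k rep \<Rightarrow> nat \<Rightarrow> 'k mat" where
  "glue_incl1 Y X i = incl1 (dimv Y i) (dimv X i)"
definition glue_incl2 :: "'k::field rep \<Rightarrow> 'k rep \<Rightarrow> nat \<Rightarrow> 'k mat" where
  "glue_incl2 Y X i = incl2 (dimv Y i) (dimv X i)"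
definition glue_proj1 :: "'k::field rep \<Rightarrow> 'k rep \<Rightarrow> nat \<Rightarrow> 'k mat" where
  "glue_proj1 Y X i = (incl1 (dimv Y i) (dimv X i))\<^sup>T"
definition glue_proj2 :: "'k::field rep \<Rightarrow> 'k rep \<Rightarrow> nat \<Rightarrow> 'k mat" where
  "glue_proj2 Y X i = (incl2 (dimv Y i) (dimv X i))\<^sup>T"

lemmas glue_maps = glue_incl1_def glue_incl2_def glue_proj1_def glue_proj2_def


lemma glue_simps:
  assumes Y: "total_rep Y" and X: "total_rep X" and h: "\<And>i. h i \<in> carrier_mat (dimv Y (Suc i)) (dimv X i)"
  shows "arr (glue Y X h) i = glue_incl1 Y X (Suc i) * arr Y i * glue_proj1 Y X i +
    glue_incl2 Y X (Suc i) * arr X i * glue_proj2 Y X i + glue_incl1 Y X (Suc i) * h i * glue_proj2 Y X i"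
  using Y X h by (simp add: glue_def glue_maps total_rep_def four_block_incl)

lemma dimv_glue: "dimv (glue Y X h) i = dimv Y i + dimv X i"
  by (simp add: glue_def)

lemma glue_maps_dim [simp]:
  "dim_row (glue_incl1 Y X i) = dimv Y i + dimv X i" "dim_col (glue_incl1 Y X i) = dimv Y i"
  "dim_row (glue_incl2 Y X i) = dimv Y i + dimv X i" "dim_col (glue_incl2 Y X i) = dimv X i"
  "dim_row (glue_proj1 Y X i) = dimv Y i" "dim_col (glue_proj1 Y X i) = dimv Y i + dimv X i"
  "dim_row (glue_proj2 Y X i) = dimv X i" "dim_col (glue_proj2 Y X i) = dimv Y i + dimv X i"
  by (simp_all add: glue_maps)

lemma glue_maps_orth [simp]:
  "glue_proj1 Y X i * glue_incl1 Y X i = 1\<^sub>m (dimv Y i)"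
  "glue_proj2 Y X i * glue_incl2 Y X i = 1\<^sub>m (dimv X i)"
  "glue_proj1 Y X i * glue_incl2 Y X i = 0\<^sub>m (dimv Y i) (dimv X i)"
  "glue_proj2 Y X i * glue_incl1 Y X i = 0\<^sub>m (dimv X i) (dimv Y i)"
  "glue_incl1 Y X i * glue_proj1 Y X i + glue_incl2 Y X i * glue_proj2 Y X i = 1\<^sub>m (dimv Y i + dimv X i)"
  by (simp_all add: glue_maps)

lemma glue_orth_assoc:
  "dim_row A = dimv Y i \<Longrightarrow> glue_proj1 Y X i * (glue_incl1 Y X i * A) = A"
  "dim_row B = dimv X i \<Longrightarrow> glue_proj2 Y X i * (glue_incl2 Y X i * B) = B"
  "dim_row B = dimv X i \<Longrightarrow> glue_proj1 Y X i * (glue_incl2 Y X i * B) = 0\<^sub>m (dimv Y i) (dim_col B)"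
  "dim_row A = dimv Y i \<Longrightarrow> glue_proj2 Y X i * (glue_incl1 Y X i * A) = 0\<^sub>m (dimv X i) (dim_col A)"
  by (simp_all add: glue_maps incl_orth_assoc)

lemma total_rep_glue:
  assumes Y: "total_rep Y" and X: "total_rep X" and h: "\<And>i. h i \<in> carrier_mat (dimv Y (Suc i)) (dimv X i)"
  shows "total_rep (glue Y X h)"
  using Y X h by (auto simp: total_rep_def glue_def)

lemma glue_mor:
  assumes Y: "total_rep Y" and X: "total_rep X" and h: "\<And>i. h i \<in> carrier_mat (dimv Y (Suc i)) (dimv X i)"
  shows "mor Y (glue Y X h) (glue_incl1 Y X)" "mor (glue Y X h) X (glue_proj2 Y X)"
  by (rule morI; simp add: glue_simps[OF assms] mat_algebra glue_orth_assoc dimv_glue total_rep_dim[OF Y]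
      total_rep_dim[OF X] carrier_matD[OF h])+

definition direct_sum :: "'k::field rep \<Rightarrow> 'k rep \<Rightarrow> 'k rep" where
  "direct_sum X Y = glue X Y (\<lambda>i. 0\<^sub>m (dimv X (Suc i)) (dimv Y i))"

lemma dimv_direct_sum: "dimv (direct_sum X Y) i = dimv X i + dimv Y i"
  by (simp add: direct_sum_def glue_def)

lemma total_rep_direct_sum: "total_rep X \<Longrightarrow> total_rep Y \<Longrightarrow> total_rep (direct_sum X Y)"
  unfolding direct_sum_def by (rule total_rep_glue) auto

lemma direct_sum_biproduct:
  assumes X: "total_rep X" and Y: "total_rep Y"
  shows "biproduct (direct_sum X Y) X Y (glue_incl1 X Y) (glue_proj1 X Y) (glue_incl2 X Y) (glue_proj2 X Y)"
proof -
  let ?h = "\<lambda>i. 0\<^sub>m (dimv X (Suc i)) (dimv Y i) :: 'a mat"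
  have h: "?h i \<in> carrier_mat (dimv X (Suc i)) (dimv Y i)" for i by simp
  have "mor (direct_sum X Y) X (glue_proj1 X Y)" "mor Y (direct_sum X Y) (glue_incl2 X Y)"
    unfolding direct_sum_def
    by (rule morI; simp add: glue_simps[OF X Y h] mat_algebra glue_orth_assoc dimv_glue total_rep_dim[OF Y]
      total_rep_dim[OF X])+
  then show ?thesis
    using glue_mor[OF X Y h] by (simp add: biproduct_def dimv_direct_sum flip: direct_sum_def)
qed

lemma dim_diag_block_arr:
  assumes "\<forall>M\<in>set Ms. is_rep n M" "i \<in> {1..<n}"
  shows "diag_block_mat (map (\<lambda>M. arr M i) Ms) \<in>
    carrier_mat (\<Sum>M\<leftarrow>Ms. dimv M (Suc i)) (\<Sum>M\<leftarrow>Ms. dimv M i)"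
  using assms by (induction Ms) (auto simp: is_rep_def Let_def)

lemma is_rep_dsum: "\<forall>M\<in>set Ms. is_rep n M \<Longrightarrow> is_rep n (dsum Ms)"
  using dim_diag_block_arr[of Ms n] by (auto simp: is_rep_def dsum_def)

lemma direct_sum_eqI:
  assumes A: "is_rep n A" and B: "is_rep n B"
    and d: "\<And>i. i \<in> {1..n} \<Longrightarrow> dimv D i = dimv A i + dimv B i"
    and a: "\<And>i. i \<in> {1..<n} \<Longrightarrow> arr D i =
      four_block_mat (arr A i) (0\<^sub>m (dimv A (Suc i)) (dimv B i)) (0\<^sub>m (dimv B (Suc i)) (dimv A i)) (arr B i)"
  shows "pad_rep n D = direct_sum (pad_rep n A) (pad_rep n B)"
proof -
  have "pad_rep n D = pad_rep n (direct_sum (pad_rep n A) (pad_rep n B))"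
    using d a by (auto simp: pad_rep_def Let_def direct_sum_def glue_def fun_eq_iff)
  then show ?thesis
    by (subst (asm) pad_rep_eqI[OF total_rep_direct_sum[OF total_pad_rep[OF A] total_pad_rep[OF B]]])
      (auto simp: dimv_direct_sum dimv_pad_rep)
qed

lemma pad_rep_dsum_Cons:
  assumes "is_rep n M" "\<forall>M\<in>set Ms. is_rep n M"
  shows "pad_rep n (dsum (M # Ms)) = direct_sum (pad_rep n M) (pad_rep n (dsum Ms))"
proof (rule direct_sum_eqI[OF assms(1) is_rep_dsum[OF assms(2)]])
  fix i assume i: "i \<in> {1..<n}"
  then have "dim_row (arr M i) = dimv M (Suc i)" "dim_col (arr M i) = dimv M i"
    using assms(1) by (auto simp: is_rep_def)
  then show "arr (dsum (M # Ms)) i = four_block_mat (arr M i) (0\<^sub>m (dimv M (Suc i)) (dimv (dsum Ms) i))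
      (0\<^sub>m (dimv (dsum Ms) (Suc i)) (dimv M i)) (arr (dsum Ms) i)"
    using dim_diag_block_arr[OF assms(2) i] by (auto simp: dsum_def Let_def)
qed (simp add: dsum_def)

text \<open>The middle term of the split extension is literally \<open>dsum [Y, X]\<close>, whereas
  \<open>pad_rep_dsum_Cons\<close> would leave a summand \<open>dsum [B]\<close>.\<close>

lemma pad_rep_dsum_pair:
  assumes A: "is_rep n A" and B: "is_rep n B"
  shows "pad_rep n (dsum [A, B]) = direct_sum (pad_rep n A) (pad_rep n B)"
proof (rule direct_sum_eqI[OF A B])
  fix i assume i: "i \<in> {1..<n}"
  then have d: "dim_row (arr A i) = dimv A (Suc i)" "dim_col (arr A i) = dimv A i"
    "dim_row (arr B i) = dimv B (Suc i)" "dim_col (arr B i) = dimv B i"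
    using A B by (auto simp: is_rep_def)
  have "arr (dsum [A, B]) i = diag_block_mat [arr A i, arr B i]"
    by (simp only: dsum_def rep.simps list.map)
  also have "\<dots> = four_block_mat (arr A i) (0\<^sub>m (dim_row (arr A i)) (dim_col (arr B i)))
      (0\<^sub>m (dim_row (arr B i)) (dim_col (arr A i))) (arr B i)"
    by (subst diag_block_mat.simps(2)) (simp only: diag_block_mat_singleton Let_def)
  finally show "arr (dsum [A, B]) i = four_block_mat (arr A i) (0\<^sub>m (dimv A (Suc i)) (dimv B i))
      (0\<^sub>m (dimv B (Suc i)) (dimv A i)) (arr B i)"
    by (simp only: d)
qed (simp add: dsum_def)

lemma perp_zero:
  assumes z: "(\<forall>i. dimv X i = 0) \<or> (\<forall>i. dimv Y i = 0)"
    and X: "total_rep X" and Y: "total_rep Y"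
  shows "perp X Y"
  unfolding perp_def
proof
  note [simp] = total_rep_dim[OF X] total_rep_dim[OF Y]
  show "hom_zero X Y"
    unfolding hom_zero_def
  proof (intro allI impI)
    fix s i assume "mor X Y s"
    note [simp] = mor_dim[OF this]
    show "s i = 0\<^sub>m (dimv Y i) (dimv X i)" using z by (intro mat_empty_eq) auto
  qed
  show "ext_zero X Y"
  proof (rule ext_zeroI)
    fix h :: "nat \<Rightarrow> 'a mat"
    assume [simp]: "\<And>i. dim_row (h i) = dimv Y (Suc i)" "\<And>i. dim_col (h i) = dimv X i"
    have "0\<^sub>m (dimv Y (Suc i)) (dimv X (Suc i)) * arr X i = arr Y i * 0\<^sub>m (dimv Y i) (dimv X i) + h i" for i
      using z by (intro mat_empty_eq) auto
    then show "\<exists>s. coboundary X Y s h"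
      by (intro exI[of _ "\<lambda>i. 0\<^sub>m (dimv Y i) (dimv X i)"]) (simp add: coboundary_def)
  qed
qed

lemma pad_rep_dsum_Nil: "dimv (pad_rep n (dsum [])) i = 0"
  by (simp add: dimv_pad_rep dsum_def)

lemma perp_dsum_left:
  assumes "\<forall>M\<in>set Ms. is_rep n M" "total_rep Z"
  shows "perp (pad_rep n (dsum Ms)) Z \<longleftrightarrow> (\<forall>M\<in>set Ms. perp (pad_rep n M) Z)"
  using assms(1)
proof (induction Ms)
  case Nil
  show ?case
    using perp_zero[OF _ total_pad_rep[OF is_rep_dsum[of "[]" n]] assms(2)]
    by (auto simp: pad_rep_dsum_Nil)
next
  case (Cons M Ms)
  then have M: "total_rep (pad_rep n M)" "total_rep (pad_rep n (dsum Ms))"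
    by (auto intro: total_pad_rep is_rep_dsum)
  show ?case
    using Cons perp_biproduct_left[OF total_rep_direct_sum[OF M] M assms(2) direct_sum_biproduct[OF M]]
    by (simp add: pad_rep_dsum_Cons)
qed

section \<open>Extensions\<close>

text \<open>Exactness is stated with vectors; solving column by column brings it back to
  matrices.\<close>

lemma mat_solve_columns:
  fixes A :: "'a::comm_ring_1 mat"
  assumes A: "A \<in> carrier_mat m k" and B: "B \<in> carrier_mat m l"
    and ex: "\<And>j. j < l \<Longrightarrow> \<exists>v\<in>carrier_vec k. A *\<^sub>v v = col B j"
  obtains X where "X \<in> carrier_mat k l" "A * X = B"
proof -
  obtain v where v: "\<And>j. j < l \<Longrightarrow> v j \<in> carrier_vec k" "\<And>j. j < l \<Longrightarrow> A *\<^sub>v v j = col B j"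
    using ex by metis
  define X where "X = mat k l (\<lambda>(i, j). v j $ i)"
  have X: "X \<in> carrier_mat k l" by (simp add: X_def)
  have c: "col X j = v j" if "j < l" for j
    using v(1)[OF that] that by (intro eq_vecI) (auto simp: X_def)
  have "A * X = B"
  proof (rule mat_col_eqI)
    fix j assume "j < dim_col B"
    then have "j < l" using B by simp
    then show "col (A * X) j = col B j" unfolding col_mult2[OF A X \<open>j < l\<close>] c[OF \<open>j < l\<close>] by (rule v(2))
  qed (use A B X in auto)
  with X that show ?thesis by blast
qed

lemma mat_cancel_inj:
  fixes A :: "'a::comm_ring_1 mat"
  assumes A: "A \<in> carrier_mat m k" and inj: "inj_on (\<lambda>v. A *\<^sub>v v) (carrier_vec k)"
    and X: "X \<in> carrier_mat k l" and Y: "Y \<in> carrier_mat k l" and eq: "A * X = A * Y"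
  shows "X = Y"
proof (rule mat_col_eqI)
  fix j assume "j < dim_col Y"
  then have j: "j < l" using Y by simp
  have "A *\<^sub>v col X j = A *\<^sub>v col Y j"
    using arg_cong[OF eq, of "\<lambda>M. col M j"] col_mult2[OF A X j] col_mult2[OF A Y j] by simp
  then show "col X j = col Y j"
    using inj X Y j by (auto simp: inj_on_def)
qed (use X Y in auto)

text \<open>Over a field a short exact sequence of vector spaces splits. Here \<open>s\<close> is a
  section of \<open>b\<close> and \<open>r\<close> the complementary retraction of
  \<open>a\<close>.\<close>

lemma exact_iff_split:
  fixes a b :: "'a::field mat"
  assumes a: "a \<in> carrier_mat e y" and b: "b \<in> carrier_mat x e"
  shows "inj_on (\<lambda>v. a *\<^sub>v v) (carrier_vec y) \<and> (\<lambda>v. a *\<^sub>v v) ` carrier_vec y = mat_kernel b \<and>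
      (\<lambda>v. b *\<^sub>v v) ` carrier_vec e = carrier_vec x \<longleftrightarrow>
    (\<exists>s r. s \<in> carrier_mat e x \<and> r \<in> carrier_mat y e \<and> b * s = 1\<^sub>m x \<and> r * a = 1\<^sub>m y \<and>
      b * a = 0\<^sub>m x y \<and> a * r + s * b = 1\<^sub>m e)" (is "?L \<longleftrightarrow> ?R")
proof
  assume L: ?L
  note [simp] = carrier_matD[OF a] carrier_matD[OF b]
  have "\<exists>v\<in>carrier_vec e. b *\<^sub>v v = col (1\<^sub>m x) j" if "j < x" for j
  proof -
    have "col (1\<^sub>m x) j \<in> (\<lambda>v. b *\<^sub>v v) ` carrier_vec e" using L that by auto
    then show ?thesis by (metis imageE)
  qed
  then obtain s where s: "s \<in> carrier_mat e x" "b * s = 1\<^sub>m x"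
    by (rule mat_solve_columns[OF b one_carrier_mat])
  note [simp] = carrier_matD[OF s(1)]
  have k: "\<exists>v\<in>carrier_vec y. a *\<^sub>v v = w" if "w \<in> carrier_vec e" "b *\<^sub>v w = 0\<^sub>v x" for w
  proof -
    have "w \<in> (\<lambda>v. a *\<^sub>v v) ` carrier_vec y" using L that b by (auto simp: mat_kernel_def)
    then show ?thesis by (metis imageE)
  qed
  \<comment> \<open>This projection has values in the kernel of \<open>b\<close>, which is the image
    of \<open>a\<close>; so it factors through \<open>a\<close>, and the factor is
    \<open>r\<close>.\<close>
  let ?N = "1\<^sub>m e + - (s * b)"
  have N: "?N \<in> carrier_mat e e" by (rule carrier_matI) auto
  have "b * ?N = b + - (b * s * b)" by (simp add: mat_algebra)
  then have bN: "b * ?N = 0\<^sub>m x e" by (simp add: s(2) mat_algebra mat_minus_self_add)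
  have "\<exists>v\<in>carrier_vec y. a *\<^sub>v v = col ?N j" if "j < e" for j
    using col_mult2[OF b N that] that bN by (intro k carrier_vecI) auto
  then obtain r where r: "r \<in> carrier_mat y e" "a * r = ?N"
    by (rule mat_solve_columns[OF a N])
  note [simp] = carrier_matD[OF r(1)]
  have ba: "b * a = 0\<^sub>m x y"
  proof (rule mat_col_eqI)
    fix j assume "j < dim_col (0\<^sub>m x y :: 'a mat)"
    then have j: "j < y" by simp
    have "a *\<^sub>v unit_vec y j \<in> mat_kernel b" using L by auto
    moreover have "col a j = a *\<^sub>v unit_vec y j"
      using col_mult2[OF a one_carrier_mat j] j by simp
    ultimately show "col (b * a) j = col (0\<^sub>m x y) j"
      using j by (simp add: mat_kernel_def col_mult2[OF b a j])
  qed simp_all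
  have "a * (r * a) = ?N * a" using r(2) by (simp flip: mat_assoc)
  also have "\<dots> = a * 1\<^sub>m y" by (simp add: mat_algebra ba)
  finally have "r * a = 1\<^sub>m y"
    using L by (intro mat_cancel_inj[OF a, of "r * a" y "1\<^sub>m y"]) (auto intro: carrier_matI)
  moreover have "a * r + s * b = 1\<^sub>m e"
    unfolding r(2) by (simp add: mat_add_assoc mat_minus_self_add mat_algebra)
  ultimately show ?R using s r ba by blast
next
  assume ?R
  then obtain s r where c: "s \<in> carrier_mat e x" "r \<in> carrier_mat y e" and e: "b * s = 1\<^sub>m x" "r * a = 1\<^sub>m y"
    "b * a = 0\<^sub>m x y" "a * r + s * b = 1\<^sub>m e" by blast
  have mv: "P *\<^sub>v (Q *\<^sub>v v) = P * Q *\<^sub>v v"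
    if "P \<in> carrier_mat i j" "Q \<in> carrier_mat j k" "v \<in> carrier_vec k" for P Q :: "'a mat" and v i j k
    using that by simp
  have ra: "r *\<^sub>v (a *\<^sub>v v) = v" if "v \<in> carrier_vec y" for v
    using that by (simp add: mv[OF c(2) a] e)
  have ba: "b *\<^sub>v (a *\<^sub>v v) = 0\<^sub>v x" if "v \<in> carrier_vec y" for v
    using that by (auto simp add: mv[OF b a] e)
  have bs: "b *\<^sub>v (s *\<^sub>v v) = v" if "v \<in> carrier_vec x" for v
    using that by (simp add: mv[OF b c(1)] e)
  have ar: "a *\<^sub>v (r *\<^sub>v v) = v" if v: "v \<in> carrier_vec e" "b *\<^sub>v v = 0\<^sub>v x" for v
  proof -
    have "v = (a * r + s * b) *\<^sub>v v" using v e by simp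
    also have "\<dots> = a *\<^sub>v (r *\<^sub>v v) + s *\<^sub>v (b *\<^sub>v v)"
      using a b c v by (simp add: add_mult_distrib_mat_vec[of _ e e])
    also have "s *\<^sub>v (b *\<^sub>v v) = 0\<^sub>v e" using v c by auto
    finally show ?thesis using a c v by simp
  qed
  have "inj_on (\<lambda>v. a *\<^sub>v v) (carrier_vec y)"
    by (rule inj_on_inverseI[of _ "\<lambda>v. r *\<^sub>v v"]) (simp add: ra)
  moreover have "(\<lambda>v. a *\<^sub>v v) ` carrier_vec y = mat_kernel b"
  proof
    show "(\<lambda>v. a *\<^sub>v v) ` carrier_vec y \<subseteq> mat_kernel b"
      using a b ba by (auto simp: mat_kernel_def)
    show "mat_kernel b \<subseteq> (\<lambda>v. a *\<^sub>v v) ` carrier_vec y"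
    proof
      fix v assume "v \<in> mat_kernel b"
      then have "v \<in> carrier_vec e" "b *\<^sub>v v = 0\<^sub>v x" using b by (auto simp: mat_kernel_def)
      from ar[OF this] show "v \<in> (\<lambda>v. a *\<^sub>v v) ` carrier_vec y"
        using c \<open>v \<in> carrier_vec e\<close> by (intro image_eqI[of _ _ "r *\<^sub>v v"]) auto
    qed
  qed
  moreover have "(\<lambda>v. b *\<^sub>v v) ` carrier_vec e = carrier_vec x"
  proof
    show "(\<lambda>v. b *\<^sub>v v) ` carrier_vec e \<subseteq> carrier_vec x" using b by auto
    show "carrier_vec x \<subseteq> (\<lambda>v. b *\<^sub>v v) ` carrier_vec e"
    proof
      fix w :: "'a vec" assume "w \<in> carrier_vec x"
      then show "w \<in> (\<lambda>v. b *\<^sub>v v) ` carrier_vec e"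
        using bs[of w] c by (intro image_eqI[of _ _ "s *\<^sub>v w"]) auto
    qed
  qed
  ultimately show ?L by blast
qed

lemma extensions_iff:
  assumes X: "is_rep n X" and Y: "is_rep n Y"
  shows "(E, a, b) \<in> extensions n X Y \<longleftrightarrow> is_rep n E \<and> a \<in> Hom n Y E \<and> b \<in> Hom n E X \<and>
    (\<forall>i\<in>{1..n}. \<exists>s r. s \<in> carrier_mat (dimv E i) (dimv X i) \<and> r \<in> carrier_mat (dimv Y i) (dimv E i) \<and>
      b i * s = 1\<^sub>m (dimv X i) \<and> r * a i = 1\<^sub>m (dimv Y i) \<and>
      b i * a i = 0\<^sub>m (dimv X i) (dimv Y i) \<and> a i * r + s * b i = 1\<^sub>m (dimv E i))"
proof -
  have "a i \<in> carrier_mat (dimv E i) (dimv Y i)" "b i \<in> carrier_mat (dimv X i) (dimv E i)"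
    if "a \<in> Hom n Y E" "b \<in> Hom n E X" "i \<in> {1..n}" for i
    using that by (auto simp: Hom_def)
  note e = exact_iff_split[OF this]
  show ?thesis
    by (simp only: extensions_def mem_Collect_eq case_prod_conv) (intro conj_cong refl ball_cong e; assumption)
qed

lemma extensionsD:
  assumes "is_rep n X" "is_rep n Y" "(E, a, b) \<in> extensions n X Y"
  shows "is_rep n E" "a \<in> Hom n Y E" "b \<in> Hom n E X"
  using assms(3) unfolding extensions_iff[OF assms(1,2)] by blast+

lemma Hom_dim:
  assumes "f \<in> Hom n X Y" "i \<in> {1..n}"
  shows "dim_row (f i) = dimv Y i" "dim_col (f i) = dimv X i"
  using assms by (auto simp: Hom_def)

lemma iso_pairD:
  assumes "iso_pair X Y u v"
  shows "mor X Y u" "mor Y X v" "v i * u i = 1\<^sub>m (dimv X i)" "u i * v i = 1\<^sub>m (dimv Y i)"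
  using assms unfolding iso_pair_def by blast+

lemma iso_pair_pad_dim:
  assumes "iso_pair (pad_rep n X) (pad_rep n Y) u v" "i \<in> {1..n}"
  shows "dim_row (u i) = dimv Y i" "dim_col (u i) = dimv X i"
    "dim_row (v i) = dimv X i" "dim_col (v i) = dimv Y i"
    "v i * u i = 1\<^sub>m (dimv X i)" "u i * v i = 1\<^sub>m (dimv Y i)"
  using mor_dim[OF iso_pairD(1)[OF assms(1)], of i] mor_dim[OF iso_pairD(2)[OF assms(1)], of i]
    iso_pairD(3,4)[OF assms(1), of i] assms(2) by (simp_all add: dimv_pad_rep)

lemma ext_equiv_iff:
  assumes X: "is_rep n X" and Y: "is_rep n Y"
  shows "((E, a, b), (E', a', b')) \<in> ext_equiv n X Y \<longleftrightarrow>
    (E, a, b) \<in> extensions n X Y \<and> (E', a', b') \<in> extensions n X Y \<and>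
    (\<exists>u v. iso_pair (pad_rep n E) (pad_rep n E') u v \<and>
      (\<forall>i\<in>{1..n}. u i * a i = a' i \<and> b' i * u i = b i))" (is "?L \<longleftrightarrow> ?R")
proof
  assume ?L
  then obtain f where e: "(E, a, b) \<in> extensions n X Y" "(E', a', b') \<in> extensions n X Y" and
    f: "is_isomorphism n E E' f" "comp_hom n f a = a'" "comp_hom n b' f = b"
    by (auto simp: ext_equiv_def)
  then have E: "is_rep n E" "is_rep n E'" "f \<in> Hom n E E'"
    using extensionsD(1)[OF X Y] by (auto simp: is_isomorphism_def)
  from f(1) obtain v where "iso_pair (pad_rep n E) (pad_rep n E') (pad_fam n f) v"
    using is_isomorphism_iff[OF E] by blast
  moreover have "pad_fam n f i * a i = a' i" "b' i * pad_fam n f i = b i" if "i \<in> {1..n}" for i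
    using fun_cong[OF f(2), of i] fun_cong[OF f(3), of i] that by (auto simp: pad_fam_def comp_hom_def)
  ultimately show ?R using e by blast
next
  assume ?R
  then obtain u v where e: "(E, a, b) \<in> extensions n X Y" "(E', a', b') \<in> extensions n X Y" and
    u: "iso_pair (pad_rep n E) (pad_rep n E') u v" and
    c: "\<And>i. i \<in> {1..n} \<Longrightarrow> u i * a i = a' i" "\<And>i. i \<in> {1..n} \<Longrightarrow> b' i * u i = b i"
    by blast
  have E: "is_rep n E" "is_rep n E'" "b \<in> Hom n E X" "a' \<in> Hom n Y E'"
    using extensionsD[OF X Y e(1)] extensionsD[OF X Y e(2)] by blast+
  have m: "mor (pad_rep n E) (pad_rep n E') u" using u by (simp add: iso_pair_def)
  have "is_isomorphism n E E' (restrict u {1..n})"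
    unfolding is_isomorphism_iff[OF E(1,2) Hom_restrict[OF m]] pad_restrict[OF m]
    using u by (rule exI[of _ v])
  moreover have "comp_hom n (restrict u {1..n}) a = a'"
  proof
    fix i show "comp_hom n (restrict u {1..n}) a i = a' i"
      using E(4) c(1)[of i] by (cases "i \<in> {1..n}") (auto simp: comp_hom_def Hom_def PiE_def extensional_def)
  qed
  moreover have "comp_hom n b' (restrict u {1..n}) = b"
  proof
    fix i show "comp_hom n b' (restrict u {1..n}) i = b i"
      using E(3) c(2)[of i] by (cases "i \<in> {1..n}") (auto simp: comp_hom_def Hom_def PiE_def extensional_def)
  qed
  ultimately show ?L using e unfolding ext_equiv_def by blast
qed

section \<open>Equivalence of extensions and the split class\<close>

lemma ext_equiv_refl:
  assumes X: "is_rep n X" and Y: "is_rep n Y" and e: "e \<in> extensions n X Y"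
  shows "(e, e) \<in> ext_equiv n X Y"
proof -
  obtain E a b where E: "e = (E, a, b)" by (cases e)
  note * = extensionsD[OF X Y e[unfolded E]]
  have "1\<^sub>m (dimv (pad_rep n E) i) * a i = a i \<and> b i * 1\<^sub>m (dimv (pad_rep n E) i) = b i"
    if "i \<in> {1..n}" for i
    using that Hom_dim[OF *(2) that] Hom_dim[OF *(3) that] by (simp add: dimv_pad_rep mat_algebra)
  then show ?thesis
    using e iso_pair_refl[OF total_pad_rep[OF *(1)]] unfolding E ext_equiv_iff[OF X Y] by blast
qed

lemma ext_equiv_sym:
  assumes X: "is_rep n X" and Y: "is_rep n Y" and e: "(e, e') \<in> ext_equiv n X Y"
  shows "(e', e) \<in> ext_equiv n X Y"
proof -
  obtain E a b where E: "e = (E, a, b)" by (cases e)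
  obtain E' a' b' where E': "e' = (E', a', b')" by (cases e')
  from e obtain u v where e: "(E, a, b) \<in> extensions n X Y" "(E', a', b') \<in> extensions n X Y"
    and u: "iso_pair (pad_rep n E) (pad_rep n E') u v"
    and c: "\<And>i. i \<in> {1..n} \<Longrightarrow> u i * a i = a' i" "\<And>i. i \<in> {1..n} \<Longrightarrow> b' i * u i = b i"
    unfolding E E' ext_equiv_iff[OF X Y] by blast
  have "v i * a' i = a i \<and> b i * v i = b' i" if i: "i \<in> {1..n}" for i
  proof -
    note d = iso_pair_pad_dim(1-4)[OF u i] Hom_dim[OF extensionsD(2)[OF X Y e(1)] i]
      Hom_dim[OF extensionsD(3)[OF X Y e(2)] i]
    have "v i * a' i = (v i * u i) * a i" "b i * v i = b' i * (u i * v i)"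
      by (simp_all add: c[OF i, symmetric] d mat_assoc)
    then show ?thesis unfolding iso_pair_pad_dim(5,6)[OF u i] by (simp add: d mat_algebra)
  qed
  then show ?thesis
    using e iso_pair_sym[OF u] unfolding E E' ext_equiv_iff[OF X Y] by blast
qed

lemma ext_equiv_trans:
  assumes X: "is_rep n X" and Y: "is_rep n Y"
    and e: "(e, e') \<in> ext_equiv n X Y" and f: "(e', e'') \<in> ext_equiv n X Y"
  shows "(e, e'') \<in> ext_equiv n X Y"
proof -
  obtain E a b where E: "e = (E, a, b)" by (cases e)
  obtain E' a' b' where E': "e' = (E', a', b')" by (cases e')
  obtain E'' a'' b'' where E'': "e'' = (E'', a'', b'')" by (cases e'')
  from e f obtain u v u' v' where e: "(E, a, b) \<in> extensions n X Y" "(E', a', b') \<in> extensions n X Y"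
      "(E'', a'', b'') \<in> extensions n X Y"
    and u: "iso_pair (pad_rep n E) (pad_rep n E') u v" "iso_pair (pad_rep n E') (pad_rep n E'') u' v'"
    and c: "\<And>i. i \<in> {1..n} \<Longrightarrow> u i * a i = a' i" "\<And>i. i \<in> {1..n} \<Longrightarrow> b' i * u i = b i"
      "\<And>i. i \<in> {1..n} \<Longrightarrow> u' i * a' i = a'' i" "\<And>i. i \<in> {1..n} \<Longrightarrow> b'' i * u' i = b' i"
    unfolding E E' E'' ext_equiv_iff[OF X Y] by blast
  have "u' i * u i * a i = a'' i \<and> b'' i * (u' i * u i) = b i" if i: "i \<in> {1..n}" for i
  proof -
    note d = iso_pair_pad_dim(1,2)[OF u(1) i] iso_pair_pad_dim(1,2)[OF u(2) i]
      Hom_dim[OF extensionsD(2)[OF X Y e(1)] i] Hom_dim[OF extensionsD(3)[OF X Y e(3)] i]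
    have "u' i * u i * a i = u' i * (u i * a i)" "b'' i * (u' i * u i) = b'' i * u' i * u i"
      by (simp_all add: d mat_assoc)
    then show ?thesis by (simp add: c[OF i])
  qed
  moreover have "total_rep (pad_rep n E)" "total_rep (pad_rep n E')" "total_rep (pad_rep n E'')"
    using e[THEN extensionsD(1)[OF X Y]] by (auto intro: total_pad_rep)
  ultimately show ?thesis
    using e iso_pair_trans[OF _ _ _ u] unfolding E E'' ext_equiv_iff[OF X Y] by blast
qed

lemma split_ext_eq:
  "split_ext n X Y = (dsum [Y, X], restrict (glue_incl1 (pad_rep n Y) (pad_rep n X)) {1..n},
    restrict (glue_proj2 (pad_rep n Y) (pad_rep n X)) {1..n})"
  unfolding split_ext_def
  by (intro arg_cong2[of _ _ _ _ Pair] refl restrict_ext) (simp_all add: glue_maps dimv_pad_rep incl_append)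

lemma glue_extension:
  assumes X: "is_rep n X" and Y: "is_rep n Y" and E: "is_rep n E"
    and h: "\<And>i. h i \<in> carrier_mat (dimv (pad_rep n Y) (Suc i)) (dimv (pad_rep n X) i)"
    and eq: "pad_rep n E = glue (pad_rep n Y) (pad_rep n X) h"
  shows "(E, restrict (glue_incl1 (pad_rep n Y) (pad_rep n X)) {1..n},
    restrict (glue_proj2 (pad_rep n Y) (pad_rep n X)) {1..n}) \<in> extensions n X Y"
proof -
  let ?X = "pad_rep n X" and ?Y = "pad_rep n Y"
  note T = total_pad_rep[OF Y] total_pad_rep[OF X]
  have "mor ?Y (pad_rep n E) (glue_incl1 ?Y ?X)" "mor (pad_rep n E) ?X (glue_proj2 ?Y ?X)"
    unfolding eq by (rule glue_mor[OF T h])+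
  moreover have "\<exists>s r. s \<in> carrier_mat (dimv E i) (dimv X i) \<and> r \<in> carrier_mat (dimv Y i) (dimv E i) \<and>
      glue_proj2 ?Y ?X i * s = 1\<^sub>m (dimv X i) \<and> r * glue_incl1 ?Y ?X i = 1\<^sub>m (dimv Y i) \<and>
      glue_proj2 ?Y ?X i * glue_incl1 ?Y ?X i = 0\<^sub>m (dimv X i) (dimv Y i) \<and>
      glue_incl1 ?Y ?X i * r + s * glue_proj2 ?Y ?X i = 1\<^sub>m (dimv E i)" if i: "i \<in> {1..n}" for i
  proof -
    have d: "dimv E i = dimv Y i + dimv X i" "dimv ?Y i = dimv Y i" "dimv ?X i = dimv X i"
      using arg_cong[OF eq, of "\<lambda>E. dimv E i"] i by (simp_all add: dimv_pad_rep dimv_glue)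
    show ?thesis
      by (intro exI[of _ "glue_incl2 ?Y ?X i"] exI[of _ "glue_proj1 ?Y ?X i"]) (auto simp: d)
  qed
  ultimately show ?thesis
    unfolding extensions_iff[OF X Y] using E Hom_restrict by (metis restrict_apply')
qed

lemma split_extension:
  assumes X: "is_rep n X" and Y: "is_rep n Y"
  shows "split_ext n X Y \<in> extensions n X Y"
  unfolding split_ext_eq
proof (rule glue_extension[OF X Y is_rep_dsum])
  show "pad_rep n (dsum [Y, X]) = glue (pad_rep n Y) (pad_rep n X)
    (\<lambda>i. 0\<^sub>m (dimv (pad_rep n Y) (Suc i)) (dimv (pad_rep n X) i))"
    by (simp only: pad_rep_dsum_pair[OF Y X] direct_sum_def)
qed (use X Y in auto)

lemma Ext_vanishes_iff_split:
  assumes X: "is_rep n X" and Y: "is_rep n Y"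
  shows "Ext_vanishes n X Y \<longleftrightarrow> (\<forall>e\<in>extensions n X Y. (split_ext n X Y, e) \<in> ext_equiv n X Y)"
    (is "_ \<longleftrightarrow> ?R")
proof
  assume v: "Ext_vanishes n X Y"
  show ?R
  proof
    fix e assume e: "e \<in> extensions n X Y"
    then have "ext_equiv n X Y `` {e} \<in> Ext1 n X Y" by (auto simp: Ext1_def quotient_def)
    with v have "ext_equiv n X Y `` {e} = ext_equiv n X Y `` {split_ext n X Y}"
      by (simp add: Ext_vanishes_def)
    moreover have "e \<in> ext_equiv n X Y `` {e}" using ext_equiv_refl[OF X Y e] by simp
    ultimately show "(split_ext n X Y, e) \<in> ext_equiv n X Y" by simp
  qed
next
  assume r: ?R
  have "ext_equiv n X Y `` {e} = ext_equiv n X Y `` {split_ext n X Y}" if "e \<in> extensions n X Y" for e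
    using r that ext_equiv_sym[OF X Y] ext_equiv_trans[OF X Y] by blast
  then show "Ext_vanishes n X Y"
    using split_extension[OF X Y] unfolding Ext_vanishes_def Ext1_def quotient_def by blast
qed

text \<open>If Ext vanishes, an equivalence from the split extension to the one glued along
  \<open>h\<close> is the identity on both diagonal blocks, and its remaining block bounds
  \<open>h\<close>. Conversely, splittings of an extension at the vertices define a cocycle, and a
  family that bounds it corrects them to a morphism.\<close>

lemma Ext_vanishes_iff:
  assumes X: "is_rep n X" and Y: "is_rep n Y"
  shows "Ext_vanishes n X Y \<longleftrightarrow> ext_zero (pad_rep n X) (pad_rep n Y)"
proof
  let ?X = "pad_rep n X" and ?Y = "pad_rep n Y"
  let ?i1 = "glue_incl1 ?Y ?X" and ?i2 = "glue_incl2 ?Y ?X"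
    and ?p1 = "glue_proj1 ?Y ?X" and ?p2 = "glue_proj2 ?Y ?X"
  note T = total_pad_rep[OF Y] total_pad_rep[OF X]
  note [simp] = total_rep_dim[OF T(1)] total_rep_dim[OF T(2)]
  note sum = total_rep_direct_sum[OF T] direct_sum_biproduct[OF T]
  have S: "pad_rep n (dsum [Y, X]) = direct_sum ?Y ?X" by (rule pad_rep_dsum_pair[OF Y X])
  {
    assume v: "Ext_vanishes n X Y"
    show "ext_zero ?X ?Y"
    proof (rule ext_zeroI)
      fix h :: "nat \<Rightarrow> 'a mat"
      assume d [simp]: "\<And>i. dim_row (h i) = dimv ?Y (Suc i)" "\<And>i. dim_col (h i) = dimv ?X i"
      have h: "h i \<in> carrier_mat (dimv ?Y (Suc i)) (dimv ?X i)" for i by (rule carrier_matI) auto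
      let ?E = "glue ?Y ?X h"
      have E: "total_rep ?E" by (rule total_rep_glue[OF T h])
      have EE: "pad_rep n ?E = ?E"
        by (rule pad_rep_eqI[OF E]) (auto simp: dimv_glue dimv_pad_rep)
      have "(split_ext n X Y, (?E, restrict (?i1) {1..n}, restrict (?p2) {1..n}))
        \<in> ext_equiv n X Y"
        using v glue_extension[OF X Y is_rep_total_rep[OF E] h EE] unfolding Ext_vanishes_iff_split[OF X Y]
        by blast
      then obtain u v where "iso_pair (pad_rep n (dsum [Y, X])) (pad_rep n ?E) u v" and
        *: "\<forall>i\<in>{1..n}. u i * restrict (?i1) {1..n} i = restrict (?i1) {1..n} i \<and>
            restrict (?p2) {1..n} i * u i = restrict (?p2) {1..n} i"
        unfolding split_ext_eq ext_equiv_iff[OF X Y] by blast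
      then have u: "mor (direct_sum ?Y ?X) ?E u" unfolding S EE by (simp add: iso_pair_def)
      note [simp] = mor_dim[OF u, unfolded dimv_direct_sum dimv_glue]
      have u1: "u i * ?i1 i = ?i1 i" for i
        using * by (cases "i \<in> {1..n}") (auto intro!: mat_empty_eq simp: dimv_pad_rep)
      have u2: "?p2 i * u i = ?p2 i" for i
        using * by (cases "i \<in> {1..n}") (auto intro!: mat_empty_eq simp: dimv_pad_rep)
      \<comment> \<open>The off-diagonal block of \<open>u\<close>.\<close>
      define s where "s i = ?p1 i * u i * ?i2 i" for i
      have [simp]: "dim_row (s i) = dimv ?Y i" "dim_col (s i) = dimv ?X i" for i
        by (simp_all add: s_def)
      have ui: "u i * ?i2 i = ?i1 i * s i + ?i2 i" for i
      proof -
        have "u i * ?i2 i = (?i1 i * ?p1 i +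
          ?i2 i * ?p2 i) * (u i * ?i2 i)"
          unfolding glue_maps_orth by (subst mat_mult_one_left) simp_all
        also have "\<dots> = ?i1 i * s i +
          ?i2 i * (?p2 i * u i * ?i2 i)"
          by (simp add: mat_algebra s_def del: glue_maps_orth)
        finally show ?thesis by (simp add: u2 mat_mult_one_right)
      qed
      have "s (Suc i) * arr ?X i = arr ?Y i * s i + h i" for i
      proof -
        have i2: "mor ?X (direct_sum ?Y ?X) (?i2)"
          using sum(2) by (simp add: biproduct_def)
        note [simp] = total_rep_dim[OF sum(1), unfolded dimv_direct_sum] total_rep_dim[OF E, unfolded dimv_glue]
        have "s (Suc i) * arr ?X i =
          ?p1 (Suc i) * (u (Suc i) * (?i2 (Suc i) * arr ?X i))"
          by (simp add: s_def mat_assoc)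
        also have "\<dots> = ?p1 (Suc i) * (arr ?E i * (u i * ?i2 i))"
          by (simp add: mor_comm[OF i2] mor_comm_assoc[OF u sum(1) E] dimv_direct_sum)
        also have "\<dots> = arr ?Y i * s i + h i"
          unfolding ui by (simp add: glue_simps[OF T h] mat_algebra glue_orth_assoc)
        finally show ?thesis .
      qed
      then show "\<exists>s. coboundary ?X ?Y s h"
        by (intro exI[of _ s]) (simp add: coboundary_def)
    qed
  }
  assume z: "ext_zero ?X ?Y"
  show "Ext_vanishes n X Y"
    unfolding Ext_vanishes_iff_split[OF X Y]
  proof
    fix e assume e: "e \<in> extensions n X Y"
    obtain E a b where eE: "e = (E, a, b)" by (cases e)
    let ?E = "pad_rep n E"
    define a' where "a' = pad_fam n a"
    define b' where "b' = pad_fam n b"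
    note E = extensionsD[OF X Y e[unfolded eE]]
    have ex: "\<exists>s r. s \<in> carrier_mat (dimv E i) (dimv X i) \<and> r \<in> carrier_mat (dimv Y i) (dimv E i) \<and>
        b i * s = 1\<^sub>m (dimv X i) \<and> r * a i = 1\<^sub>m (dimv Y i) \<and>
        b i * a i = 0\<^sub>m (dimv X i) (dimv Y i) \<and> a i * r + s * b i = 1\<^sub>m (dimv E i)"
      if "i \<in> {1..n}" for i
      using e that unfolding eE extensions_iff[OF X Y] by blast
    note E' = total_pad_rep[OF E(1)]
    have ma: "mor ?Y ?E a'" unfolding a'_def by (rule mor_pad_fam[OF Y E(1,2)])
    have mb: "mor ?E ?X b'" unfolding b'_def by (rule mor_pad_fam[OF E(1) X E(3)])
    have "\<forall>i. \<exists>s r. s \<in> carrier_mat (dimv ?E i) (dimv ?X i) \<and> r \<in> carrier_mat (dimv ?Y i) (dimv ?E i) \<and>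
        b' i * s = 1\<^sub>m (dimv ?X i) \<and> r * a' i = 1\<^sub>m (dimv ?Y i) \<and>
        b' i * a' i = 0\<^sub>m (dimv ?X i) (dimv ?Y i) \<and> a' i * r + s * b' i = 1\<^sub>m (dimv ?E i)"
    proof
      fix i
      show "\<exists>s r. s \<in> carrier_mat (dimv ?E i) (dimv ?X i) \<and> r \<in> carrier_mat (dimv ?Y i) (dimv ?E i) \<and>
        b' i * s = 1\<^sub>m (dimv ?X i) \<and> r * a' i = 1\<^sub>m (dimv ?Y i) \<and>
        b' i * a' i = 0\<^sub>m (dimv ?X i) (dimv ?Y i) \<and> a' i * r + s * b' i = 1\<^sub>m (dimv ?E i)"
      proof (cases "i \<in> {1..n}")
        case True
        show ?thesis using ex[OF True] True unfolding a'_def b'_def pad_fam_def dimv_pad_rep by simp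
      next
        case False
        then have "dimv ?E i = 0" "dimv ?X i = 0" "dimv ?Y i = 0" "a' i = 0\<^sub>m 0 0" "b' i = 0\<^sub>m 0 0"
          by (auto simp: a'_def b'_def pad_fam_def dimv_pad_rep)
        then show ?thesis by (intro exI[of _ "0\<^sub>m 0 0"]) (auto intro: mat_empty_eq)
      qed
    qed
    then obtain s r where c: "\<And>i. s i \<in> carrier_mat (dimv ?E i) (dimv ?X i)"
      "\<And>i. r i \<in> carrier_mat (dimv ?Y i) (dimv ?E i)" and
      bs: "\<And>i. b' i * s i = 1\<^sub>m (dimv ?X i)" and ra: "\<And>i. r i * a' i = 1\<^sub>m (dimv ?Y i)" and
      ba: "\<And>i. b' i * a' i = 0\<^sub>m (dimv ?X i) (dimv ?Y i)" and
      id: "\<And>i. a' i * r i + s i * b' i = 1\<^sub>m (dimv ?E i)"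
      by metis
    note [simp] = carrier_matD[OF c(1)] carrier_matD[OF c(2)] mor_dim[OF ma] mor_dim[OF mb] total_rep_dim[OF E']
    \<comment> \<open>The cocycle measures how far \<open>s\<close> is from a morphism:
      \<open>arr ?E i * s i - s (Suc i) * arr ?X i\<close> is \<open>a' (Suc i)\<close> times
      it.\<close>
    obtain t where [simp]: "\<And>i. dim_row (t i) = dimv ?Y i" "\<And>i. dim_col (t i) = dimv ?X i" and
      t: "\<And>i. t (Suc i) * arr ?X i = arr ?Y i * t i + r (Suc i) * arr ?E i * s i"
      by (rule ext_zeroD[OF z, of "\<lambda>i. r (Suc i) * arr ?E i * s i"]) auto
    \<comment> \<open>a splitting of \<open>b'\<close>, first chosen at every vertex and then made compatible with the arrows\<close>
    define s' where "s' i = s i + a' i * t i" for i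
    have [simp]: "dim_row (s' i) = dimv ?E i" "dim_col (s' i) = dimv ?X i" for i
      by (simp_all add: s'_def)
    have ms: "mor ?X ?E s'"
    proof (rule morI)
      fix i
      have "arr ?E i * s i = (a' (Suc i) * r (Suc i) + s (Suc i) * b' (Suc i)) * (arr ?E i * s i)"
        by (simp add: id mat_mult_one_left)
      also have "\<dots> = a' (Suc i) * (r (Suc i) * (arr ?E i * s i)) + s (Suc i) * arr ?X i"
        by (simp add: mat_algebra mor_comm_assoc[OF mb E' T(2)] bs)
      finally have "arr ?E i * s i = a' (Suc i) * (r (Suc i) * (arr ?E i * s i)) + s (Suc i) * arr ?X i" .
      then have "arr ?E i * s i + arr ?E i * (a' i * t i) =
        a' (Suc i) * (r (Suc i) * (arr ?E i * s i)) + s (Suc i) * arr ?X i + arr ?E i * (a' i * t i)"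
        by (rule arg_cong)
      then have "arr ?E i * s' i =
        a' (Suc i) * (r (Suc i) * (arr ?E i * s i)) + s (Suc i) * arr ?X i + arr ?E i * (a' i * t i)"
        by (simp add: s'_def mat_mult_add_right)
      also have "\<dots> = s (Suc i) * arr ?X i + a' (Suc i) * (arr ?Y i * t i + r (Suc i) * arr ?E i * s i)"
        by (simp add: mat_algebra mat_add_ac mor_comm_assoc[OF ma T(1) E', symmetric])
      also have "\<dots> = s' (Suc i) * arr ?X i"
        unfolding t[symmetric] by (simp add: s'_def mat_algebra)
      finally show "s' (Suc i) * arr ?X i = arr ?E i * s' i" by (rule sym)
    qed simp_all
    have bs': "b' i * s' i = 1\<^sub>m (dimv ?X i)" for i
    proof -
      have "b' i * s' i = b' i * s i + b' i * a' i * t i" by (simp add: s'_def mat_algebra)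
      then show ?thesis by (simp add: bs ba mat_algebra)
    qed
    \<comment> \<open>\<open>r\<close> was chosen together with the old section \<open>s\<close>.
      The retraction of \<open>a'\<close> that annihilates the new section \<open>s'\<close> is
      \<open>r * N\<close>.\<close>
    define N where "N i = 1\<^sub>m (dimv ?E i) + - (s' i * b' i)" for i
    have [simp]: "dim_row (N i) = dimv ?E i" "dim_col (N i) = dimv ?E i" for i
      by (simp_all add: N_def)
    define u where "u i = a' i * ?p1 i + s' i * ?p2 i" for i
    have [simp]: "dim_row (u i) = dimv ?E i" "dim_col (u i) = dimv ?Y i + dimv ?X i" for i
      by (simp_all add: u_def)
    have bau: "b' i * (a' i * Z) = 0\<^sub>m (dimv ?X i) (dim_col Z)" if "dim_row Z = dimv ?Y i" for i Z
      using that by (simp add: ba mat_mult_zero_left flip: mat_assoc)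
    have bsu: "b' i * (s' i * Z) = Z" if "dim_row Z = dimv ?X i" for i Z
      using that by (simp add: bs' mat_mult_one_left flip: mat_assoc)
    have mu: "mor (direct_sum ?Y ?X) ?E u"
      unfolding u_def using sum(2)
      by (intro mor_add[OF sum(1) E'] mor_comp[OF sum(1) T(1) E' _ ma] mor_comp[OF sum(1) T(2) E' _ ms])
        (auto simp: biproduct_def)
    define v where "v i = ?i1 i * (r i * N i) + ?i2 i * b' i" for i
    have [simp]: "dim_row (v i) = dimv ?Y i + dimv ?X i" "dim_col (v i) = dimv ?E i" for i
      by (simp_all add: v_def)
    have bN: "b' i * N i = 0\<^sub>m (dimv ?X i) (dimv ?E i)" for i
      by (simp add: N_def mat_algebra bsu mat_minus_self_add)
    have Na: "N i * a' i = a' i" for i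
      by (simp add: N_def mat_algebra ba)
    have Ns: "N i * s' i = 0\<^sub>m (dimv ?E i) (dimv ?X i)" for i
      by (simp add: N_def mat_algebra bs' mat_minus_self_add)
    have arN: "a' i * (r i * N i) = N i" for i
      using arg_cong[OF id, of "\<lambda>M. M * N i" i] by (simp add: mat_algebra bN)
    have "u i * v i = a' i * (r i * N i) + s' i * b' i" for i
      by (simp add: u_def v_def mat_algebra glue_orth_assoc)
    then have uv: "u i * v i = 1\<^sub>m (dimv ?E i)" for i
      unfolding arN by (simp add: N_def mat_add_assoc mat_algebra mat_minus_self_add)
    have vu: "v i * u i = 1\<^sub>m (dimv (direct_sum ?Y ?X) i)" for i
    proof -
      have "v i * u i = ?i1 i * (r i * (N i * a' i)) * ?p1 i +
        ?i1 i * (r i * (N i * s' i)) * ?p2 i +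
        ?i2 i * ?p2 i"
        by (simp add: u_def v_def mat_algebra bau bsu mat_add_ac)
      then show ?thesis
        unfolding Na Ns ra by (simp add: mat_algebra dimv_direct_sum)
    qed
    have "v i \<in> carrier_mat (dimv (direct_sum ?Y ?X) i) (dimv ?E i)" for i
      by (rule carrier_matI) (simp_all add: dimv_direct_sum)
    then have iso: "iso_pair (pad_rep n (dsum [Y, X])) ?E u v"
      unfolding S by (rule iso_pairI[OF sum(1) E' mu _ vu uv])
    have au: "u i * ?i1 i = a' i" "b' i * u i = ?p2 i" for i
      by (simp_all add: u_def mat_algebra bau bsu)
    have "u i * restrict (?i1) {1..n} i = a i \<and> b i * u i = restrict (?p2) {1..n} i"
      if "i \<in> {1..n}" for i
    proof -
      have "a' i = a i" "b' i = b i"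
        using that by (simp_all only: a'_def b'_def pad_fam_def if_True)
      then show ?thesis using au[of i] that by simp
    qed
    then show "(split_ext n X Y, e) \<in> ext_equiv n X Y"
      using split_extension[OF X Y] e iso unfolding split_ext_eq eE ext_equiv_iff[OF X Y] by blast
  qed
qed

section \<open>Interval modules\<close>

lemma mat_mult_empty:
  fixes A B :: "'a::semiring_0 mat"
  shows "dim_col A = 0 \<Longrightarrow> dim_row B = 0 \<Longrightarrow> A * B = 0\<^sub>m (dim_row A) (dim_col B)"
  by (rule eq_matI) (auto simp: scalar_prod_def)

definition mat_iso :: "'a::semiring_1 mat \<Rightarrow> bool" where
  "mat_iso A \<longleftrightarrow> (\<exists>B. B \<in> carrier_mat (dim_col A) (dim_row A) \<and> B * A = 1\<^sub>m (dim_col A) \<and> A * B = 1\<^sub>m (dim_row A))"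

lemma mat_isoI:
  "B \<in> carrier_mat (dim_col A) (dim_row A) \<Longrightarrow> B * A = 1\<^sub>m (dim_col A) \<Longrightarrow> A * B = 1\<^sub>m (dim_row A) \<Longrightarrow> mat_iso A"
  unfolding mat_iso_def by blast

lemma mat_isoE:
  assumes "mat_iso A"
  obtains B where "dim_row B = dim_col A" "dim_col B = dim_row A"
    "B * A = 1\<^sub>m (dim_col A)" "A * B = 1\<^sub>m (dim_row A)"
  using assms unfolding mat_iso_def by auto

lemma mat_iso_one: "mat_iso (1\<^sub>m k)"
  by (rule mat_isoI[of "1\<^sub>m k"]) auto

lemma mat_iso_mult:
  assumes "mat_iso A" "mat_iso B" "dim_col A = dim_row B"
  shows "mat_iso (A * B)"
proof -
  obtain A' where A: "dim_row A' = dim_col A" "dim_col A' = dim_row A" "A' * A = 1\<^sub>m (dim_col A)" "A * A' = 1\<^sub>m (dim_row A)"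
    using assms(1) by (rule mat_isoE)
  obtain B' where B: "dim_row B' = dim_col B" "dim_col B' = dim_row B" "B' * B = 1\<^sub>m (dim_col B)" "B * B' = 1\<^sub>m (dim_row B)"
    using assms(2) by (rule mat_isoE)
  note [simp] = A(1,2) B(1,2) assms(3)
  show ?thesis
  proof (rule mat_isoI[of "B' * A'"])
    have "B' * A' * (A * B) = B' * (A' * A * B)" by (simp add: mat_assoc)
    then show "B' * A' * (A * B) = 1\<^sub>m (dim_col (A * B))" by (simp add: A B mat_mult_one_left)
    have "A * B * (B' * A') = A * (B * B' * A')" by (simp add: mat_assoc)
    then show "A * B * (B' * A') = 1\<^sub>m (dim_row (A * B))" by (simp add: A B mat_mult_one_left)
  qed (auto intro: carrier_matI)
qed

lemma mat_iso_cancel_left: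
  assumes "mat_iso (A * B)" "mat_iso A" "dim_col A = dim_row B"
  shows "mat_iso B"
proof -
  obtain A' where A: "dim_row A' = dim_col A" "dim_col A' = dim_row A" "A' * A = 1\<^sub>m (dim_col A)" "A * A' = 1\<^sub>m (dim_row A)"
    using assms(2) by (rule mat_isoE)
  then have "mat_iso (A' * (A * B))"
    by (intro mat_iso_mult mat_isoI[of A A'] assms(1)) (auto intro: carrier_matI)
  also have "A' * (A * B) = A' * A * B" using assms(3) A(1,2) by (simp add: mat_assoc)
  finally show ?thesis using assms(3) by (simp add: A mat_mult_one_left)
qed

text \<open>Comparing which dimensions vanish is enough for interval modules, whose dimensions are 0
  and 1. An identity matrix that factors through a zero space is zero.\<close>

lemma mat_iso_dim_zero:
  fixes A :: "'a::comm_ring_1 mat"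
  assumes "mat_iso A"
  shows "dim_row A = 0 \<longleftrightarrow> dim_col A = 0"
proof -
  obtain B where B: "dim_row B = dim_col A" "dim_col B = dim_row A" "B * A = 1\<^sub>m (dim_col A)" "A * B = 1\<^sub>m (dim_row A)"
    using assms by (rule mat_isoE)
  have "1\<^sub>m (dim_col A) = (0\<^sub>m (dim_col A) (dim_col A) :: 'a mat)" if "dim_row A = 0"
    unfolding B(3)[symmetric] using that B(1,2) by (intro eq_matI) (auto simp: scalar_prod_def)
  moreover have "1\<^sub>m (dim_row A) = (0\<^sub>m (dim_row A) (dim_row A) :: 'a mat)" if "dim_col A = 0"
    unfolding B(4)[symmetric] using that B(1,2) by (intro eq_matI) (auto simp: scalar_prod_def)
  ultimately show ?thesis using one_mat_eq_zero by blast
qed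

text \<open>Vectors appear as matrices with one column, which is the form of a morphism from an
  interval module at a vertex of its support.\<close>

lemma mat_iso_columns:
  fixes A :: "'a::comm_ring_1 mat"
  assumes A: "A \<in> carrier_mat m k"
    and inj: "\<And>y. y \<in> carrier_mat k 1 \<Longrightarrow> A * y = 0\<^sub>m m 1 \<Longrightarrow> y = 0\<^sub>m k 1"
    and surj: "\<And>z. z \<in> carrier_mat m 1 \<Longrightarrow> \<exists>y\<in>carrier_mat k 1. A * y = z"
  shows "mat_iso A"
proof -
  note dA [simp] = carrier_matD[OF A]
  define e where "e j = mat m 1 (\<lambda>(i, _). if i = j then 1 else (0::'a))" for j
  have "e j \<in> carrier_mat m 1" for j by (simp add: e_def)
  then have "\<forall>j. \<exists>y. y \<in> carrier_mat k 1 \<and> A * y = e j" using surj by blast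
  then obtain y where y: "\<And>j. y j \<in> carrier_mat k 1" "\<And>j. A * y j = e j" by metis
  define B where "B = mat k m (\<lambda>(i, j). y j $$ (i, 0))"
  have [simp]: "dim_row B = k" "dim_col B = m" by (simp_all add: B_def)
  have cols: "(A * M) $$ (i, j) = (A * mat k 1 (\<lambda>(t, _). M $$ (t, j))) $$ (i, 0)"
    if "i < m" "j < dim_col M" "dim_row M = k" for M :: "'a mat" and i j
    using that by (simp add: scalar_prod_def)
  have AB: "A * B = 1\<^sub>m m"
  proof (rule eq_matI)
    fix i j assume "i < dim_row (1\<^sub>m m :: 'a mat)" "j < dim_col (1\<^sub>m m :: 'a mat)"
    then have ij: "i < m" "j < m" by auto
    have "mat k 1 (\<lambda>(t, _). B $$ (t, j)) = y j"
      using y(1)[of j] ij by (intro eq_matI) (auto simp: B_def)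
    then have "(A * B) $$ (i, j) = (A * y j) $$ (i, 0)" using cols[of i j B] ij by simp
    then show "(A * B) $$ (i, j) = 1\<^sub>m m $$ (i, j)" unfolding y(2) using ij by (simp add: e_def)
  qed auto
  have zero: "M = 0\<^sub>m k l" if M: "M \<in> carrier_mat k l" "A * M = 0\<^sub>m m l" for M l
  proof (rule eq_matI)
    fix i j assume "i < dim_row (0\<^sub>m k l :: 'a mat)" "j < dim_col (0\<^sub>m k l :: 'a mat)"
    then have ij: "i < k" "j < l" by auto
    have "A * mat k 1 (\<lambda>(t, _). M $$ (t, j)) = 0\<^sub>m m 1"
    proof (rule eq_matI)
      fix x y assume "x < dim_row (0\<^sub>m m 1 :: 'a mat)" "y < dim_col (0\<^sub>m m 1 :: 'a mat)"
      then show "(A * mat k 1 (\<lambda>(t, _). M $$ (t, j))) $$ (x, y) = 0\<^sub>m m 1 $$ (x, y)"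
        using cols[of x j M] M ij by auto
    qed auto
    then have "mat k 1 (\<lambda>(t, _). M $$ (t, j)) = 0\<^sub>m k 1" by (intro inj) auto
    then have "mat k 1 (\<lambda>(t, _). M $$ (t, j)) $$ (i, 0) = 0" using ij by simp
    then show "M $$ (i, j) = 0\<^sub>m k l $$ (i, j)" using ij by simp
  qed (use M in auto)
  \<comment> \<open>The right inverse is also a left inverse: \<open>A\<close> annihilates
    \<open>B * A - 1\<close>, and \<open>A\<close> is injective.\<close>
  have "A * (B * A + - 1\<^sub>m k) = A * B * A + - A" by (simp add: mat_algebra)
  also have "\<dots> = 0\<^sub>m m k" by (simp add: AB mat_algebra mat_minus_self_add)
  finally have z: "B * A + - 1\<^sub>m k = 0\<^sub>m k k"
    by (intro zero) (auto intro: carrier_matI)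
  have "B * A = B * A + (- 1\<^sub>m k + 1\<^sub>m k)"
    by (simp add: mat_minus_self_add mat_algebra)
  also have "\<dots> = B * A + - 1\<^sub>m k + 1\<^sub>m k" by (simp add: mat_add_assoc)
  finally have "B * A = 1\<^sub>m k" by (simp add: z mat_algebra)
  with AB show ?thesis by (intro mat_isoI[of B]) (auto intro: carrier_matI)
qed

text \<open>The \<open>else\<close> branch supplies the start of the recursion at
  \<open>Suc b = a\<close>; for smaller targets the identity is a default value.\<close>

primrec path_map :: "'k::field rep \<Rightarrow> nat \<Rightarrow> nat \<Rightarrow> 'k mat" where
  "path_map X a 0 = 1\<^sub>m (dimv X 0)"
| "path_map X a (Suc b) = (if a \<le> b then arr X b * path_map X a b else 1\<^sub>m (dimv X (Suc b)))"

lemma path_map_self [simp]: "path_map X a a = 1\<^sub>m (dimv X a)"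
  by (cases a) auto

lemma path_map_Suc: "a \<le> b \<Longrightarrow> path_map X a (Suc b) = arr X b * path_map X a b"
  by simp

declare path_map.simps [simp del]

lemma path_map_dim:
  assumes "total_rep X" "a \<le> b"
  shows "dim_row (path_map X a b) = dimv X b" "dim_col (path_map X a b) = dimv X a"
  using assms(2) by (induction b rule: dec_induct) (simp_all add: path_map_Suc total_rep_dim[OF assms(1)])

lemma path_map_trans:
  assumes "total_rep X" "a \<le> b" "b \<le> c"
  shows "path_map X b c * path_map X a b = path_map X a c"
  using assms(3)
proof (induction c rule: dec_induct)
  case base
  then show ?case using assms by (simp add: mat_mult_one_left path_map_dim)
next
  case (step c)
  then show ?case
    using assms by (simp add: path_map_Suc mat_assoc path_map_dim total_rep_dim)
qed

lemma path_map_Suc_left: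
  assumes "total_rep X" "a < b"
  shows "path_map X (Suc a) b * arr X a = path_map X a b"
proof -
  have "path_map X a (Suc a) = arr X a"
    using assms(1) by (simp add: path_map_Suc mat_mult_one_right total_rep_dim)
  then show ?thesis using path_map_trans[OF assms(1), of a "Suc a" b] assms(2) by simp
qed

lemma path_map_natural:
  assumes X: "total_rep X" and Y: "total_rep Y" and f: "mor X Y f" and ab: "a \<le> b"
  shows "f b * path_map X a b = path_map Y a b * f a"
  using ab
proof (induction b rule: dec_induct)
  case base
  then show ?case by (simp add: mat_algebra mor_dim[OF f])
next
  case (step b)
  then show ?case
    by (simp add: path_map_Suc mat_assoc path_map_dim[OF X] path_map_dim[OF Y] mor_dim[OF f]
        total_rep_dim[OF X] total_rep_dim[OF Y] mor_comm_assoc[OF f X Y])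
qed

text \<open>A matrix of ones is the identity between two vertices of the support and empty
  everywhere else, so the arrows need no case distinction.\<close>

definition interval_rep :: "nat \<Rightarrow> nat \<Rightarrow> 'k::field rep" where
  "interval_rep a b = (let d = (\<lambda>i. if a \<le> i \<and> i < b then 1 else 0) in
     \<lparr>dimv = d, arr = (\<lambda>i. mat (d (Suc i)) (d i) (\<lambda>_. 1))\<rparr>)"

lemma dimv_interval: "dimv (interval_rep a b) i = (if a \<le> i \<and> i < b then 1 else 0)"
  by (simp add: interval_rep_def Let_def)

lemma total_interval: "total_rep (interval_rep a b)"
  by (simp add: total_rep_def interval_rep_def Let_def)

lemma arr_interval: "a \<le> i \<Longrightarrow> Suc i < b \<Longrightarrow> arr (interval_rep a b) i = 1\<^sub>m 1"
  by (intro eq_matI) (auto simp: interval_rep_def Let_def)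

lemma pad_rep_interval_rep:
  "1 \<le> a \<Longrightarrow> b \<le> Suc n \<Longrightarrow> pad_rep n (interval_rep a b) = interval_rep a b"
  by (intro pad_rep_eqI total_interval) (auto simp: dimv_interval)

lemma path_map_interval:
  assumes "a \<le> i" "i < b"
  shows "path_map (interval_rep a b) a i = 1\<^sub>m 1"
  using assms
  by (induction i rule: dec_induct) (auto simp: dimv_interval path_map_Suc arr_interval mat_algebra)

text \<open>An interval module is generated at \<open>a\<close>, so a morphism to \<open>Y\<close>
  is given by the image \<open>y\<close> of the generator. The only relation is that the path to
  \<open>b\<close> kills \<open>y\<close>.\<close>

definition interval_hom :: "'k::field rep \<Rightarrow> nat \<Rightarrow> nat \<Rightarrow> 'k mat \<Rightarrow> nat \<Rightarrow> 'k mat" where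
  "interval_hom Y a b y i = (if a \<le> i \<and> i < b then path_map Y a i * y else 0\<^sub>m (dimv Y i) 0)"

lemma mor_interval_hom:
  fixes Y :: "'k::field rep"
  assumes Y: "total_rep Y" and ab: "a < b" and y: "y \<in> carrier_mat (dimv Y a) 1"
    and k: "path_map Y a b * y = 0\<^sub>m (dimv Y b) 1"
  shows "mor (interval_rep a b) Y (interval_hom Y a b y)"
proof (rule morI)
  note [simp] = carrier_matD[OF y] total_rep_dim[OF Y] path_map_dim[OF Y] total_rep_dim[OF total_interval]
  show [simp]: "dim_row (interval_hom Y a b y i) = dimv Y i" for i by (simp add: interval_hom_def)
  show [simp]: "dim_col (interval_hom Y a b y i) = dimv (interval_rep a b :: 'k rep) i" for i
    by (simp add: interval_hom_def dimv_interval)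
  fix i
  consider "a \<le> i" "Suc i < b" | "a \<le> i" "Suc i = b" | "dimv (interval_rep a b :: 'k rep) i = 0"
    by (fastforce simp: dimv_interval)
  then show "interval_hom Y a b y (Suc i) * arr (interval_rep a b) i = arr Y i * interval_hom Y a b y i"
  proof cases
    case 1
    then show ?thesis
      by (simp add: interval_hom_def arr_interval path_map_Suc mat_assoc mat_mult_one_right)
  next
    case 2
    have "arr Y i * interval_hom Y a b y i = path_map Y a b * y"
      using 2 by (auto simp: interval_hom_def path_map_Suc mat_assoc)
    also have "\<dots> = 0\<^sub>m (dimv Y (Suc i)) 0 * arr (interval_rep a b) i"
      using 2 k by (subst mat_mult_empty) (auto simp: dimv_interval)
    finally show ?thesis using 2 by (simp add: interval_hom_def)
  next
    case 3
    then show ?thesis by (intro mat_empty_eq) simp_all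
  qed
qed

lemma mor_interval_eq:
  fixes Y :: "'k::field rep"
  assumes Y: "total_rep Y" and f: "mor (interval_rep a b) Y f" and i: "a \<le> i" "i < b"
  shows "f i = path_map Y a i * f a"
  using path_map_natural[OF total_interval Y f i(1)] mor_dim[OF f, of i] i
  by (simp add: path_map_interval mat_mult_one_right dimv_interval)

lemma mor_interval_end:
  fixes Y :: "'k::field rep"
  assumes Y: "total_rep Y" and f: "mor (interval_rep a b) Y f" and ab: "a < b"
  shows "path_map Y a b * f a = 0\<^sub>m (dimv Y b) 1"
proof -
  have "path_map Y a b * f a = f b * path_map (interval_rep a b) a b"
    using path_map_natural[OF total_interval Y f, of a b] ab by simp
  also have "\<dots> = 0\<^sub>m (dimv Y b) 1"
    using mor_dim[OF f, of b] path_map_dim[OF total_interval[where ?'a = 'k], of a b a b] ab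
    by (subst mat_mult_empty) (auto simp: dimv_interval)
  finally show ?thesis .
qed

text \<open>From the projective resolution \<open>0 \<rightarrow> P b \<rightarrow> P a \<rightarrow> M \<rightarrow> 0\<close> of the interval module \<open>M\<close>, where \<open>Hom(P i, Y)\<close>
  is the space of \<open>Y\<close> at \<open>i\<close>.\<close>

lemma perp_interval_iff:
  fixes Y :: "'k::field rep"
  assumes Y: "total_rep Y" and ab: "a < b"
  shows "perp (interval_rep a b) Y \<longleftrightarrow> mat_iso (path_map Y a b)"
proof
  let ?I = "interval_rep a b :: 'k rep"
  note dims [simp] = total_rep_dim[OF Y] path_map_dim[OF Y] total_rep_dim[OF total_interval]
  {
    assume p: "perp ?I Y"
    show "mat_iso (path_map Y a b)"
    proof (rule mat_iso_columns)
      show "path_map Y a b \<in> carrier_mat (dimv Y b) (dimv Y a)" using ab by (intro carrier_matI) auto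
      fix y assume y: "y \<in> carrier_mat (dimv Y a) 1" "path_map Y a b * y = 0\<^sub>m (dimv Y b) 1"
      have "interval_hom Y a b y a = 0\<^sub>m (dimv Y a) (dimv ?I a)"
        using hom_zeroD[OF _ mor_interval_hom[OF Y ab y]] p by (simp add: perp_def)
      then show "y = 0\<^sub>m (dimv Y a) 1"
        using ab y by (simp add: interval_hom_def dimv_interval)
    next
      fix z :: "'k mat" assume z: "z \<in> carrier_mat (dimv Y b) 1"
      \<comment> \<open>The vector \<open>z\<close> is placed on the arrow into \<open>b\<close>. A
        family that bounds this cocycle follows the paths from \<open>a\<close> up to
        \<open>b - 1\<close>, and its value \<open>0\<close> at \<open>b\<close> gives
        \<open>path_map Y a b * s a = - z\<close>.\<close>
      define h where "h i = (if Suc i = b then z else 0\<^sub>m (dimv Y (Suc i)) (dimv ?I i))" for i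
      obtain s where [simp]: "\<And>i. dim_row (s i) = dimv Y i" "\<And>i. dim_col (s i) = dimv ?I i" and
        s: "\<And>i. s (Suc i) * arr ?I i = arr Y i * s i + h i"
        by (rule ext_zeroD[of ?I Y h]) (use p z ab in \<open>auto simp: perp_def h_def dimv_interval\<close>)
      have si: "s i = path_map Y a i * s a" if "a \<le> i" "i < b" for i
        using that
      proof (induction i rule: dec_induct)
        case base
        then show ?case by (simp add: mat_mult_one_left)
      next
        case (step i)
        then show ?case using s[of i]
          by (simp add: arr_interval h_def path_map_Suc mat_assoc mat_mult_one_right
              mat_add_zero_right dimv_interval)
      qed
      obtain i where i: "b = Suc i" "a \<le> i" using ab by (cases b) auto
      have "0\<^sub>m (dimv Y b) 1 = s (Suc i) * arr ?I i"
        by (subst mat_mult_empty) (simp_all add: dimv_interval i)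
      also have "\<dots> = path_map Y a b * s a + z"
        unfolding s using i si[of i] by (simp add: h_def path_map_Suc mat_assoc)
      finally have e: "path_map Y a b * s a + z = 0\<^sub>m (dimv Y b) 1" by simp
      have "path_map Y a b * (- s a) = path_map Y a b * (- s a) + (path_map Y a b * s a + z)"
        unfolding e using ab by (simp add: mat_algebra dimv_interval)
      also have "\<dots> = - (path_map Y a b * s a) + path_map Y a b * s a + z"
        using ab z by (simp add: mat_mult_minus_right mat_add_assoc dimv_interval)
      also have "\<dots> = z"
        using ab z by (simp add: mat_minus_self_add mat_add_zero_left dimv_interval)
      finally show "\<exists>y\<in>carrier_mat (dimv Y a) 1. path_map Y a b * y = z"
        using ab by (intro bexI[of _ "- s a"]) (auto intro!: carrier_matI simp: dimv_interval)
    qed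
  }
  assume "mat_iso (path_map Y a b)"
  then obtain T where T: "dim_row T = dimv Y a" "dim_col T = dimv Y b" "T * path_map Y a b = 1\<^sub>m (dimv Y a)"
    "path_map Y a b * T = 1\<^sub>m (dimv Y b)"
    using ab by (metis mat_isoE path_map_dim[OF Y] less_imp_le)
  note [simp] = T(1,2)
  show "perp ?I Y"
    unfolding perp_def
  proof
    show "hom_zero ?I Y"
      unfolding hom_zero_def
    proof (intro allI impI)
      fix s i assume s: "mor ?I Y s"
      note [simp] = mor_dim[OF s]
      have "s a = T * (path_map Y a b * s a)"
        using ab by (simp add: T(3) mat_mult_one_left flip: mat_assoc)
      then have sa: "s a = 0\<^sub>m (dimv Y a) 1"
        unfolding mor_interval_end[OF Y s ab] by (simp add: mat_mult_zero_right)
      show "s i = 0\<^sub>m (dimv Y i) (dimv ?I i)"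
      proof (cases "a \<le> i \<and> i < b")
        case True
        then show ?thesis
          using mor_interval_eq[OF Y s, of i] by (simp add: sa mat_mult_zero_right dimv_interval)
      next
        case False
        then show ?thesis by (intro mat_empty_eq) (auto simp: dimv_interval)
      qed
    qed
    show "ext_zero ?I Y"
    proof (rule ext_zeroI)
      fix h :: "nat \<Rightarrow> 'k mat"
      assume [simp]: "\<And>i. dim_row (h i) = dimv Y (Suc i)" "\<And>i. dim_col (h i) = dimv ?I i"
      \<comment> \<open>The solution of the coboundary recursion with initial value \<open>0\<close>
        at \<open>a\<close>. One condition remains, that the value at \<open>b\<close> is zero;
        inverting the path map yields the initial value \<open>y\<close> that achieves it.\<close>
      define t where "t = rec_nat (0\<^sub>m (dimv Y a) 1) (\<lambda>k M. arr Y (a + k) * M + h (a + k))"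
      have t0: "t 0 = 0\<^sub>m (dimv Y a) 1" and tS: "t (Suc k) = arr Y (a + k) * t k + h (a + k)" for k
        by (simp_all add: t_def)
      have td: "dim_row (t k) = dimv Y (a + k) \<and> dim_col (t k) = 1" if "a + k \<le> b" for k
        using that by (induction k) (auto simp: t0 tS dimv_interval)
      define y where "y = - (T * t (b - a))"
      have [simp]: "dim_row y = dimv Y a" "dim_col y = 1" using ab td[of "b - a"] by (simp_all add: y_def)
      have "path_map Y a b * y = - (path_map Y a b * T * t (b - a))"
        using ab td[of "b - a"] by (simp add: y_def mat_assoc mat_mult_minus_right)
      then have Ty: "path_map Y a b * y = - t (b - a)"
        using ab td[of "b - a"] by (simp add: T mat_mult_one_left)
      define s where "s i = (if a \<le> i \<and> i < b then t (i - a) + path_map Y a i * y else 0\<^sub>m (dimv Y i) 0)" for i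
      have [simp]: "dim_row (s i) = dimv Y i" "dim_col (s i) = dimv ?I i" for i
        using td[of "i - a"] by (auto simp: s_def dimv_interval)
      have "s (Suc i) * arr ?I i = arr Y i * s i + h i" for i
      proof -
        have *: "arr Y i * s i + h i = t (Suc i - a) + path_map Y a (Suc i) * y" if "a \<le> i" "i < b"
        proof -
          have "Suc i - a = Suc (i - a)" "a + (i - a) = i" using that by auto
          then show ?thesis
            using that td[of "i - a"] 
            by (simp add: s_def tS path_map_Suc mat_assoc mat_mult_add_right mat_add_ac dimv_interval)
        qed
        consider "a \<le> i" "Suc i < b" | "a \<le> i" "Suc i = b" | "dimv ?I i = 0"
          by (fastforce simp: dimv_interval)
        then show ?thesis
        proof cases
          case 1
          have "s (Suc i) = t (Suc i - a) + path_map Y a (Suc i) * y" using 1 by (simp add: s_def)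
          moreover have "s (Suc i) * arr ?I i = s (Suc i)"
            using 1 by (simp add: arr_interval dimv_interval mat_mult_one_right)
          ultimately show ?thesis using * 1 by simp
        next
          case 2
          have "s (Suc i) * arr ?I i = 0\<^sub>m (dimv Y b) 1"
            using 2 by (subst mat_mult_empty) (simp_all add: dimv_interval)
          moreover have "t (Suc i - a) + path_map Y a (Suc i) * y = 0\<^sub>m (dimv Y b) 1"
            unfolding 2(2) Ty using td[of "b - a"] ab by (simp add: mat_minus_self_add)
          ultimately show ?thesis using * 2 by simp
        next
          case 3
          then show ?thesis by (intro mat_empty_eq) simp_all
        qed
      qed
      then show "\<exists>s. coboundary ?I Y s h"
        by (intro exI[of _ s]) (simp add: coboundary_def)
    qed
  qed
qed

section \<open>Indecomposable modules are interval modules\<close>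

text \<open>A vector \<open>x\<close> at the first vertex \<open>a\<close> of the support generates
  an interval submodule, which ends where a path first kills \<open>x\<close>. A functional at its
  last vertex, pulled back along the paths, is a retraction. It commutes with the arrow into
  \<open>a\<close> because \<open>M\<close> vanishes before \<open>a\<close>.\<close>

lemma interval_summand:
  fixes M :: "'k::field rep"
  assumes M: "total_rep M" and supp: "\<And>i. i \<notin> {1..n} \<Longrightarrow> dimv M i = 0" and nz: "dimv M c \<noteq> 0"
  obtains a b W u v j q where "1 \<le> a" "a < b" "b \<le> Suc n" "total_rep W"
    "biproduct M (interval_rep a b) W u v j q"
proof -
  note [simp] = total_rep_dim[OF M] path_map_dim[OF M]
  define a where "a = (LEAST i. dimv M i \<noteq> 0)"
  have da: "dimv M a \<noteq> 0" unfolding a_def using nz by (rule LeastI)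
  have low: "dimv M i = 0" if "i < a" for i using not_less_Least[OF that[unfolded a_def]] by simp
  have a: "1 \<le> a" "a \<le> n" using da supp[of a] by auto
  define x where "x = mat (dimv M a) 1 (\<lambda>(i, _). if i = 0 then 1 else (0::'k))"
  have x [simp]: "dim_row x = dimv M a" "dim_col x = 1" by (simp_all add: x_def)
  define P where "P b \<longleftrightarrow> a \<le> b \<and> path_map M a b * x = 0\<^sub>m (dimv M b) 1" for b
  have "P (Suc n)"
    using a supp[of "Suc n"] by (auto simp: P_def intro!: mat_empty_eq)
  define b where "b = (LEAST b. P b)"
  have Pb: "P b" unfolding b_def by (rule LeastI[of P, OF \<open>P (Suc n)\<close>])
  have bn: "b \<le> Suc n" unfolding b_def by (rule Least_le[of P, OF \<open>P (Suc n)\<close>])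
  have "\<not> P a"
  proof
    assume "P a"
    then have "x = 0\<^sub>m (dimv M a) 1" by (simp add: P_def mat_mult_one_left)
    then have "x $$ (0, 0) = 0\<^sub>m (dimv M a) 1 $$ (0, 0)" by (rule arg_cong)
    then show False using da by (simp add: x_def)
  qed
  then have ab: "a < b" using Pb by (metis P_def le_neq_implies_less)
  then obtain e where e: "b = Suc e" "a \<le> e" by (cases b) auto
  have "\<not> P e" using not_less_Least[of e P] e by (simp add: b_def)
  define w where "w = path_map M a e * x"
  have w [simp]: "dim_row w = dimv M e" "dim_col w = 1" using e by (simp_all add: w_def)
  have "w \<noteq> 0\<^sub>m (dimv M e) 1" using \<open>\<not> P e\<close> e by (simp add: P_def w_def)
  then obtain k where k: "k < dimv M e" "w $$ (k, 0) \<noteq> 0"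
    by (metis (no_types, lifting) eq_matI index_zero_mat less_one w)
  \<comment> \<open>A functional with value 1 on \<open>w\<close>, the last nonzero image of
    \<open>x\<close>.\<close>
  define l where "l = mat 1 (dimv M e) (\<lambda>(_, i). if i = k then 1 / w $$ (k, 0) else 0)"
  have l [simp]: "dim_row l = 1" "dim_col l = dimv M e" by (simp_all add: l_def)
  have lw: "l * w = 1\<^sub>m 1"
    using k by (intro eq_matI) (auto simp: l_def scalar_prod_def if_distrib[of "\<lambda>x. x * _"] cong: if_cong)
  define u where "u = interval_hom M a b x"
  have u: "mor (interval_rep a b) M u"
    unfolding u_def using Pb ab by (intro mor_interval_hom[OF M]) (auto simp: P_def)
  define v where "v i = (if a \<le> i \<and> i < b then l * path_map M i e else 0\<^sub>m 0 (dimv M i))" for i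
  have v: "mor M (interval_rep a b) v"
  proof (rule morI)
    note [simp] = total_rep_dim[OF total_interval]
    show [simp]: "dim_row (v i) = dimv (interval_rep a b :: 'k rep) i" for i
      by (simp add: v_def dimv_interval)
    show [simp]: "dim_col (v i) = dimv M i" for i
      using e by (simp add: v_def)
    fix i
    consider "a \<le> i" "Suc i < b" | "i < a" | "dimv (interval_rep a b :: 'k rep) (Suc i) = 0"
      by (fastforce simp: dimv_interval)
    then show "v (Suc i) * arr M i = arr (interval_rep a b) i * v i"
    proof cases
      case 1
      then show ?thesis using e
        by (simp add: v_def arr_interval mat_assoc mat_mult_one_left path_map_Suc_left[OF M])
    next
      case 2
      then show ?thesis by (intro mat_empty_eq) (simp_all add: low)
    next
      case 3
      then show ?thesis by (intro mat_empty_eq) simp_all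
    qed
  qed
  have vu: "v i * u i = 1\<^sub>m (dimv (interval_rep a b :: 'k rep) i)" for i
  proof (cases "a \<le> i \<and> i < b")
    case True
    then have "v i * u i = l * (path_map M i e * path_map M a i * x)"
      using e by (simp add: v_def u_def interval_hom_def mat_assoc)
    also have "\<dots> = l * w" using True e by (simp add: path_map_trans[OF M] w_def)
    finally show ?thesis using True by (simp add: lw dimv_interval)
  next
    case False
    then show ?thesis using mor_dim[OF u, of i] mor_dim[OF v, of i]
      by (intro mat_empty_eq) (auto simp: dimv_interval)
  qed
  obtain W j q where "total_rep W" "biproduct M (interval_rep a b) W u v j q"
    by (rule retract_complement[OF M total_interval u v vu])
  with that a(1) ab bn show ?thesis by blast
qed

text \<open>The interval summand is nonzero, so indecomposability kills the complement
  \<open>W\<close> and the retraction becomes an inverse.\<close>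

lemma indecomposable_interval:
  fixes E :: "'k::field rep"
  assumes E: "is_rep n E" and ind: "indecomposable n E"
  obtains a b u v where "1 \<le> a" "a < b" "b \<le> Suc n"
    "iso_pair (pad_rep n E) (interval_rep a b) u v"
proof -
  let ?E = "pad_rep n E"
  note TE = total_pad_rep[OF E]
  have "\<not> is_zero_rep n E" using ind by (simp add: indecomposable_def)
  then obtain c where "c \<in> {1..n}" "dimv E c \<noteq> 0" by (auto simp: is_zero_rep_def)
  then have c: "dimv ?E c \<noteq> 0" by (simp add: dimv_pad_rep)
  have supp: "dimv ?E i = 0" if "i \<notin> {1..n}" for i using that by (auto simp: dimv_pad_rep)
  from TE supp c obtain a b W u v j q where ab: "1 \<le> a" "a < b" "b \<le> Suc n" and W: "total_rep W"
    and bi: "biproduct ?E (interval_rep a b) W u v j q"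
    by (rule interval_summand)
  let ?I = "interval_rep a b :: 'k rep"
  note I = total_interval[of a b, where ?'a = 'k]
  have m: "mor ?I ?E u" "mor ?E ?I v" "mor W ?E j" "mor ?E W q" and
    e: "\<And>i. v i * u i = 1\<^sub>m (dimv ?I i)" "\<And>i. q i * j i = 1\<^sub>m (dimv W i)"
      "\<And>i. u i * v i + j i * q i = 1\<^sub>m (dimv ?E i)"
    using bi by (auto simp: biproduct_def)
  note [simp] = m[THEN mor_dim(1)] m[THEN mor_dim(2)]
  have suppW: "dimv W i = 0" if "i \<notin> {1..n}" for i
  proof -
    have "1\<^sub>m (dimv W i) = (0\<^sub>m (dimv W i) (dimv W i) :: 'k mat)"
      using e(2)[of i] mat_mult_empty[of "q i" "j i"] supp[OF that] by simp
    then show ?thesis by (rule one_mat_eq_zero)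
  qed
  then have EW: "pad_rep n W = W" by (intro pad_rep_eqI[OF W])
  have EI: "pad_rep n ?I = ?I" using ab by (intro pad_rep_interval_rep) auto
  have rI: "is_rep n ?I" and rW: "is_rep n W" using is_rep_total_rep I W by blast+
  have "pad_rep n (dsum [?I, W]) = direct_sum ?I W"
    using pad_rep_dsum_pair[OF rI rW] by (simp only: EI EW)
  then have "isomorphic n E (dsum [?I, W])"
    unfolding isomorphic_iff[OF E is_rep_dsum[of "[?I, W]" n, simplified, OF conjI[OF rI rW]]]
    using biproduct_unique[OF TE total_rep_direct_sum[OF I W] I W bi direct_sum_biproduct[OF I W]]
    by metis
  then have "is_zero_rep n ?I \<or> is_zero_rep n W"
    using ind rI rW unfolding indecomposable_def by blast
  moreover have "\<not> is_zero_rep n ?I"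
    using ab by (auto simp: is_zero_rep_def dimv_interval)
  ultimately have W0: "dimv W i = 0" for i
    using suppW[of i] by (cases "i \<in> {1..n}") (auto simp: is_zero_rep_def)
  have "u i * v i = 1\<^sub>m (dimv ?E i)" for i
    using e(3)[of i] by (simp add: mat_mult_empty W0 mat_add_zero_right)
  then have "iso_pair ?E ?I v u" using m e by (simp add: iso_pair_def)
  with ab that show ?thesis by blast
qed

section \<open>Relative projectivity\<close>

lemma perp_iso_left:
  assumes X: "total_rep X" and X': "total_rep X'" and Y: "total_rep Y" and uv: "iso_pair X X' u v"
  shows "perp X Y \<longleftrightarrow> perp X' Y"
  using perp_retract_left[OF X X' Y iso_pairD(1,2,4)[OF uv]]
    perp_retract_left[OF X' X Y iso_pairD(2,1,3)[OF uv]] by blast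

lemma right_perp_dsum_iff:
  assumes "\<forall>M\<in>set Ms. is_rep n M"
  shows "Y \<in> right_perp n (dsum Ms) \<longleftrightarrow>
    is_rep n Y \<and> (\<forall>M\<in>set Ms. perp (pad_rep n M) (pad_rep n Y))"
  using perp_dsum_left[OF assms total_pad_rep[of n Y]]
  by (auto simp: right_perp_def Hom_vanishes_iff Ext_vanishes_iff is_rep_dsum[OF assms] perp_def)

text \<open>By \<open>perp_interval_iff\<close> this is the right perpendicular category of the
  interval modules whose edges form \<open>R\<close>.\<close>

definition path_inverting :: "nat \<Rightarrow> (nat \<times> nat) set \<Rightarrow> 'k::field rep set" where
  "path_inverting n R = {Y. is_rep n Y \<and> (\<forall>(c, d)\<in>R. mat_iso (path_map (pad_rep n Y) c d))}"

lemma path_invertingD: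
  "Y \<in> path_inverting n R \<Longrightarrow> is_rep n Y"
  "Y \<in> path_inverting n R \<Longrightarrow> (c, d) \<in> R \<Longrightarrow> mat_iso (path_map (pad_rep n Y) c d)"
  by (auto simp: path_inverting_def)

lemma path_iso_rtrancl:
  assumes Z: "total_rep Z" and R: "\<And>c d. (c, d) \<in> R \<Longrightarrow> c < d \<and> mat_iso (path_map Z c d)"
    and bq: "(b, q) \<in> R\<^sup>*"
  shows "b \<le> q \<and> mat_iso (path_map Z b q)"
  using bq
proof (induction rule: rtrancl_induct)
  case base
  then show ?case by (simp add: mat_iso_one)
next
  case (step q r)
  then have "q < r" "mat_iso (path_map Z q r)" "b \<le> q" "mat_iso (path_map Z b q)" using R by auto
  then have "mat_iso (path_map Z q r * path_map Z b q)"
    by (intro mat_iso_mult) (simp_all add: path_map_dim[OF Z])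
  then show ?case using \<open>q < r\<close> \<open>b \<le> q\<close> by (simp add: path_map_trans[OF Z])
qed

text \<open>The inverse \<open>V\<close> of the path map of \<open>Y\<close> satisfies
  \<open>V * f d = f c * U\<close>, so it preserves the image of \<open>f\<close> and descends to
  the cokernel as \<open>q c * V * s d\<close>.\<close>

lemma cokernel_path_iso:
  assumes X: "total_rep X" and Y: "total_rep Y" and W: "total_rep W"
    and f: "mor X Y f" and q: "mor Y W q"
    and qf: "\<And>i. q i * f i = 0\<^sub>m (dimv W i) (dimv X i)"
    and s: "\<And>i. s i \<in> carrier_mat (dimv Y i) (dimv W i)" and t: "\<And>i. t i \<in> carrier_mat (dimv X i) (dimv Y i)"
    and qs: "\<And>i. q i * s i = 1\<^sub>m (dimv W i)" and id: "\<And>i. s i * q i + f i * t i = 1\<^sub>m (dimv Y i)"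
    and cd: "c \<le> d" and iX: "mat_iso (path_map X c d)" and iY: "mat_iso (path_map Y c d)"
  shows "mat_iso (path_map W c d)"
proof -
  note [simp] = path_map_dim[OF X cd] path_map_dim[OF Y cd] path_map_dim[OF W cd] mor_dim[OF f] mor_dim[OF q]
    carrier_matD[OF s] carrier_matD[OF t]
  obtain U where U [simp]: "dim_row U = dimv X c" "dim_col U = dimv X d"
    and UX: "U * path_map X c d = 1\<^sub>m (dimv X c)" "path_map X c d * U = 1\<^sub>m (dimv X d)"
    using iX by (rule mat_isoE) (simp)
  obtain V where V [simp]: "dim_row V = dimv Y c" "dim_col V = dimv Y d"
    and VY: "V * path_map Y c d = 1\<^sub>m (dimv Y c)" "path_map Y c d * V = 1\<^sub>m (dimv Y d)"
    using iY by (rule mat_isoE) (simp)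
  have "V * f d = V * f d * (path_map X c d * U)" by (simp add: UX mat_mult_one_right)
  also have "\<dots> = V * (f d * path_map X c d) * U" by (simp add: mat_assoc)
  also have "\<dots> = V * path_map Y c d * f c * U" 
    unfolding path_map_natural[OF X Y f cd] by (simp add: mat_assoc)
  also have "\<dots> = f c * U" by (simp add: VY mat_mult_one_left)
  finally have Vf: "V * f d = f c * U" .
  show ?thesis
  proof (rule mat_isoI[of "q c * V * s d"])
    have "path_map W c d * (q c * V * s d) = path_map W c d * q c * V * s d"
      by (simp add: mat_assoc)
    also have "\<dots> = q d * (path_map Y c d * V) * s d"
      by (simp add: mat_assoc flip: path_map_natural[OF Y W q cd])
    finally show "path_map W c d * (q c * V * s d) = 1\<^sub>m (dim_row (path_map W c d))"
      by (simp add: VY qs mat_mult_one_right)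
    have "q c * V * s d * q d + q c * f c * (U * t d) = q c * V * (s d * q d) + q c * (V * f d) * t d"
      by (simp add: mat_assoc Vf)
    also have "\<dots> = q c * V * (s d * q d + f d * t d)"
      by (simp add: mat_assoc mat_mult_add_right)
    finally have "q c * V * s d * q d = q c * V"
      by (simp add: id qf mat_mult_one_right mat_mult_zero_left mat_add_zero_right)
    then have "q c * V * s d * q d * path_map Y c d = q c * V * path_map Y c d" by simp
    then have *: "q c * V * s d * path_map W c d * q c = q c"
      by (simp add: mat_assoc VY mat_mult_one_right path_map_natural[OF Y W q cd])
    have "q c * V * s d * path_map W c d = q c * V * s d * path_map W c d * (q c * s c)"
      by (simp add: qs mat_mult_one_right)
    also have "\<dots> = q c * V * s d * path_map W c d * q c * s c"
      by (simp add: mat_assoc)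
    finally show "q c * V * s d * path_map W c d = 1\<^sub>m (dim_col (path_map W c d))"
      by (simp only: * qs) simp
  qed (auto intro: carrier_matI)
qed

text \<open>The cokernel \<open>W\<close> lies in the subcategory, so it may be used as a test
  object: its projection \<open>q\<close> and the zero map agree on the image of \<open>f\<close>,
  hence \<open>q = 0\<close>.\<close>

lemma epi_surjective:
  assumes X: "X \<in> path_inverting n R" and Y: "Y \<in> path_inverting n R" and R: "\<And>c d. (c, d) \<in> R \<Longrightarrow> c < d"
    and f: "epi_in n (path_inverting n R) X Y f" and a: "a \<in> {1..n}"
  obtains t where "t \<in> carrier_mat (dimv X a) (dimv Y a)" "f a * t = 1\<^sub>m (dimv Y a)"
proof -
  let ?X = "pad_rep n X" and ?Y = "pad_rep n Y" and ?f = "pad_fam n f"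
  have rep: "is_rep n X" "is_rep n Y" using X Y by (auto simp: path_inverting_def)
  have fH: "f \<in> Hom n X Y" using f by (simp add: epi_in_def)
  note TX = total_pad_rep[OF rep(1)] and TY = total_pad_rep[OF rep(2)]
    and mf = mor_pad_fam[OF rep fH]
  obtain W q s t where W: "total_rep W" and q: "mor ?Y W q"
    and qf: "\<And>i. q i * ?f i = 0\<^sub>m (dimv W i) (dimv ?X i)"
    and s: "\<And>i. s i \<in> carrier_mat (dimv ?Y i) (dimv W i)" and t: "\<And>i. t i \<in> carrier_mat (dimv ?X i) (dimv ?Y i)"
    and qs: "\<And>i. q i * s i = 1\<^sub>m (dimv W i)" and id: "\<And>i. s i * q i + ?f i * t i = 1\<^sub>m (dimv ?Y i)"
    by (rule cokernel_exists[OF TX TY mf]) blast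
  note [simp] = mor_dim[OF q] carrier_matD[OF s] carrier_matD[OF t] mor_dim[OF mf]
  have "dimv W i = 0" if "i \<notin> {1..n}" for i
  proof -
    have "dimv ?Y i = 0" using that by (auto simp: dimv_pad_rep)
    then have "1\<^sub>m (dimv W i) = (0\<^sub>m (dimv W i) (dimv W i) :: 'a mat)"
      using qs[of i] mat_mult_empty[of "q i" "s i"] by simp
    then show ?thesis by (rule one_mat_eq_zero)
  qed
  then have EW: "pad_rep n W = W" by (intro pad_rep_eqI[OF W])
  have rW: "is_rep n W" by (rule is_rep_total_rep[OF W])
  have "mat_iso (path_map W c d)" if "(c, d) \<in> R" for c d
    using cokernel_path_iso[OF TX TY W mf q qf s t qs id] X Y that R[OF that]
    by (fastforce simp: path_inverting_def)
  then have "W \<in> path_inverting n R" using rW by (auto simp: path_inverting_def EW)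
  moreover have q': "restrict q {1..n} \<in> Hom n Y W" by (rule Hom_restrict) (use q EW in simp)
  moreover have "comp_hom n (restrict q {1..n}) f = comp_hom n (zero_hom n Y W) f"
    unfolding comp_hom_def
  proof (rule restrict_ext)
    fix i assume i: "i \<in> {1..n}"
    have "dimv W i = dimv (pad_rep n W) i" by (simp only: EW)
    then show "restrict q {1..n} i * f i = zero_hom n Y W i * f i"
      using qf[of i] i Hom_dim[OF fH i] by (simp add: pad_fam_def zero_hom_def dimv_pad_rep mat_mult_zero_left)
  qed
  ultimately have "restrict q {1..n} = zero_hom n Y W"
    using f zero_hom_mem[OF rep(2) rW] unfolding epi_in_def by blast
  then have "q a = zero_hom n Y W a" using a by (metis restrict_apply')
  then have "q a = 0\<^sub>m (dimv W a) (dimv ?Y a)"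
    using a by (simp add: zero_hom_def dimv_pad_rep)
  then have "?f a * t a = 1\<^sub>m (dimv ?Y a)"
    using id[of a] by (simp add: mat_mult_zero_right mat_add_zero_left)
  then show ?thesis
    using a t[of a] by (intro that[of "t a"]) (simp_all add: pad_fam_def dimv_pad_rep)
qed

text \<open>The hypotheses on \<open>p\<close> and \<open>q\<close> make the path maps from
  \<open>p\<close> to \<open>q\<close> and from \<open>b\<close> to \<open>q\<close> invertible in
  the whole category, hence also the one from \<open>p\<close> to \<open>b\<close>. Its inverse
  defines the projection of the space at \<open>a\<close> onto the kernel of the path to
  \<open>b\<close>.\<close>

lemma interval_projective:
  fixes P :: "'k::field rep"
  assumes R: "\<And>c d. (c, d) \<in> R \<Longrightarrow> c < d" and P: "P \<in> path_inverting n R"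
    and ab: "1 \<le> a" "a < b" "b \<le> Suc n"
    and uv: "iso_pair (pad_rep n P) (interval_rep a b) u v"
    and pq: "p < a" "(p, q) \<in> R \<or> (p, q) = (0, Suc n)" "(b, q) \<in> R\<^sup>*"
  shows "projective_object n (path_inverting n R) P"
  unfolding projective_object_def
proof (intro conjI ballI allI impI P)
  fix X Y f g
  assume X: "X \<in> path_inverting n R" and Y: "Y \<in> path_inverting n R"
    and f: "epi_in n (path_inverting n R) X Y f" and g: "g \<in> Hom n P Y"
  let ?X = "pad_rep n X" and ?Y = "pad_rep n Y" and ?f = "pad_fam n f" and ?g = "pad_fam n g"
    and ?P = "pad_rep n P" and ?I = "interval_rep a b :: 'k rep"
  have rep: "is_rep n X" "is_rep n Y" "is_rep n P" using X Y P by (auto simp: path_inverting_def)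
  note TX = total_pad_rep[OF rep(1)] and TY = total_pad_rep[OF rep(2)]
    and TP = total_pad_rep[OF rep(3)] and TI = total_interval[of a b, where ?'a = 'k]
  have fH: "f \<in> Hom n X Y" using f by (simp add: epi_in_def)
  note mf = mor_pad_fam[OF rep(1,2) fH] and mg = mor_pad_fam[OF rep(3,2) g]
  note u = iso_pairD(1)[OF uv] and v = iso_pairD(2)[OF uv]
  note [simp] = mor_dim[OF mf] mor_dim[OF mg] mor_dim[OF u] mor_dim[OF v] path_map_dim[OF TX] path_map_dim[OF TY]
  have bq: "b \<le> q" using path_iso_rtrancl[OF TX _ pq(3)] R path_invertingD(2)[OF X] by blast
  have iso: "mat_iso (path_map (pad_rep n Z) p b)" if Z: "Z \<in> path_inverting n R" for Z
  proof -
    have TZ: "total_rep (pad_rep n Z)" using Z by (auto simp: path_inverting_def intro: total_pad_rep)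
    have "mat_iso (path_map (pad_rep n Z) p q)"
      using pq(2)
    proof
      assume "(p, q) \<in> R"
      then show ?thesis using Z by (auto simp: path_inverting_def)
    next
      \<comment> \<open>Both ends carry the zero space.\<close>
      assume "(p, q) = (0, Suc n)"
      then show ?thesis
        using path_map_dim[OF TZ, of 0 "Suc n"]
        by (intro mat_isoI[of "0\<^sub>m 0 0"]) (auto simp: dimv_pad_rep intro!: mat_empty_eq)
    qed
    moreover have "mat_iso (path_map (pad_rep n Z) b q)"
      using path_iso_rtrancl[OF TZ _ pq(3)] R path_invertingD(2)[OF Z] by blast
    ultimately have e: "mat_iso (path_map (pad_rep n Z) b q * path_map (pad_rep n Z) p b)"
      "mat_iso (path_map (pad_rep n Z) b q)"
      using bq ab pq(1) by (simp_all add: path_map_trans[OF TZ])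
    show ?thesis
      by (rule mat_iso_cancel_left[OF e]) (use bq ab pq(1) in \<open>simp add: path_map_dim[OF TZ]\<close>)
  qed
  have pab: "p \<le> a" "p \<le> b" "a \<le> b" using pq(1) ab by auto
  obtain U where U [simp]: "dim_row U = dimv ?X p" "dim_col U = dimv ?X b"
    and UX: "U * path_map ?X p b = 1\<^sub>m (dimv ?X p)" "path_map ?X p b * U = 1\<^sub>m (dimv ?X b)"
    using iso[OF X] by (rule mat_isoE) (simp add: pab)
  obtain V where V [simp]: "dim_row V = dimv ?Y p" "dim_col V = dimv ?Y b"
    and VY: "V * path_map ?Y p b = 1\<^sub>m (dimv ?Y p)" "path_map ?Y p b * V = 1\<^sub>m (dimv ?Y b)"
    using iso[OF Y] by (rule mat_isoE) (simp add: pab)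
  \<comment> \<open>The inverses of the path maps from \<open>p\<close> to \<open>b\<close> commute
    with \<open>f\<close>; this makes the correction of the lift natural.\<close>
  have "?f p * U = V * path_map ?Y p b * ?f p * U" by (simp add: VY mat_mult_one_left)
  also have "\<dots> = V * (?f b * path_map ?X p b) * U"
    unfolding path_map_natural[OF TX TY mf pab(2)] by (simp add: mat_assoc pab)
  also have "\<dots> = V * ?f b * (path_map ?X p b * U)" by (simp add: mat_assoc pab)
  finally have fU: "?f p * U = V * ?f b" by (simp add: UX mat_mult_one_right)
  define G where "G i = ?g i * v i" for i
  have G: "mor ?I ?Y G" unfolding G_def by (rule mor_comp[OF TI TP TY v mg])
  note [simp] = mor_dim[OF G]
  define y where "y = G a"
  have y [simp]: "dim_row y = dimv ?Y a" "dim_col y = 1" using ab by (simp_all add: y_def dimv_interval)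
  have ky: "path_map ?Y a b * y = 0\<^sub>m (dimv ?Y b) 1"
    unfolding y_def by (rule mor_interval_end[OF TY G ab(2)])
  have a: "a \<in> {1..n}" using ab by auto
  obtain t where t: "t \<in> carrier_mat (dimv X a) (dimv Y a)" "f a * t = 1\<^sub>m (dimv Y a)"
    by (rule epi_surjective[OF X Y R f a])
  then have [simp]: "dim_row t = dimv ?X a" "dim_col t = dimv ?Y a" and ft: "?f a * t = 1\<^sub>m (dimv ?Y a)"
    using a by (auto simp: pad_fam_def dimv_pad_rep)
  define x0 where "x0 = t * y"
  have [simp]: "dim_row x0 = dimv ?X a" "dim_col x0 = 1" by (simp_all add: x0_def)
  have "?f a * x0 = ?f a * t * y" by (simp add: x0_def mat_assoc)
  then have fx0: "?f a * x0 = y" by (simp add: ft mat_mult_one_left)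
  \<comment> \<open>\<open>x0\<close> lifts \<open>y\<close>; the part of \<open>x0\<close> that comes from vertex \<open>p\<close> is mapped to \<open>0\<close>\<close>
  define z where "z = U * (path_map ?X a b * x0)"
  define x where "x = x0 + - (path_map ?X p a * z)"
  have [simp]: "dim_row z = dimv ?X p" "dim_col z = 1" "dim_row x = dimv ?X a" "dim_col x = 1"
    by (simp_all add: z_def x_def pab)
  have "path_map ?X a b * x = path_map ?X a b * x0 + - (path_map ?X a b * path_map ?X p a * z)"
    by (simp add: x_def mat_mult_add_right mat_mult_minus_right mat_assoc pab)
  also have "path_map ?X a b * path_map ?X p a * z = path_map ?X p b * U * (path_map ?X a b * x0)"
    unfolding path_map_trans[OF TX pab(1,3)] z_def by (simp add: mat_assoc pab)
  finally have kx: "path_map ?X a b * x = 0\<^sub>m (dimv ?X b) 1"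
    by (simp add: UX mat_mult_one_left pab mat_minus_self_add)
  have "?f p * z = V * (?f b * path_map ?X a b) * x0"
  proof -
    have "?f p * z = ?f p * U * (path_map ?X a b * x0)" by (simp add: z_def mat_assoc pab)
    then show ?thesis unfolding fU by (simp add: mat_assoc pab)
  qed
  also have "\<dots> = V * (path_map ?Y a b * y)"
    unfolding path_map_natural[OF TX TY mf pab(3)] by (simp add: mat_assoc pab fx0)
  finally have fz: "?f p * z = 0\<^sub>m (dimv ?Y p) 1" by (simp add: ky mat_mult_zero_right)
  have "?f a * x = y + - (?f a * path_map ?X p a * z)"
    by (simp add: x_def mat_mult_add_right mat_mult_minus_right mat_assoc pab fx0)
  also have "?f a * path_map ?X p a * z = path_map ?Y p a * (?f p * z)"
    unfolding path_map_natural[OF TX TY mf pab(1)] by (simp add: mat_assoc pab)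
  finally have fx: "?f a * x = y" by (simp add: fz mat_mult_zero_right mat_add_zero_right pab)
  define H where "H = interval_hom ?X a b x"
  have H: "mor ?I ?X H"
    unfolding H_def by (rule mor_interval_hom[OF TX ab(2) _ kx]) (auto intro: carrier_matI)
  note [simp] = mor_dim[OF H]
  have Ha: "H a = x" using ab by (simp add: H_def interval_hom_def mat_mult_one_left)
  note fHm = mor_comp[OF TI TX TY H mf]
  have fHG: "?f i * H i = G i" for i
  proof (cases "a \<le> i \<and> i < b")
    case True
    then show ?thesis
      using mor_interval_eq[OF TY G, of i] mor_interval_eq[OF TY fHm, of i] by (simp add: Ha fx y_def)
  next
    case False
    then show ?thesis by (intro mat_empty_eq) (auto simp: dimv_interval)
  qed
  have hm: "mor ?P ?X (\<lambda>i. H i * u i)" by (rule mor_comp[OF TP TI TX u H])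
  have fhg: "?f i * (H i * u i) = ?g i" for i
  proof -
    have "?f i * (H i * u i) = ?g i * (v i * u i)"
      using fHG[of i] by (simp add: G_def mat_assoc[symmetric])
    then show ?thesis unfolding iso_pairD(3)[OF uv] by (simp add: mat_mult_one_right)
  qed
  show "\<exists>h\<in>Hom n P X. comp_hom n f h = g"
  proof
    show "restrict (\<lambda>i. H i * u i) {1..n} \<in> Hom n P X" by (rule Hom_restrict[OF hm])
    have "comp_hom n (restrict ?f {1..n}) (restrict (\<lambda>i. H i * u i) {1..n}) = restrict ?g {1..n}"
      unfolding comp_hom_restrict fhg ..
    then show "comp_hom n f (restrict (\<lambda>i. H i * u i) {1..n}) = g"
      unfolding restrict_pad[OF fH] restrict_pad[OF g] .
  qed
qed

section \<open>The graph of an exceptional sequence\<close>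

text \<open>An interval module with support \<open>{a..<b}\<close> is drawn as an edge from \<open>a\<close> to \<open>b\<close>. The matrix \<open>L * D\<close> of the Euler
  form in the dimension vectors of the sequence is unitriangular. So no nonzero vector is orthogonal to
  all of them, while the indicator vector of a set that no edge leaves would be.\<close>

lemma edge_leaving_aux:
  fixes a b :: "nat \<Rightarrow> nat"
  assumes ab: "\<And>i. i < n \<Longrightarrow> 1 \<le> a i \<and> a i < b i \<and> b i \<le> Suc n"
    and exc: "\<And>i j. i < j \<Longrightarrow> j < n \<Longrightarrow> (a i \<le> a j \<and> a j < b i) \<longleftrightarrow> (a i \<le> b j \<and> b j < b i)"
    and S: "S \<subseteq> {1..n}" "S \<noteq> {}"
  shows "\<exists>i<n. (a i \<in> S) \<noteq> (b i \<in> S)"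
proof (rule ccontr)
  assume no: "\<not> (\<exists>i<n. (a i \<in> S) \<noteq> (b i \<in> S))"
  \<comment> \<open>Index \<open>v\<close> stands for vertex \<open>Suc v\<close>. Row
    \<open>i\<close> is the functional of a module that subtracts its dimension at
    \<open>b i\<close> from that at \<open>a i\<close>, as the projective resolution dictates. The
    vertex \<open>Suc n\<close> has no column, hence \<open>S\<close> must avoid it.\<close>
  define L where "L = mat n n (\<lambda>(i, v). (if a i = Suc v then 1 else 0) - (if b i = Suc v then 1 else (0::rat)))"
  define D where "D = mat n n (\<lambda>(v, j). if a j \<le> Suc v \<and> Suc v < b j then 1 else (0::rat))"
  have LD: "L \<in> carrier_mat n n" "D \<in> carrier_mat n n" by (auto simp: L_def D_def)
  have sum1: "(\<Sum>v = 0..<n. (if c = Suc v then 1 else 0) * f v) = (if c \<le> n then f (c - 1) else 0)"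
    if "1 \<le> c" for c and f :: "nat \<Rightarrow> rat"
  proof -
    have "(\<Sum>v = 0..<n. (if c = Suc v then 1 else 0) * f v) = (\<Sum>v = 0..<n. if v = c - 1 then f v else 0)"
      using that by (intro sum.cong) auto
    then show ?thesis using that by auto
  qed
  have LDij: "(L * D) $$ (i, j) = (if a j \<le> a i \<and> a i < b j then 1 else 0) - (if a j \<le> b i \<and> b i < b j then 1 else 0)"
    if "i < n" "j < n" for i j
  proof -
    have "(L * D) $$ (i, j) = (\<Sum>v = 0..<n. (if a i = Suc v then 1 else 0) * (if a j \<le> Suc v \<and> Suc v < b j then 1 else 0)) -
      (\<Sum>v = 0..<n. (if b i = Suc v then 1 else 0) * (if a j \<le> Suc v \<and> Suc v < b j then 1 else (0::rat)))"
      using that by (simp add: L_def D_def scalar_prod_def algebra_simps sum_subtractf)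
    also have "\<dots> = (if a j \<le> a i \<and> a i < b j then 1 else 0) - (if a j \<le> b i \<and> b i < b j then 1 else 0)"
      using ab[of i] ab[of j] that by (subst (1 2) sum1) auto
    finally show ?thesis .
  qed
  have "upper_triangular (L * D)"
  proof (rule upper_triangularI)
    fix i j assume "j < i" "i < dim_row (L * D)"
    then have "j < i" "i < n" using LD by auto
    then show "(L * D) $$ (i, j) = 0" using exc[of j i] by (subst LDij) auto
  qed
  then have "det (L * D) = prod_list (diag_mat (L * D))"
    using LD by (intro det_upper_triangular[of _ n]) auto
  also have "diag_mat (L * D) = map (\<lambda>_. 1) [0..<n]"
    unfolding diag_mat_def using LD
  proof (intro map_cong)
    fix i assume "i \<in> set [0..<n]"
    then show "(L * D) $$ (i, i) = 1" using ab[of i] by (subst LDij) auto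
  qed auto
  also have "prod_list (map (\<lambda>_. 1) [0..<n]) = (1 :: rat)" by (induction n) auto
  finally have "det L \<noteq> 0" using det_mult[OF LD] by auto
  define x where "x = vec n (\<lambda>v. if Suc v \<in> S then 1 else (0::rat))"
  have "L *\<^sub>v x = 0\<^sub>v n"
  proof (rule eq_vecI)
    fix i assume "i < dim_vec (0\<^sub>v n :: rat vec)"
    then have i: "i < n" by simp
    have "(L *\<^sub>v x) $ i = (\<Sum>v = 0..<n. (if a i = Suc v then 1 else 0) * (if Suc v \<in> S then 1 else 0)) -
      (\<Sum>v = 0..<n. (if b i = Suc v then 1 else 0) * (if Suc v \<in> S then 1 else (0::rat)))"
      using i by (simp add: L_def x_def scalar_prod_def algebra_simps sum_subtractf)
    also have "\<dots> = (if a i \<in> S then 1 else 0) - (if b i \<in> S then 1 else 0)"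
      using ab[OF i] S by (subst (1 2) sum1) auto
    finally show "(L *\<^sub>v x) $ i = 0\<^sub>v n $ i" using no i by auto
  qed (use LD in simp)
  moreover have "x \<noteq> 0\<^sub>v n"
  proof
    assume x0: "x = 0\<^sub>v n"
    obtain v where "v \<in> S" using S by blast
    moreover from this have v: "1 \<le> v" "v \<le> n" using S by auto
    ultimately have "x $ (v - 1) = 1" by (simp add: x_def)
    then show False using v by (simp add: x0)
  qed
  ultimately have "det L = 0"
    unfolding det_0_iff_vec_prod_zero[OF LD(1)] by (intro exI[of _ x]) (simp add: x_def)
  with \<open>det L \<noteq> 0\<close> show False by simp
qed

text \<open>The second assumption says that module \<open>i\<close> has the same dimension at both
  ends of edge \<open>j\<close>, for \<open>j\<close> later than \<open>i\<close>.\<close>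

locale exceptional_intervals =
  fixes n :: nat and a b :: "nat \<Rightarrow> nat"
  assumes endpoints: "i < n \<Longrightarrow> 1 \<le> a i \<and> a i < b i \<and> b i \<le> Suc n"
    and exceptional: "i < j \<Longrightarrow> j < n \<Longrightarrow> (a i \<le> a j \<and> a j < b i) \<longleftrightarrow> (a i \<le> b j \<and> b j < b i)"
begin

text \<open>Connectedness of the graph. A set that contains \<open>Suc n\<close> is replaced by its
  complement, which is left by the same edges.\<close>

lemma edge_leaving:
  assumes S: "S \<subseteq> {1..Suc n}" "S \<noteq> {}" "S \<noteq> {1..Suc n}"
  shows "\<exists>i<n. (a i \<in> S) \<noteq> (b i \<in> S)"
proof (cases "Suc n \<in> S")
  case False
  have "S \<subseteq> {1..n}"
  proof
    fix x assume "x \<in> S"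
    then have "1 \<le> x" "x \<le> Suc n" "x \<noteq> Suc n" using False S(1) by auto
    then show "x \<in> {1..n}" by simp
  qed
  then show ?thesis using edge_leaving_aux[of n a b S] endpoints exceptional S by blast
next
  case True
  define S' where "S' = {1..Suc n} - S"
  have "S' \<noteq> {}" using S by (auto simp: S'_def)
  moreover have "S' \<subseteq> {1..n}"
  proof
    fix x assume "x \<in> S'"
    then have "1 \<le> x" "x \<le> Suc n" "x \<noteq> Suc n" using True by (auto simp: S'_def)
    then show "x \<in> {1..n}" by simp
  qed
  ultimately obtain i where "i < n" "(a i \<in> S') \<noteq> (b i \<in> S')"
    using edge_leaving_aux[of n a b S'] endpoints exceptional by blast
  then show ?thesis using endpoints[of i] by (auto simp: S'_def)
qed

text \<open>If \<open>i\<close> is earlier, \<open>a j\<close> inside edge \<open>i\<close> forces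
  \<open>b j\<close> inside. If \<open>j\<close> is earlier, \<open>a i\<close> outside edge
  \<open>j\<close> forces \<open>b i\<close> outside.\<close>

lemma not_crossing: "i < n \<Longrightarrow> j < n \<Longrightarrow> a i < a j \<Longrightarrow> a j < b i \<Longrightarrow> b j \<le> b i"
  using exceptional[of i j] exceptional[of j i] endpoints[of i] endpoints[of j]
  by (cases i j rule: linorder_cases) auto

text \<open>For this and the next two lemmas, the opposite order would put exactly one end of
  \<open>i\<close> inside the half-open interval of \<open>j\<close>. Thus of two edges with the
  same start the longer comes first, and with the same end the shorter.\<close>

lemma adjacent_order: "i < n \<Longrightarrow> j < n \<Longrightarrow> b i = a j \<Longrightarrow> i < j"
  using exceptional[of j i] endpoints[of i] endpoints[of j]
  by (cases i j rule: linorder_cases) auto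

lemma same_start_order: "i < n \<Longrightarrow> j < n \<Longrightarrow> a i = a j \<Longrightarrow> b j < b i \<Longrightarrow> i < j"
  using exceptional[of j i] endpoints[of i] endpoints[of j]
  by (cases i j rule: linorder_cases) auto

lemma same_end_order: "i < n \<Longrightarrow> j < n \<Longrightarrow> b i = b j \<Longrightarrow> a j < a i \<Longrightarrow> i < j"
  using exceptional[of j i] endpoints[of i] endpoints[of j]
  by (cases i j rule: linorder_cases) auto

lemma edge_unique: "i < n \<Longrightarrow> j < n \<Longrightarrow> a i = a j \<Longrightarrow> b i = b j \<Longrightarrow> i = j"
  using exceptional[of j i] exceptional[of i j] endpoints[of i] endpoints[of j]
  by (cases i j rule: linorder_cases) auto

section \<open>Chains of maximal edges\<close>

definition earlier :: "nat \<Rightarrow> (nat \<times> nat) set" where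
  "earlier i = {(a j, b j) | j. j < i}"

definition later :: "nat \<Rightarrow> (nat \<times> nat) set" where
  "later i = {(a j, b j) | j. i < j \<and> j < n}"

text \<open>The edges of a set \<open>V\<close> that are maximal for inclusion and adjacent to each other form a path;
  \<open>chain V i u w\<close> says that a part of the path through the edge \<open>i\<close> goes from \<open>u\<close> to \<open>w\<close>.\<close>

definition maximal :: "nat set \<Rightarrow> nat \<Rightarrow> bool" where
  "maximal V i \<longleftrightarrow> i \<in> V \<and> (\<forall>j\<in>V. a j \<le> a i \<longrightarrow> b i \<le> b j \<longrightarrow> j = i)"

inductive chain :: "nat set \<Rightarrow> nat \<Rightarrow> nat \<Rightarrow> nat \<Rightarrow> bool" for V i where
  base: "chain V i (a i) (b i)"
| right: "chain V i u w \<Longrightarrow> maximal V j \<Longrightarrow> a j = w \<Longrightarrow> chain V i u (b j)"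
| left: "chain V i u w \<Longrightarrow> maximal V j \<Longrightarrow> b j = u \<Longrightarrow> chain V i (a j) w"

text \<open>The invariant of a chain. The edges at its two tips record the order, so that by
  \<open>adjacent_order\<close> an edge attached on the right is later than \<open>i\<close> and one
  attached on the left is earlier. The last conjunct says that edges can leave the chain only
  outwards at a tip.\<close>

lemma chain_props:
  assumes V: "V \<subseteq> {..<n}" and i: "maximal V i" and c: "chain V i u w"
  shows "u \<le> a i \<and> b i \<le> w \<and> (b i, w) \<in> (later i)\<^sup>* \<and> (u, a i) \<in> (earlier i)\<^sup>* \<and>
    (\<exists>j\<in>V. i \<le> j \<and> b j = w \<and> a i \<le> a j) \<and> (\<exists>j\<in>V. j \<le> i \<and> a j = u \<and> b j \<le> b i) \<and>
    (\<forall>j\<in>V. (a j \<in> {u..w} \<longrightarrow> b j \<in> {u..w} \<or> a j = w) \<and> (b j \<in> {u..w} \<longrightarrow> a j \<in> {u..w} \<or> b j = u))"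
  using c
proof induction
  case base
  have iV: "i \<in> V" "i < n" using i V by (auto simp: maximal_def)
  have "(a j \<in> {a i..b i} \<longrightarrow> b j \<in> {a i..b i} \<or> a j = b i) \<and> (b j \<in> {a i..b i} \<longrightarrow> a j \<in> {a i..b i} \<or> b j = a i)"
    if j: "j \<in> V" for j
  proof -
    have "j < n" using j V by auto
    have 1: False if "a i \<le> a j" "a j < b i" "b i < b j"
      using not_crossing[of i j] i j iV \<open>j < n\<close> that by (cases "a i = a j") (auto simp: maximal_def)
    have 2: False if "a j < a i" "a i < b j" "b j \<le> b i"
      using not_crossing[of j i] i j iV \<open>j < n\<close> that by (auto simp: maximal_def)
    show ?thesis
    proof (rule ccontr)
      assume "\<not> ?thesis"
      then have "(a i \<le> a j \<and> a j < b i \<and> b i < b j) \<or> (a j < a i \<and> a i < b j \<and> b j \<le> b i)"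
        using endpoints[OF \<open>j < n\<close>] by auto
      then show False using 1 2 by blast
    qed
  qed
  then show ?case using iV by auto
next
  case (right u w j)
  note IH = right.IH
  have j: "j \<in> V" "a j = w" and jmax: "\<And>l. l \<in> V \<Longrightarrow> a l \<le> a j \<Longrightarrow> b j \<le> b l \<Longrightarrow> l = j"
    using right by (auto simp: maximal_def)
  have iV: "i \<in> V" using i by (simp add: maximal_def)
  have N: "\<And>l. l \<in> V \<Longrightarrow> l < n" using V by auto
  have abj: "a j < b j" "a i < b i" using endpoints N j(1) iV by auto
  obtain k where k: "k \<in> V" "i \<le> k" "b k = w" using IH by blast
  have "k < j" using adjacent_order[of k j] N k j by simp
  then have ij: "i < j" using k by simp
  then have "(w, b j) \<in> later i" using N[OF j(1)] j(2) by (auto simp: later_def)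
  then have path: "(b i, b j) \<in> (later i)\<^sup>*" using IH by (meson rtrancl.rtrancl_into_rtrancl)
  have out: "(a l \<in> {u..b j} \<longrightarrow> b l \<in> {u..b j} \<or> a l = b j) \<and> (b l \<in> {u..b j} \<longrightarrow> a l \<in> {u..b j} \<or> b l = u)"
    if l: "l \<in> V" for l
  proof -
    have l': "a l < b l" using endpoints N[OF l] by auto
    have o: "(a l \<in> {u..w} \<longrightarrow> b l \<in> {u..w} \<or> a l = w) \<and> (b l \<in> {u..w} \<longrightarrow> a l \<in> {u..w} \<or> b l = u)"
      using IH l by blast
    \<comment> \<open>Such an edge would leave the old chain before \<open>w\<close>, contain the
      maximal edge \<open>j\<close>, or cross \<open>j\<close>.\<close>
    have 1: False if h: "u \<le> a l" "a l < b j" "b j < b l"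
    proof -
      have "\<not> a l < a j" using o h abj j(2) by auto
      moreover have "a l \<noteq> a j" using jmax[OF l] h by auto
      moreover have "\<not> a j < a l" using not_crossing[of j l] N j(1) l h by auto
      ultimately show False by simp
    qed
    \<comment> \<open>An edge coming from the left of \<open>u\<close> has to pass beyond
      \<open>w = a j\<close>; then it contains or crosses \<open>j\<close>.\<close>
    have 2: False if h: "a l < u" "u < b l" "b l \<le> b j"
    proof -
      have "w < b l" using o h by auto
      moreover have "a l < a j" using h IH abj j(2) by simp
      ultimately have "b j \<le> b l" using not_crossing[of l j] N j l by auto
      then show False using jmax[OF l] \<open>a l < a j\<close> by auto
    qed
    show ?thesis
    proof (rule ccontr)
      assume "\<not> ?thesis"
      then have "(u \<le> a l \<and> a l < b j \<and> b j < b l) \<or> (a l < u \<and> u < b l \<and> b l \<le> b j)" using l' by auto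
      then show False using 1 2 by blast
    qed
  qed
  have e1: "\<exists>k\<in>V. i \<le> k \<and> b k = b j \<and> a i \<le> a k"
    using j(1) ij IH abj j(2) by (intro bexI[of _ j]) auto
  have ends: "u \<le> a i" "b i \<le> b j" using IH abj j(2) by auto
  have IH': "(u, a i) \<in> (earlier i)\<^sup>*" "\<exists>k\<in>V. k \<le> i \<and> a k = u \<and> b k \<le> b i" using IH by blast+
  show ?case using ends path IH' e1 out by blast
next
  case (left u w j)
  note IH = left.IH
  have j: "j \<in> V" "b j = u" and jmax: "\<And>l. l \<in> V \<Longrightarrow> a l \<le> a j \<Longrightarrow> b j \<le> b l \<Longrightarrow> l = j"
    using left by (auto simp: maximal_def)
  have iV: "i \<in> V" using i by (simp add: maximal_def)
  have N: "\<And>l. l \<in> V \<Longrightarrow> l < n" using V by auto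
  have abj: "a j < b j" "a i < b i" using endpoints N j(1) iV by auto
  obtain k where k: "k \<in> V" "k \<le> i" "a k = u" using IH by blast
  have "j < k" using adjacent_order[of j k] N k j by simp
  then have ij: "j < i" using k by simp
  then have "(a j, u) \<in> earlier i" using j(2) by (auto simp: earlier_def)
  then have path: "(a j, a i) \<in> (earlier i)\<^sup>*" using IH by (meson converse_rtrancl_into_rtrancl)
  have out: "(a l \<in> {a j..w} \<longrightarrow> b l \<in> {a j..w} \<or> a l = w) \<and> (b l \<in> {a j..w} \<longrightarrow> a l \<in> {a j..w} \<or> b l = a j)"
    if l: "l \<in> V" for l
  proof -
    have l': "a l < b l" using endpoints N[OF l] by auto
    have o: "(a l \<in> {u..w} \<longrightarrow> b l \<in> {u..w} \<or> a l = w) \<and> (b l \<in> {u..w} \<longrightarrow> a l \<in> {u..w} \<or> b l = u)"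
      using IH l by blast
    have 1: False if h: "a l < a j" "a j < b l" "b l \<le> w"
    proof -
      have "\<not> b j < b l" using o h abj j(2) by auto
      moreover have "b l \<noteq> b j" using jmax[OF l] h by auto
      moreover have "\<not> b l < b j" using not_crossing[of l j] N j(1) l h by auto
      ultimately show False by simp
    qed
    have 2: False if h: "a j \<le> a l" "a l < w" "w < b l"
    proof -
      have "a l < u" using o h by auto
      moreover have "b j < b l" using h IH abj j(2) by simp
      ultimately have "\<not> a j < a l" using not_crossing[of j l] N j l by auto
      then have "l = j" using \<open>b j < b l\<close> by (intro jmax[OF l]) simp_all
      then show False using \<open>b j < b l\<close> by simp
    qed
    show ?thesis
    proof (rule ccontr)
      assume "\<not> ?thesis"
      then have "(a l < a j \<and> a j < b l \<and> b l \<le> w) \<or> (a j \<le> a l \<and> a l < w \<and> w < b l)" using l' by auto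
      then show False using 1 2 by blast
    qed
  qed
  have e1: "\<exists>k\<in>V. k \<le> i \<and> a k = a j \<and> b k \<le> b i"
    using j(1) ij IH abj j(2) by (intro bexI[of _ j]) auto
  have ends: "a j \<le> a i" "b i \<le> w" using IH abj j(2) by auto
  have IH': "(b i, w) \<in> (later i)\<^sup>*" "\<exists>k\<in>V. i \<le> k \<and> b k = w \<and> a i \<le> a k" using IH by blast+
  show ?case using ends path IH' e1 out by blast
qed

text \<open>Take a longest edge above \<open>l\<close>. By \<open>edge_unique\<close>, an edge above
  it of the same length is the edge itself.\<close>

lemma maximal_above:
  assumes "V \<subseteq> {..<n}" "l \<in> V"
  obtains k where "maximal V k" "a k \<le> a l" "b l \<le> b k"
proof -
  define P where "P k \<longleftrightarrow> k \<in> V \<and> a k \<le> a l \<and> b l \<le> b k" for k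
  have N: "P k \<Longrightarrow> k < n" for k using assms(1) by (auto simp: P_def)
  have "P l" using assms by (simp add: P_def)
  moreover have "\<forall>k. P k \<longrightarrow> b k - a k < Suc (Suc n)"
  proof (intro allI impI)
    fix k assume "P k"
    from endpoints[OF N[OF this]] show "b k - a k < Suc (Suc n)" by auto
  qed
  ultimately obtain k where k: "P k" "\<And>m. P m \<Longrightarrow> b m - a m \<le> b k - a k"
    using ex_has_greatest_nat[of P l "\<lambda>k. b k - a k" "Suc (Suc n)"] by blast
  have "m = k" if m: "m \<in> V" "a m \<le> a k" "b k \<le> b m" for m
  proof -
    have "P m" using m k by (auto simp: P_def)
    then have "b m - a m \<le> b k - a k" by (rule k(2))
    then show ?thesis
      using m edge_unique[of m k] N[OF \<open>P m\<close>] N[OF k(1)] endpoints[OF N[OF k(1)]] by auto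
  qed
  then have "maximal V k" using k by (auto simp: maximal_def P_def)
  then show ?thesis using that k by (auto simp: P_def)
qed

text \<open>A longest chain is closed: an edge leaving it lies below a maximal edge, which would
  prolong the chain or contain \<open>i\<close>.\<close>

lemma full_chain:
  assumes V: "V \<subseteq> {..<n}" and i: "maximal V i"
  obtains u w where "chain V i u w" "\<And>j. j \<in> V \<Longrightarrow> a j \<in> {u..w} \<longleftrightarrow> b j \<in> {u..w}"
proof -
  note props = chain_props[OF V i]
  define P where "P p \<longleftrightarrow> chain V i (fst p) (snd p)" for p
  have "P (a i, b i)" by (simp add: P_def chain.base)
  moreover have "\<forall>p. P p \<longrightarrow> snd p - fst p < Suc (Suc n)"
  proof (intro allI impI)
    fix p assume "P p"
    then obtain j where "j \<in> V" "b j = snd p" using props[of "fst p" "snd p"] by (auto simp: P_def)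
    moreover from this have "j < n" using V by auto
    ultimately show "snd p - fst p < Suc (Suc n)" using endpoints[of j] by auto
  qed
  ultimately obtain p where p: "P p" "\<And>p'. P p' \<Longrightarrow> snd p' - fst p' \<le> snd p - fst p"
    using ex_has_greatest_nat[of P "(a i, b i)" "\<lambda>p. snd p - fst p" "Suc (Suc n)"] by blast
  define u w where "u = fst p" and "w = snd p"
  have c: "chain V i u w" using p by (simp add: P_def u_def w_def)
  have longest: "w' - u' \<le> w - u" if "chain V i u' w'" for u' w'
    using p(2)[of "(u', w')"] that by (simp add: P_def u_def w_def)
  note pc = props[OF c]
  have ends: "u \<le> a i" "b i \<le> w" using pc by blast+
  have iV: "i \<in> V" and imax: "\<And>k. k \<in> V \<Longrightarrow> a k \<le> a i \<Longrightarrow> b i \<le> b k \<Longrightarrow> k = i"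
    using i by (auto simp: maximal_def)
  have abi: "a i < b i" using endpoints[of i] iV V by auto
  have "a l \<in> {u..w} \<longleftrightarrow> b l \<in> {u..w}" if l: "l \<in> V" for l
  proof (rule ccontr)
    assume ne: "\<not> ?thesis"
    have abl: "a l < b l" using endpoints[of l] l V by auto
    obtain k where k: "maximal V k" "a k \<le> a l" "b l \<le> b k" using maximal_above[OF V l] .
    then have kV: "k \<in> V" by (simp add: maximal_def)
    have ok: "(a k \<in> {u..w} \<longrightarrow> b k \<in> {u..w} \<or> a k = w) \<and> (b k \<in> {u..w} \<longrightarrow> a k \<in> {u..w} \<or> b k = u)"
      and ol: "(a l \<in> {u..w} \<longrightarrow> b l \<in> {u..w} \<or> a l = w) \<and> (b l \<in> {u..w} \<longrightarrow> a l \<in> {u..w} \<or> b l = u)"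
      using pc kV l by blast+
    \<comment> \<open>An edge around the whole chain would contain \<open>i\<close>, against
      maximality.\<close>
    have ki: "\<not> (a k < u \<and> w < b k)"
    proof
      assume h: "a k < u \<and> w < b k"
      then have "k = i" using imax[OF kV] ends by auto
      then show False using h ends by auto
    qed
    have "(a l = w \<and> w < b l) \<or> (b l = u \<and> a l < u)" using ne ol abl by auto
    then show False
    proof
      assume h: "a l = w \<and> w < b l"
      then have "a k = w" using ok ki k by auto
      from longest[OF chain.right[OF c k(1) this]] show False using h k ends abi by linarith
    next
      assume h: "b l = u \<and> a l < u"
      then have "b k = u" using ok ki k by auto
      from longest[OF chain.left[OF c k(1) this]] show False using h k ends abi by linarith
    qed
  qed
  with c that show ?thesis by blast
qed

text \<open>Paths from \<open>0\<close> to \<open>n + 1\<close> run between zero spaces, so \<open>(0, n + 1)\<close> can serve as an edge that encloses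
  all others. Injectivity involves the vertices \<open>a - 1\<close> and \<open>b - 1\<close> instead of \<open>a\<close> and \<open>b\<close>, hence the
  edge \<open>(1, n + 2)\<close>.\<close>

definition proj_condition :: "nat \<Rightarrow> bool" where
  "proj_condition i \<longleftrightarrow> (\<exists>p q. p < a i \<and> ((p, q) \<in> later i \<or> (p, q) = (0, Suc n)) \<and>
     (b i, q) \<in> (later i)\<^sup>*)"

definition inj_condition :: "nat \<Rightarrow> bool" where
  "inj_condition i \<longleftrightarrow> (\<exists>p q. b i < q \<and> ((p, q) \<in> earlier i \<or> (p, q) = (1, Suc (Suc n))) \<and>
     (p, a i) \<in> (earlier i)\<^sup>*)"

text \<open>No edge at all leaves the closed chain, so by connectedness it runs from
  \<open>1\<close> to \<open>Suc n\<close>, and the two artificial edges serve as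
  \<open>(p, q)\<close>.\<close>

lemma root_conditions:
  assumes i: "maximal {..<n} i"
  shows "proj_condition i \<and> inj_condition i"
proof -
  obtain u w where c: "chain {..<n} i u w" and out: "\<And>j. j \<in> {..<n} \<Longrightarrow> a j \<in> {u..w} \<longleftrightarrow> b j \<in> {u..w}"
    using full_chain[OF _ i] by blast
  note pc = chain_props[OF subset_refl i c]
  have i': "1 \<le> a i" "a i < b i" "b i \<le> Suc n" using endpoints[of i] i by (auto simp: maximal_def)
  have "1 \<le> u" "w \<le> Suc n" using pc endpoints by blast+
  then have "{u..w} \<subseteq> {1..Suc n}" by auto
  moreover have "{u..w} \<noteq> {}" using pc i' by auto
  ultimately have "{u..w} = {1..Suc n}" using edge_leaving[of "{u..w}"] out by blast
  then have "u = 1 \<and> w = Suc n" using Icc_eq_Icc[of u w 1 "Suc n"] by auto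
  then have "(b i, Suc n) \<in> (later i)\<^sup>*" "(1, a i) \<in> (earlier i)\<^sup>*" using pc by auto
  moreover have "0 < a i" "b i < Suc (Suc n)" using i' by auto
  ultimately show ?thesis
    unfolding proj_condition_def inj_condition_def using i' by blast
qed

text \<open>\<open>k\<close> is a shortest edge above \<open>i\<close>, which makes \<open>i\<close>
  maximal among the edges \<open>V\<close> strictly below \<open>k\<close>. If the closed chain
  through \<open>i\<close> reached neither end of \<open>k\<close>, connectedness would give an edge
  leaving it, and this edge would belong to \<open>V\<close>.\<close>

lemma nonroot_condition:
  assumes "i < n" and nm: "\<not> maximal {..<n} i"
  shows "proj_condition i \<or> inj_condition i"
proof -
  define P where "P k \<longleftrightarrow> k < n \<and> k \<noteq> i \<and> a k \<le> a i \<and> b i \<le> b k" for k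
  have "\<exists>k. P k" using assms by (auto simp: maximal_def P_def)
  then obtain k where k: "P k" "\<And>m. P m \<Longrightarrow> b k - a k \<le> b m - a m"
    using ex_has_least_nat[of P _ "\<lambda>k. b k - a k"] by blast
  have kn: "k < n" "k \<noteq> i" "a k \<le> a i" "b i \<le> b k" using k(1) by (auto simp: P_def)
  note ek = endpoints[OF kn(1)] and ei = endpoints[OF assms(1)]
  define V where "V = {j. j < n \<and> a k \<le> a j \<and> b j \<le> b k \<and> j \<noteq> k}"
  have V: "V \<subseteq> {..<n}" by (auto simp: V_def)
  have i: "maximal V i"
    unfolding maximal_def
  proof (intro conjI ballI impI)
    show "i \<in> V" using assms kn by (auto simp: V_def)
    fix j assume j: "j \<in> V" "a j \<le> a i" "b i \<le> b j"
    show "j = i"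
    proof (rule ccontr)
      assume "j \<noteq> i"
      then have "b k - a k \<le> b j - a j" using j by (intro k(2)) (auto simp: P_def V_def)
      moreover have jk: "j < n" "a k \<le> a j" "b j \<le> b k" "j \<noteq> k" using j by (auto simp: V_def)
      ultimately have "a j = a k \<and> b j = b k" using endpoints[OF jk(1)] by arith
      then show False using edge_unique[of j k] kn(1) jk by auto
    qed
  qed
  obtain u w where c: "chain V i u w" and out: "\<And>j. j \<in> V \<Longrightarrow> a j \<in> {u..w} \<longleftrightarrow> b j \<in> {u..w}"
    using full_chain[OF V i] by blast
  note pc = chain_props[OF V i c]
  obtain j where j: "j \<in> V" "i \<le> j" "b j = w" "a i \<le> a j" using pc by blast
  obtain j' where j': "j' \<in> V" "j' \<le> i" "a j' = u" "b j' \<le> b i" using pc by blast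
  have uw: "a k \<le> u" "w \<le> b k" "u \<le> a i" "b i \<le> w" using j j' pc by (auto simp: V_def)
  have "u = a k \<or> w = b k"
  proof (rule ccontr)
    assume "\<not> ?thesis"
    then have lt: "a k < u" "w < b k" using uw by auto
    have "{u..w} \<subseteq> {1..Suc n}" using lt ek by auto
    moreover have "{u..w} \<noteq> {}" using uw ei by auto
    moreover have "{u..w} \<noteq> {1..Suc n}"
    proof
      assume "{u..w} = {1..Suc n}"
      moreover have "a k \<in> {1..Suc n}" using ek by auto
      ultimately show False using lt by auto
    qed
    ultimately obtain l where l: "l < n" "(a l \<in> {u..w}) \<noteq> (b l \<in> {u..w})"
      using edge_leaving by blast
    have "l \<noteq> k" using l lt by auto
    \<comment> \<open>One end of \<open>l\<close> lies strictly between the ends of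
      \<open>k\<close>, so \<open>l\<close> stays below \<open>k\<close> or crosses it.\<close>
    moreover have "a k \<le> a l \<and> b l \<le> b k"
    proof (cases "a l \<in> {u..w}")
      case True
      then show ?thesis using not_crossing[of k l] l(1) kn(1) lt by auto
    next
      case False
      then have "b l < b k" "a k < b l" using l(2) lt by auto
      then show ?thesis using not_crossing[of l k] l(1) kn(1) by (auto simp: not_le[symmetric])
    qed
    ultimately have "l \<in> V" using l by (auto simp: V_def)
    then show False using out l by blast
  qed
  moreover have ne: "\<not> (a k = a i \<and> b k = b i)" using edge_unique[of k i] kn assms by auto
  moreover have "proj_condition i" if "w = b k" "a k < a i"
  proof -
    \<comment> \<open>\<open>j\<close> shares its right end with \<open>k\<close> and is shorter, so
      it precedes \<open>k\<close>; and \<open>i \<le> j\<close>.\<close>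
    have "j < k" using same_end_order[of j k] j that kn by (auto simp: V_def)
    then have "(a k, b k) \<in> later i" using j kn by (auto simp: later_def)
    then show ?thesis unfolding proj_condition_def using that kn pc by blast
  qed
  moreover have "inj_condition i" if "u = a k" "b i < b k"
  proof -
    have "k < j'" using same_start_order[of k j'] j' that kn by (auto simp: V_def)
    then have "(a k, b k) \<in> earlier i" using j' by (auto simp: earlier_def)
    then show ?thesis unfolding inj_condition_def using that kn pc by blast
  qed
  \<comment> \<open>If \<open>w = b k\<close> but \<open>a k = a i\<close>, then
    \<open>a k \<le> u \<le> a i\<close> gives \<open>u = a k\<close>, and \<open>ne\<close> gives
    \<open>b i < b k\<close>. The other degenerate case is symmetric.\<close>
  ultimately show ?thesis using uw kn by (metis le_antisym le_neq_implies_less)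
qed

lemma projective_or_injective_conditions:
  assumes "1 \<le> n"
  shows "(\<forall>i<n. proj_condition i \<or> inj_condition i) \<and> (\<exists>i<n. proj_condition i \<and> inj_condition i)"
proof -
  obtain i where "maximal {..<n} i" using maximal_above[of "{..<n}" 0] assms by auto
  then have "i < n" "proj_condition i \<and> inj_condition i"
    using root_conditions unfolding maximal_def by blast+
  moreover have "proj_condition j \<or> inj_condition j" if "j < n" for j
    using root_conditions[of j] nonroot_condition[OF that] by blast
  ultimately show ?thesis by blast
qed

end

section \<open>Duality\<close>

text \<open>Vector space duality reverses the arrows, and reflecting the vertices restores their
  direction. The result is again a representation of the same quiver.\<close>

definition dual :: "nat \<Rightarrow> 'k::field rep \<Rightarrow> 'k rep" where
  "dual n X = \<lparr>dimv = (\<lambda>i. dimv X (Suc n - i)), arr = (\<lambda>i. (arr X (n - i))\<^sup>T)\<rparr>"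

text \<open>For \<open>i > n + 1\<close> the truncated difference \<open>Suc n - i\<close> is \<open>0\<close>, a vertex at which padded representations
  vanish.\<close>

definition dual_fam :: "nat \<Rightarrow> (nat \<Rightarrow> 'k::field mat) \<Rightarrow> nat \<Rightarrow> 'k mat" where
  "dual_fam n s i = (s (Suc n - i))\<^sup>T"

definition dual_hom :: "nat \<Rightarrow> (nat \<Rightarrow> 'k::field mat) \<Rightarrow> nat \<Rightarrow> 'k mat" where
  "dual_hom n f = restrict (dual_fam n f) {1..n}"

lemma is_rep_dual: "is_rep n X \<Longrightarrow> is_rep n (dual n X)"
  unfolding is_rep_def
proof
  fix i assume X: "\<forall>i\<in>{1..<n}. arr X i \<in> carrier_mat (dimv X (i + 1)) (dimv X i)" and i: "i \<in> {1..<n}"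
  have "n - i \<in> {1..<n}" "n - i + 1 = Suc n - i" "Suc n - (i + 1) = n - i" using i by auto
  moreover from this have "arr X (n - i) \<in> carrier_mat (dimv X (n - i + 1)) (dimv X (n - i))"
    using X by blast
  ultimately show "arr (dual n X) i \<in> carrier_mat (dimv (dual n X) (i + 1)) (dimv (dual n X) i)"
    by (simp add: dual_def)
qed

lemma dimv_pad_dual: "dimv (pad_rep n (dual n X)) i = dimv (pad_rep n X) (Suc n - i)"
  by (auto simp: dimv_pad_rep dual_def)

lemma arr_pad_dual:
  assumes X: "is_rep n X" and i: "i \<le> n"
  shows "arr (pad_rep n (dual n X)) i = (arr (pad_rep n X) (n - i))\<^sup>T"
proof (cases "i \<in> {1..<n}")
  case True
  then have "n - i \<in> {1..<n}" by auto
  then show ?thesis using True by (simp add: arr_pad_rep(1) dual_def)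
next
  case False
  then have "n - i \<notin> {1..<n}" "Suc (n - i) = Suc n - i" using i by auto
  then show ?thesis using False
    by (simp add: arr_pad_rep(2) dimv_pad_dual del: atLeastLessThan_iff)
qed

lemma pad_rep_cong:
  assumes "\<And>i. i \<in> {1..n} \<Longrightarrow> dimv X i = dimv Y i" "\<And>i. i \<in> {1..<n} \<Longrightarrow> arr X i = arr Y i"
  shows "pad_rep n X = pad_rep n Y"
  using assms by (auto simp: pad_rep_def Let_def fun_eq_iff)

lemma pad_dual_dual: "pad_rep n (dual n (dual n X)) = pad_rep n X"
  by (rule pad_rep_cong) (auto simp: dual_def)

text \<open>The double dual agrees with the original only at the relevant indices, so it may differ
  as a record; the Hom sets are nevertheless equal.\<close>

lemma Hom_dual_dual:
  "Hom n (dual n (dual n X)) Y = Hom n X Y" "Hom n X (dual n (dual n Y)) = Hom n X Y"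
proof -
  have d: "dimv (dual n (dual n Z)) i = dimv Z i" if "i \<in> {1..n}" for i and Z :: "'a rep"
    using that by (simp add: dual_def)
  have a: "arr (dual n (dual n Z)) i = arr Z i" if "i \<in> {1..<n}" for i and Z :: "'a rep"
    using that by (simp add: dual_def)
  show "Hom n (dual n (dual n X)) Y = Hom n X Y" "Hom n X (dual n (dual n Y)) = Hom n X Y"
    unfolding Hom_def by (intro Collect_cong conj_cong ball_cong refl arg_cong2[of _ _ _ _ "(\<in>)"] PiE_cong; simp add: d a)+
qed

lemma mor_dual:
  assumes X: "is_rep n X" and Y: "is_rep n Y" and s: "mor (pad_rep n X) (pad_rep n Y) s"
  shows "mor (pad_rep n (dual n Y)) (pad_rep n (dual n X)) (dual_fam n s)"
proof (rule morI)
  note T = total_pad_rep[OF X] total_pad_rep[OF Y]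
  note [simp] = mor_dim[OF s] total_rep_dim[OF T(1)] total_rep_dim[OF T(2)]
  show dr: "dim_row (dual_fam n s i) = dimv (pad_rep n (dual n X)) i" for i
    by (simp add: dual_fam_def dimv_pad_dual)
  show dc: "dim_col (dual_fam n s i) = dimv (pad_rep n (dual n Y)) i" for i
    by (simp add: dual_fam_def dimv_pad_dual)
  fix i
  show "dual_fam n s (Suc i) * arr (pad_rep n (dual n Y)) i = arr (pad_rep n (dual n X)) i * dual_fam n s i"
  proof (cases "i \<le> n")
    case True
    then have "Suc n - i = Suc (n - i)" "Suc n - Suc i = n - i" by auto
    moreover have "(s (n - i))\<^sup>T * (arr (pad_rep n Y) (n - i))\<^sup>T =
      (arr (pad_rep n Y) (n - i) * s (n - i))\<^sup>T"
      by (subst transpose_mult) auto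
    moreover have "(arr (pad_rep n X) (n - i))\<^sup>T * (s (Suc (n - i)))\<^sup>T =
      (s (Suc (n - i)) * arr (pad_rep n X) (n - i))\<^sup>T"
      by (subst transpose_mult) auto
    ultimately show ?thesis
      using True by (simp add: dual_fam_def arr_pad_dual[OF X] arr_pad_dual[OF Y] mor_comm[OF s])
  next
    case False
    then show ?thesis
      using total_rep_dim[OF total_pad_rep[OF is_rep_dual[OF X]], of i]
        total_rep_dim[OF total_pad_rep[OF is_rep_dual[OF Y]], of i]
      by (intro mat_empty_eq) (simp_all add: dr dc, simp_all add: dimv_pad_rep)
  qed
qed

lemma Hom_dual:
  assumes X: "is_rep n X" and Y: "is_rep n Y" and f: "f \<in> Hom n X Y"
  shows "dual_hom n f \<in> Hom n (dual n Y) (dual n X)"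
proof -
  have "restrict (dual_fam n (pad_fam n f)) {1..n} \<in> Hom n (dual n Y) (dual n X)"
    by (rule Hom_restrict[OF mor_dual[OF X Y mor_pad_fam[OF X Y f]]])
  also have "restrict (dual_fam n (pad_fam n f)) {1..n} = dual_hom n f"
    unfolding dual_hom_def by (rule restrict_ext) (auto simp: dual_fam_def pad_fam_def)
  finally show ?thesis .
qed

lemma dual_hom_dual_hom: "f \<in> Hom n X Y \<Longrightarrow> dual_hom n (dual_hom n f) = f"
  by (rule ext) (auto simp: dual_hom_def dual_fam_def Hom_def restrict_def PiE_def extensional_def)

lemma dual_hom_comp:
  assumes f: "f \<in> Hom n X Y" and g: "g \<in> Hom n Y Z"
  shows "dual_hom n (comp_hom n g f) = comp_hom n (dual_hom n f) (dual_hom n g)"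
  unfolding dual_hom_def comp_hom_restrict
proof (rule restrict_ext)
  fix i assume "i \<in> {1..n}"
  then have i: "Suc n - i \<in> {1..n}" by auto
  then show "dual_fam n (comp_hom n g f) i = dual_fam n f i * dual_fam n g i"
    using Hom_dim[OF f i] Hom_dim[OF g i] unfolding dual_fam_def comp_hom_def
    by (simp del: One_nat_def) (rule transpose_mult, auto)
qed

text \<open>Transposition exchanges the two products in the coboundary equation, which accounts for
  the sign in \<open>s'\<close>.\<close>

lemma perp_dual:
  assumes X: "is_rep n X" and Y: "is_rep n Y" and p: "perp (pad_rep n X) (pad_rep n Y)"
  shows "perp (pad_rep n (dual n Y)) (pad_rep n (dual n X))"
  unfolding perp_def
proof
  let ?X = "pad_rep n X" and ?Y = "pad_rep n Y"
    and ?DX = "pad_rep n (dual n X)" and ?DY = "pad_rep n (dual n Y)"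
  note DX = is_rep_dual[OF X] and DY = is_rep_dual[OF Y]
  note T = total_pad_rep[OF X] total_pad_rep[OF Y] total_pad_rep[OF DX] total_pad_rep[OF DY]
  note [simp] = total_rep_dim[OF T(1)] total_rep_dim[OF T(2)] total_rep_dim[OF T(3)] total_rep_dim[OF T(4)]
  show "hom_zero ?DY ?DX"
    unfolding hom_zero_def
  proof (intro allI impI)
    fix s i assume s: "mor ?DY ?DX s"
    have "mor ?X ?Y (dual_fam n s)"
      using mor_dual[OF DY DX s] by (simp only: pad_dual_dual)
    then have z: "dual_fam n s j = 0\<^sub>m (dimv ?Y j) (dimv ?X j)" for j
      using hom_zeroD p unfolding perp_def by blast
    show "s i = 0\<^sub>m (dimv ?DX i) (dimv ?DY i)"
    proof (cases "i \<le> Suc n")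
      case True
      then have "(dual_fam n s (Suc n - i))\<^sup>T = s i" by (simp add: dual_fam_def)
      then show ?thesis unfolding z by (simp add: dimv_pad_dual)
    next
      case False
      then show ?thesis using mor_dim[OF s, of i] by (intro mat_empty_eq) (simp_all add: dimv_pad_rep)
    qed
  qed
  show "ext_zero ?DY ?DX"
  proof (rule ext_zeroI)
    fix h :: "nat \<Rightarrow> 'a mat"
    assume h: "\<And>i. dim_row (h i) = dimv ?DX (Suc i)" "\<And>i. dim_col (h i) = dimv ?DY i"
    \<comment> \<open>Arrow \<open>j\<close> corresponds to arrow \<open>n - j\<close> of the dual.
      Beyond \<open>n\<close> the padded spaces vanish.\<close>
    define h' where "h' j = (if j \<le> n then (h (n - j))\<^sup>T else 0\<^sub>m 0 0)" for j
    have h'd [simp]: "dim_row (h' j) = dimv ?Y (Suc j)" "dim_col (h' j) = dimv ?X j" for j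
      by (auto simp: h'_def h dimv_pad_dual Suc_diff_le) (auto simp: dimv_pad_rep)
    obtain s where [simp]: "\<And>i. dim_row (s i) = dimv ?Y i" "\<And>i. dim_col (s i) = dimv ?X i" and
      s: "\<And>i. s (Suc i) * arr ?X i = arr ?Y i * s i + h' i"
      by (rule ext_zeroD[of ?X ?Y h']) (use p in \<open>auto simp: perp_def\<close>)
    define s' where "s' i = - dual_fam n s i" for i
    have sd [simp]: "dim_row (s' i) = dimv ?DX i" "dim_col (s' i) = dimv ?DY i" for i
      by (simp_all add: s'_def dual_fam_def dimv_pad_dual)
    have "s' (Suc i) * arr ?DY i = arr ?DX i * s' i + h i" for i
    proof (cases "i \<le> n")
      case True
      define j where "j = n - i"
      have j: "Suc n - i = Suc j" "Suc n - Suc i = j" "n - j = i" "j \<le> n" using True by (auto simp: j_def)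
      have a: "arr ?DX i = (arr ?X j)\<^sup>T" "arr ?DY i = (arr ?Y j)\<^sup>T"
        using True by (simp_all add: arr_pad_dual[OF X] arr_pad_dual[OF Y] j_def)
      have hj: "h i = (h' j)\<^sup>T" using j by (simp add: h'_def)
      have "(arr ?X j)\<^sup>T * (s (Suc j))\<^sup>T = (s (Suc j) * arr ?X j)\<^sup>T"
        by (subst transpose_mult) auto
      also have "\<dots> = (arr ?Y j * s j)\<^sup>T + h i"
        unfolding s hj by (subst transpose_add) auto
      also have "(arr ?Y j * s j)\<^sup>T = (s j)\<^sup>T * (arr ?Y j)\<^sup>T"
        by (subst transpose_mult) auto
      finally have e: "(arr ?X j)\<^sup>T * (s (Suc j))\<^sup>T =
        (s j)\<^sup>T * (arr ?Y j)\<^sup>T + h i" .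
      have hd: "dim_row (h i) = dimv ?X j" "dim_col (h i) = dimv ?Y (Suc j)" by (simp_all add: hj)
      have "arr ?DX i * s' i + h i = - ((s j)\<^sup>T * (arr ?Y j)\<^sup>T + h i) + h i"
        by (simp add: a s'_def dual_fam_def j mat_mult_minus_right flip: e)
      also have "\<dots> = - ((s j)\<^sup>T * (arr ?Y j)\<^sup>T)"
        by (rule eq_matI) (simp_all add: hd)
      also have "\<dots> = s' (Suc i) * arr ?DY i"
        using j(2) by (simp add: a s'_def dual_fam_def mat_mult_minus_left)
      finally show ?thesis by (rule sym)
    next
      case False
      then show ?thesis by (intro mat_empty_eq) (simp_all add: h, simp_all add: dimv_pad_rep)
    qed
    then show "\<exists>s. coboundary ?DY ?DX s h"
        by (intro exI[of _ s']) (simp add: coboundary_def)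
  qed
qed

lemma perp_dual_iff:
  assumes X: "is_rep n X" and Y: "is_rep n Y"
  shows "perp (pad_rep n (dual n Y)) (pad_rep n (dual n X)) \<longleftrightarrow>
    perp (pad_rep n X) (pad_rep n Y)"
  using perp_dual[OF X Y] perp_dual[OF is_rep_dual[OF Y] is_rep_dual[OF X]]
  unfolding pad_dual_dual by blast

lemma dual_fam_mult:
  "dim_col (s (Suc n - i)) = dim_row (t (Suc n - i)) \<Longrightarrow>
    dual_fam n t i * dual_fam n s i = (s (Suc n - i) * t (Suc n - i))\<^sup>T"
  unfolding dual_fam_def by (subst transpose_mult) auto

lemma biproduct_dual:
  assumes E: "is_rep n E" and X: "is_rep n X" and Y: "is_rep n Y"
    and b: "biproduct (pad_rep n E) (pad_rep n X) (pad_rep n Y) i1 p1 i2 p2"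
  shows "biproduct (pad_rep n (dual n E)) (pad_rep n (dual n X)) (pad_rep n (dual n Y))
    (dual_fam n p1) (dual_fam n i1) (dual_fam n p2) (dual_fam n i2)"
proof -
  let ?E = "pad_rep n E" and ?X = "pad_rep n X" and ?Y = "pad_rep n Y"
  from b have m: "mor ?X ?E i1" "mor ?E ?X p1" "mor ?Y ?E i2" "mor ?E ?Y p2"
    and e: "p1 i * i1 i = 1\<^sub>m (dimv ?X i)" "p2 i * i2 i = 1\<^sub>m (dimv ?Y i)"
      "p1 i * i2 i = 0\<^sub>m (dimv ?X i) (dimv ?Y i)" "p2 i * i1 i = 0\<^sub>m (dimv ?Y i) (dimv ?X i)"
      "i1 i * p1 i + i2 i * p2 i = 1\<^sub>m (dimv ?E i)" for i
    by (auto simp: biproduct_def)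
  note [simp] = m[THEN mor_dim(1)] m[THEN mor_dim(2)]
  have "(i1 i * p1 i)\<^sup>T + (i2 i * p2 i)\<^sup>T = 1\<^sub>m (dimv ?E i)" for i
    using arg_cong[OF e(5), of transpose_mat i] by (subst (asm) transpose_add) auto
  then show ?thesis
    unfolding biproduct_def
    using mor_dual[OF X E m(1)] mor_dual[OF E X m(2)] mor_dual[OF Y E m(3)] mor_dual[OF E Y m(4)]
    by (simp add: dual_fam_mult e dimv_pad_dual)
qed

text \<open>Additivity in the second argument is additivity in the first for the dual
  modules.\<close>

lemma perp_dsum_right:
  assumes "\<forall>M\<in>set Ms. is_rep n M" and X: "is_rep n X"
  shows "perp (pad_rep n X) (pad_rep n (dsum Ms)) \<longleftrightarrow>
    (\<forall>M\<in>set Ms. perp (pad_rep n X) (pad_rep n M))"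
  using assms(1)
proof (induction Ms)
  case Nil
  show ?case
    using perp_zero[OF _ total_pad_rep[OF X] total_pad_rep[OF is_rep_dsum[of "[]" n]]]
    by (auto simp: pad_rep_dsum_Nil)
next
  case (Cons M Ms)
  then have r: "is_rep n M" "is_rep n (dsum Ms)" "is_rep n (dsum (M # Ms))"
    using is_rep_dsum[of Ms n] is_rep_dsum[of "M # Ms" n] by auto
  note T = total_pad_rep[OF is_rep_dual]
  have "pad_rep n (dsum (M # Ms)) = direct_sum (pad_rep n M) (pad_rep n (dsum Ms))"
    using Cons.prems by (intro pad_rep_dsum_Cons) auto
  then show ?case
    using perp_biproduct_left[OF T[OF r(3)] T[OF r(1)] T[OF r(2)] T[OF X] biproduct_dual[OF r(3,1,2)]]
      direct_sum_biproduct[OF r(1,2)[THEN total_pad_rep]] Cons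
    by (simp add: perp_dual_iff X r)
qed

lemma left_perp_dsum_iff:
  assumes "\<forall>M\<in>set Ms. is_rep n M"
  shows "X \<in> left_perp n (dsum Ms) \<longleftrightarrow>
    is_rep n X \<and> (\<forall>M\<in>set Ms. perp (pad_rep n X) (pad_rep n M))"
  using perp_dsum_right[OF assms, of X]
  by (auto simp: left_perp_def Hom_vanishes_iff Ext_vanishes_iff is_rep_dsum[OF assms] perp_def)

lemma iso_pair_dual:
  assumes X: "is_rep n X" and Y: "is_rep n Y" and uv: "iso_pair (pad_rep n X) (pad_rep n Y) u v"
  shows "iso_pair (pad_rep n (dual n X)) (pad_rep n (dual n Y)) (dual_fam n v) (dual_fam n u)"
proof -
  note u = iso_pairD(1)[OF uv] and v = iso_pairD(2)[OF uv]
  show ?thesis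
    unfolding iso_pair_def using mor_dual[OF X Y u] mor_dual[OF Y X v] iso_pairD(3,4)[OF uv]
    by (simp add: dual_fam_mult dimv_pad_dual mor_dim[OF u] mor_dim[OF v])
qed

text \<open>The last vertex \<open>b - 1\<close> of the support is reflected to
  \<open>n + 2 - b\<close>, the new first one.\<close>

lemma pad_dual_interval:
  assumes "1 \<le> a" "a < b" "b \<le> Suc n"
  shows "pad_rep n (dual n (interval_rep a b)) =
    (interval_rep (Suc (Suc n) - b) (Suc (Suc n) - a) :: 'k::field rep)"
proof -
  let ?I = "interval_rep a b :: 'k rep" and ?J = "interval_rep (Suc (Suc n) - b) (Suc (Suc n) - a) :: 'k rep"
  have "pad_rep n (dual n ?I) = pad_rep n ?J"
  proof (rule pad_rep_cong)
    have d: "dimv (dual n ?I) i = dimv ?J i" if "i \<le> n" for i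
      using assms that by (auto simp: dual_def dimv_interval)
    then show "dimv (dual n ?I) i = dimv ?J i" if "i \<in> {1..n}" for i using that by simp
    fix i assume i: "i \<in> {1..<n}"
    then have "Suc n - i = Suc (n - i)" "Suc n - Suc i = n - i" by auto
    moreover have "arr (interval_rep c e :: 'k rep) k =
      mat (dimv (interval_rep c e :: 'k rep) (Suc k)) (dimv (interval_rep c e :: 'k rep) k) (\<lambda>_. 1)" for c e k
      by (simp add: interval_rep_def Let_def)
    ultimately show "arr (dual n ?I) i = arr ?J i"
      using d[of i] d[of "Suc i"] i by (intro eq_matI) (auto simp: dual_def)
  qed
  also have "\<dots> = ?J" using assms by (intro pad_rep_interval_rep) auto
  finally show ?thesis .
qed

text \<open>Duality maps each of the two categories into the other, so a monomorphism of the first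
  becomes an epimorphism of the second. Only the set of \<open>Ns\<close> is prescribed, since
  perpendicularity to a direct sum ignores the order of the summands.\<close>

lemma injective_dual:
  fixes Ms Ns :: "'k::field rep list"
  assumes Ms: "\<forall>M\<in>set Ms. is_rep n M" and Ns: "set Ns = dual n ` set Ms" and I: "I \<in> left_perp n (dsum Ms)"
    and P: "projective_object n (right_perp n (dsum Ns)) (dual n I)"
  shows "injective_object n (left_perp n (dsum Ms)) I"
  unfolding injective_object_def
proof (intro conjI ballI allI impI I)
  let ?C = "left_perp n (dsum Ms)" and ?D = "right_perp n (dsum Ns)"
  have Ns': "\<forall>N\<in>set Ns. is_rep n N" using Ms Ns is_rep_dual by auto
  have CD: "dual n X \<in> ?D" if X: "X \<in> ?C" for X
    using X Ms Ns perp_dual is_rep_dual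
    unfolding left_perp_dsum_iff[OF Ms] right_perp_dsum_iff[OF Ns'] by fastforce
  have DC: "dual n W \<in> ?C" if W: "W \<in> ?D" for W
    unfolding left_perp_dsum_iff[OF Ms]
  proof (intro conjI ballI)
    have rW: "is_rep n W" using W unfolding right_perp_dsum_iff[OF Ns'] by blast
    then show "is_rep n (dual n W)" by (rule is_rep_dual)
    fix M assume M: "M \<in> set Ms"
    then have "perp (pad_rep n (dual n M)) (pad_rep n W)"
      using W Ns unfolding right_perp_dsum_iff[OF Ns'] by blast
    from perp_dual[OF is_rep_dual rW this]
    show "perp (pad_rep n (dual n W)) (pad_rep n M)"
      using M Ms by (simp add: pad_dual_dual)
  qed
  have rC: "is_rep n X" if "X \<in> ?C" for X using that unfolding left_perp_dsum_iff[OF Ms] by blast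
  have rD: "is_rep n W" if "W \<in> ?D" for W using that unfolding right_perp_dsum_iff[OF Ns'] by blast
  fix X Y f g assume X: "X \<in> ?C" and Y: "Y \<in> ?C" and f: "mono_in n ?C X Y f" and g: "g \<in> Hom n X I"
  have fH: "f \<in> Hom n X Y" using f by (simp add: mono_in_def)
  have fD: "dual_hom n f \<in> Hom n (dual n Y) (dual n X)" by (rule Hom_dual[OF rC[OF X] rC[OF Y] fH])
  have "epi_in n ?D (dual n Y) (dual n X) (dual_hom n f)"
    unfolding epi_in_def
  proof (intro conjI ballI impI fD)
    fix W s t assume W: "W \<in> ?D" and s: "s \<in> Hom n (dual n X) W" and t: "t \<in> Hom n (dual n X) W"
      and eq: "comp_hom n s (dual_hom n f) = comp_hom n t (dual_hom n f)"
    have *: "dual_hom n r \<in> Hom n (dual n W) X \<and>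
        dual_hom n (comp_hom n r (dual_hom n f)) = comp_hom n f (dual_hom n r)"
      if "r \<in> Hom n (dual n X) W" for r
      using Hom_dual[OF is_rep_dual[OF rC[OF X]] rD[OF W] that] dual_hom_comp[OF fD that]
      by (simp add: Hom_dual_dual dual_hom_dual_hom[OF fH])
    have "dual_hom n s = dual_hom n t"
      using *[OF s] *[OF t] eq f DC[OF W] unfolding mono_in_def by metis
    then have "dual_hom n (dual_hom n s) = dual_hom n (dual_hom n t)" by simp
    then show "s = t" by (simp add: dual_hom_dual_hom[OF s] dual_hom_dual_hom[OF t])
  qed
  moreover have "dual_hom n g \<in> Hom n (dual n I) (dual n X)" by (rule Hom_dual[OF rC[OF X] rC[OF I] g])
  ultimately obtain h where h: "h \<in> Hom n (dual n I) (dual n Y)" "comp_hom n (dual_hom n f) h = dual_hom n g"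
    using P CD[OF X] CD[OF Y] unfolding projective_object_def by blast
  have "dual_hom n h \<in> Hom n Y I"
    using Hom_dual[OF is_rep_dual[OF rC[OF I]] is_rep_dual[OF rC[OF Y]] h(1)] by (simp add: Hom_dual_dual)
  moreover have "comp_hom n (dual_hom n h) f = g"
    using dual_hom_comp[OF h(1) fD] by (simp add: h(2) dual_hom_dual_hom[OF fH] dual_hom_dual_hom[OF g])
  ultimately show "\<exists>h\<in>Hom n Y I. comp_hom n h f = g" by blast
qed

text \<open>Stated for arbitrary endpoint functions, so that it applies to the dual sequence as
  well.\<close>

lemma relatively_projective_interval:
  fixes Es :: "'k::field rep list"
  assumes len: "length Es = n" and rep: "\<And>j. j < n \<Longrightarrow> is_rep n (Es ! j)"
    and iso: "\<And>j. j < n \<Longrightarrow> \<exists>u v. iso_pair (pad_rep n (Es ! j)) (interval_rep (a j) (b j)) u v"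
    and ab: "\<And>j. j < n \<Longrightarrow> 1 \<le> a j \<and> a j < b j \<and> b j \<le> Suc n"
    and perp: "\<And>i j. i < j \<Longrightarrow> j < n \<Longrightarrow> perp (pad_rep n (Es ! j)) (pad_rep n (Es ! i))"
    and i: "i < n" and R: "R = {(a j, b j) | j. i < j \<and> j < n}"
    and pq: "p < a i" "(p, q) \<in> R \<or> (p, q) = (0, Suc n)" "(b i, q) \<in> R\<^sup>*"
  shows "relatively_projective n Es i"
proof -
  have set: "set (drop (Suc i) Es) = {Es ! j | j. i < j \<and> j < n}"
  proof (intro equalityI subsetI)
    fix E assume "E \<in> set (drop (Suc i) Es)"
    then obtain k where "k < n - Suc i" "E = Es ! (Suc i + k)"
      using len by (auto simp: in_set_conv_nth)
    then show "E \<in> {Es ! j | j. i < j \<and> j < n}" by (auto intro!: exI[of _ "Suc i + k"])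
  next
    fix E assume "E \<in> {Es ! j | j. i < j \<and> j < n}"
    then obtain j where "i < j" "j < n" "E = Es ! j" by blast
    then show "E \<in> set (drop (Suc i) Es)"
      using len by (auto simp: in_set_conv_nth intro!: exI[of _ "j - Suc i"])
  qed
  have rep': "\<forall>M\<in>set (drop (Suc i) Es). is_rep n M" using rep set by auto
  have iff: "perp (pad_rep n (Es ! j)) (pad_rep n Y) \<longleftrightarrow> mat_iso (path_map (pad_rep n Y) (a j) (b j))"
    if j: "j < n" and Y: "is_rep n Y" for j Y
  proof -
    obtain u v where "iso_pair (pad_rep n (Es ! j)) (interval_rep (a j) (b j)) u v" using iso[OF j] by blast
    from perp_iso_left[OF total_pad_rep[OF rep[OF j]] total_interval
        total_pad_rep[OF Y] this]
    show ?thesis using perp_interval_iff[OF total_pad_rep[OF Y]] ab[OF j] by blast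
  qed
  have C: "right_perp n (dsum (drop (Suc i) Es)) = path_inverting n R"
  proof (rule Set.set_eqI)
    fix Y
    show "Y \<in> right_perp n (dsum (drop (Suc i) Es)) \<longleftrightarrow> Y \<in> path_inverting n R"
      unfolding right_perp_dsum_iff[OF rep'] path_inverting_def set R using iff by fastforce
  qed
  have "Es ! i \<in> right_perp n (dsum (drop (Suc i) Es))"
    unfolding right_perp_dsum_iff[OF rep'] set using rep[OF i] perp by blast
  moreover obtain u v where "iso_pair (pad_rep n (Es ! i)) (interval_rep (a i) (b i)) u v" using iso[OF i] by blast
  ultimately show ?thesis
    unfolding relatively_projective_def C
    by (intro interval_projective[of R _ n "a i" "b i" u v p q]) (use ab[OF i] ab pq R in auto)
qed

text \<open>\<open>Fs\<close> is the dual sequence in reverse order, with \<open>r\<close>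
  translating positions. Its graph is the reflection of the original one by x -> n + 2 - x, which
  exchanges earlier and later edges.\<close>

lemma relatively_injective_interval:
  fixes Es :: "'k::field rep list"
  assumes len: "length Es = n" and rep: "\<And>j. j < n \<Longrightarrow> is_rep n (Es ! j)"
    and iso: "\<And>j. j < n \<Longrightarrow> \<exists>u v. iso_pair (pad_rep n (Es ! j)) (interval_rep (a j) (b j)) u v"
    and ab: "\<And>j. j < n \<Longrightarrow> 1 \<le> a j \<and> a j < b j \<and> b j \<le> Suc n"
    and perp: "\<And>i j. i < j \<Longrightarrow> j < n \<Longrightarrow> perp (pad_rep n (Es ! j)) (pad_rep n (Es ! i))"
    and i: "i < n" and R: "R = {(a j, b j) | j. j < i}"
    and pq: "b i < q" "(p, q) \<in> R \<or> (p, q) = (1, Suc (Suc n))" "(p, a i) \<in> R\<^sup>*"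
  shows "relatively_injective n Es i"
proof -
  define Fs where "Fs = map (dual n) (rev Es)"
  define r where "r j = n - Suc j" for j
  define a' where "a' j = Suc (Suc n) - b (r j)" for j
  define b' where "b' j = Suc (Suc n) - a (r j)" for j
  have r: "r j < n" "r (r j) = j" if "j < n" for j using that by (auto simp: r_def)
  have F: "Fs ! j = dual n (Es ! r j)" if "j < n" for j
    using that len by (simp add: Fs_def rev_nth r_def)
  have repF: "is_rep n (Fs ! j)" if "j < n" for j using that F r rep is_rep_dual by metis
  have isoF: "\<exists>u v. iso_pair (pad_rep n (Fs ! j)) (interval_rep (a' j) (b' j)) u v" if j: "j < n" for j
  proof -
    let ?I = "interval_rep (a (r j)) (b (r j)) :: 'k rep"
    have abr: "1 \<le> a (r j)" "a (r j) < b (r j)" "b (r j) \<le> Suc n" using ab[OF r(1)[OF j]] by auto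
    obtain u v where "iso_pair (pad_rep n (Es ! r j)) ?I u v" using iso[OF r(1)[OF j]] by blast
    then have "iso_pair (pad_rep n (Es ! r j)) (pad_rep n ?I) u v"
      using abr by (simp add: pad_rep_interval_rep)
    from iso_pair_dual[OF rep[OF r(1)[OF j]] is_rep_total_rep[OF total_interval] this]
    show ?thesis unfolding F[OF j] a'_def b'_def pad_dual_interval[OF abr] by blast
  qed
  have abF: "1 \<le> a' j \<and> a' j < b' j \<and> b' j \<le> Suc n" if "j < n" for j
    using ab[OF r(1)[OF that]] by (auto simp: a'_def b'_def)
  have perpF: "perp (pad_rep n (Fs ! k)) (pad_rep n (Fs ! j))" if "j < k" "k < n" for j k
  proof -
    have "r k < r j" "r j < n" "j < n" using that by (auto simp: r_def)
    then show ?thesis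
      using perp_dual[OF rep rep perp, of "r j" "r k"] that F[of j] F[of k] r[of j] r[of k] by simp
  qed
  \<comment> \<open>The reflection turns the artificial edge \<open>(1, n + 2)\<close> into
    \<open>(0, n + 1)\<close>.\<close>
  have "relatively_projective n Fs (r i)"
  proof (rule relatively_projective_interval[of Fs n a' b' "r i" _ "Suc (Suc n) - q" "Suc (Suc n) - p"])
    let ?R = "{(a' j, b' j) | j. r i < j \<and> j < n}"
    have Rd: "(Suc (Suc n) - d, Suc (Suc n) - c) \<in> ?R" if "(c, d) \<in> R" for c d
    proof -
      obtain j where j: "j < i" "c = a j" "d = b j" using \<open>(c, d) \<in> R\<close> R by blast
      then have "r i < r j" "r j < n" "r (r j) = j" using i r[of j] by (auto simp: r_def)
      then show ?thesis
        using j by (auto simp: a'_def b'_def intro!: exI[of _ "r j"])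
    qed
    \<comment> \<open>The subtraction is truncated; strictness needs
      \<open>b i \<le> Suc n\<close>.\<close>
    show "Suc (Suc n) - q < a' (r i)" unfolding a'_def r(2)[OF i] using pq(1) ab[OF i] by arith
    show "(Suc (Suc n) - q, Suc (Suc n) - p) \<in> ?R \<or> (Suc (Suc n) - q, Suc (Suc n) - p) = (0, Suc n)"
      using pq(2) Rd by auto
    have e: "b' (r i) = Suc (Suc n) - a i" by (simp add: b'_def r(2)[OF i])
    \<comment> \<open>Every edge is reversed by \<open>Rd\<close>, so the reflected path is built
      from its last edge backwards.\<close>
    show "(b' (r i), Suc (Suc n) - p) \<in> ?R\<^sup>*"
      unfolding e using pq(3)
    proof (induction rule: rtrancl_induct)
      case (step y z)
      show ?case by (rule converse_rtrancl_into_rtrancl[OF Rd[OF step.hyps(2)] step.IH])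
    qed simp
  qed (use len repF isoF abF perpF r(1)[OF i] in \<open>auto simp: Fs_def\<close>)
  then have P: "projective_object n (right_perp n (dsum (drop (Suc (r i)) Fs))) (dual n (Es ! i))"
    unfolding relatively_projective_def using F[OF r(1)[OF i]] r(2)[OF i] by simp
  have "drop (Suc (r i)) Fs = map (dual n) (rev (take i Es))"
    using i len by (simp add: Fs_def r_def drop_map drop_rev Suc_diff_Suc)
  then have Ns: "set (drop (Suc (r i)) Fs) = dual n ` set (take i Es)" by simp
  have "set (take i Es) = (!) Es ` {0..<i}" using nth_image[of i Es] i len by simp
  then have T: "set (take i Es) = {Es ! j | j. j < i}" by auto
  have rep': "\<forall>M\<in>set (take i Es). is_rep n M" using rep T i by auto
  have "Es ! i \<in> left_perp n (dsum (take i Es))"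
    unfolding left_perp_dsum_iff[OF rep'] T using rep[OF i] perp i by blast
  from injective_dual[OF rep' Ns this P] show ?thesis by (simp add: relatively_injective_def)
qed

theorem corollaryB:
  fixes n :: nat and Es :: "'k::field rep list"
  assumes "n \<ge> 1"
    and "complete_exceptional_sequence n Es"
  shows "(\<forall>i<n. relatively_projective n Es i \<or> relatively_injective n Es i) \<and>
         (\<exists>i<n. relatively_projective n Es i \<and> relatively_injective n Es i)"
proof -
  have len: "length Es = n" and rep: "\<And>j. j < n \<Longrightarrow> is_rep n (Es ! j)"
    and ind: "\<And>j. j < n \<Longrightarrow> indecomposable n (Es ! j)"
    using assms(2) by (auto simp: complete_exceptional_sequence_def)
  have perp: "perp (pad_rep n (Es ! j)) (pad_rep n (Es ! i))" if "i < j" "j < n" for i j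
  proof -
    have r: "is_rep n (Es ! j)" "is_rep n (Es ! i)" using that by (auto intro: rep)
    show ?thesis
      using assms(2) that unfolding perp_def Hom_vanishes_iff[OF r, symmetric] Ext_vanishes_iff[OF r, symmetric]
      by (simp add: complete_exceptional_sequence_def)
  qed
  have "\<forall>j. \<exists>a b. j < n \<longrightarrow> 1 \<le> a \<and> a < b \<and> b \<le> Suc n \<and>
      (\<exists>u v. iso_pair (pad_rep n (Es ! j)) (interval_rep a b) u v)"
    using indecomposable_interval[OF rep ind] by metis
  then obtain a b where ab: "\<And>j. j < n \<Longrightarrow> 1 \<le> a j \<and> a j < b j \<and> b j \<le> Suc n"
    and iso: "\<And>j. j < n \<Longrightarrow> \<exists>u v. iso_pair (pad_rep n (Es ! j)) (interval_rep (a j) (b j)) u v"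
    by metis
  interpret exceptional_intervals n a b
  proof
    show "1 \<le> a i \<and> a i < b i \<and> b i \<le> Suc n" if "i < n" for i using ab[OF that] .
    fix i j assume ij: "i < j" "j < n"
    then have "i < n" by simp
    let ?I = "interval_rep (a i) (b i) :: 'k rep" and ?J = "interval_rep (a j) (b j) :: 'k rep"
    obtain u v u' v' where u: "iso_pair (pad_rep n (Es ! i)) ?I u v" "iso_pair (pad_rep n (Es ! j)) ?J u' v'"
      using iso[OF \<open>i < n\<close>] iso[OF ij(2)] by blast
    note T = total_pad_rep[OF rep[OF \<open>i < n\<close>]]
    have "perp ?J (pad_rep n (Es ! i))"
      using perp[OF ij] perp_iso_left[OF total_pad_rep[OF rep[OF ij(2)]] total_interval T u(2)]
      by blast
    then have "mat_iso (path_map (pad_rep n (Es ! i)) (a j) (b j))"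
      using perp_interval_iff[OF T] ab[OF ij(2)] by blast
    from mat_iso_dim_zero[OF this]
    have "dimv (pad_rep n (Es ! i)) (a j) = 0 \<longleftrightarrow> dimv (pad_rep n (Es ! i)) (b j) = 0"
      using path_map_dim[OF T, of "a j" "b j"] ab[OF ij(2)] by auto
    \<comment> \<open>The isomorphism replaces \<open>Es ! i\<close> by its interval module, whose
      dimensions are explicit.\<close>
    moreover have "dimv (pad_rep n (Es ! i)) x = 0 \<longleftrightarrow> dimv ?I x = 0" for x
      using mat_iso_dim_zero[OF mat_isoI[of "v x" "u x"]] iso_pairD[OF u(1)]
      by (simp add: mor_dim mor_carrier)
    ultimately show "(a i \<le> a j \<and> a j < b i) \<longleftrightarrow> (a i \<le> b j \<and> b j < b i)"
      by (auto simp: dimv_interval split: if_splits)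
  qed
  have "relatively_projective n Es i" if i: "i < n" and c: "proj_condition i" for i
  proof -
    obtain p q where "p < a i" "(p, q) \<in> later i \<or> (p, q) = (0, Suc n)" "(b i, q) \<in> (later i)\<^sup>*"
      using c unfolding proj_condition_def by blast
    note pq = this
    show ?thesis
      by (rule relatively_projective_interval[OF len _ _ _ _ i later_def pq]) (rule rep iso ab perp; assumption)+
  qed
  moreover have "relatively_injective n Es i" if i: "i < n" and c: "inj_condition i" for i
  proof -
    obtain p q where "b i < q" "(p, q) \<in> earlier i \<or> (p, q) = (1, Suc (Suc n))" "(p, a i) \<in> (earlier i)\<^sup>*"
      using c unfolding inj_condition_def by blast
    note pq = this
    show ?thesis
      by (rule relatively_injective_interval[OF len _ _ _ _ i earlier_def pq]) (rule rep iso ab perp; assumption)+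
  qed
  ultimately show ?thesis using projective_or_injective_conditions[OF assms(1)] by blast
qed

end
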